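(* Let $\mathcal{M}=(S,A,P,s_0)$ be a Markov decision process, let $R^{\mathcal{A}}\subseteq S$ be a set of absorbing states, let $\nu^{\mathcal{A}}\in[0,1]$, and let $\pi^{\mathcal{S}}$ be a stationary (reference) policy on $\mathcal{M}$. Consider the problem $$\text{(I)}\qquad \inf_{\pi\in\Pi(\mathcal{M})}\ KL\left(\Gamma^{\pi}_{\mathcal{M}}\,\|\,\Gamma^{\pi^{\mathcal{S}}}_{\mathcal{M}}\right)\quad\text{subject to}\quad {\Pr}^{\pi}_{\mathcal{M}}(s_0\models\lozenge R^{\mathcal{A}})\ge\nu^{\mathcal{A}},$$ and assume its optimal value is finite. Let $C^{cl}$ be the union of all closed communicating classes of the Markov chain induced by $\pi^{\mathcal{S}}$, let $S_d=S\setminus(C^{cl}\cup R^{\mathcal{A}})$, and consider the optimization problem in the real variables $x^{\mathcal{A}}_{s,a}$, $s\in S_d$, $a\in A(s)$: $$\text{(II)}\qquad \inf\ \sum_{s\in S_d}\sum_{a\in A(s)}\sum_{q\in Succ(s)}x^{\mathcal{A}}_{s,a}P_{s,a,q}\log\left(\frac{\sum_{a'\in A(s)}x^{\mathcal{A}}_{s,a'}P_{s,a',q}}{\pi^{\mathcal{S}}_{s,q}\sum_{a'\in A(s)}x^{\mathcal{A}}_{s,a'}}\right)$$ subject to $$x^{\mathcal{A}}_{s,a}\ge0\quad\forall s\in S_d,\ a\in A(s),$$ $$\sum_{a\in A(s)}x^{\mathcal{A}}_{s,a}-\sum_{q\in S_d}\sum_{a\in A(q)}x^{\mathcal{A}}_{q,a}P_{q,a,s}=\mathds{1}_{s_0}(s)\quad\forall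 s\in S_d,$$ $$\sum_{q\in R^{\mathcal{A}}}\Big(\sum_{s\in S_d}\sum_{a\in A(s)}x^{\mathcal{A}}_{s,a}P_{s,a,q}+\mathds{1}_{s_0}(q)\Big)\ge\nu^{\mathcal{A}}.$$ Then (II) is a convex optimization problem that has the same optimal value as (I). Furthermore, there exists a stationary policy $\pi\in\Pi^{St}(\mathcal{M})$ that attains the optimal value of (II), i.e. whose state-action occupation measures on $S_d$ are feasible for (II) and attain its optimal value.
   Context: A Markov decision process (MDP) is a tuple $\mathcal{M}=(S,A,P,s_0)$ with finite state set $S$, finite action set $A$, transition function $P:S\times A\times S\to[0,1]$ (write $P_{s,a,q}=P(s,a,q)$) and initial state $s_0$; $A(s)$ is the set of actions available at $s$, and $\sum_{q\in S}P_{s,a,q}=1$ for $a\in A(s)$. $Succ(s)$ is the set of states $q$ with $P_{s,a,q}>0$ for some $a\in A(s)$. A state $s$ is absorbing if $P_{s,a,s}=1$ for all $a\in A(s)$. A history at time $t$ is $h_t=s_0a_0s_1\ldots s_{t-1}a_{t-1}s_t$. A policy is a sequence $\pi=\mu_0\mu_1\ldots$ where $\mu_t$ assigns to each history $h_t$ a probability distribution $\mu_t(h_t,\cdot)$ on $A(s_t)$; $\Pi(\mathcal{M})$ is the set of all policies. A stationary policy is $\pi=\mu\mu\ldots$ with $\mu(s,\cdot)$ a (possibly randomized) probability distribution on $A(s)$ depending only on the current state; write $\pi_{s,a}=\mu(s,a)$; $\Pi^{St}(\mathcal{M})$ is the set of stationary policies. A stationary policy $\pi$ induces a Markov chain on $S$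 with transition probabilities $\sum_{a\in A(s)}P_{s,a,q}\pi_{s,a}$; for the reference policy these are denoted $\pi^{\mathcal{S}}_{s,q}$. A communicating class of the chain is a set of mutually accessible states; it is closed if no state outside it is accessible from it. A path is an infinite sequence of states $s_0s_1s_2\ldots$ (actions are not recorded); $\Gamma^{\pi}_{\mathcal{M}}$ is the distribution of paths under $\pi$. $KL(Q_1\|Q_2)\in[0,\infty]$ is the Kullback--Leibler divergence with natural logarithm, for discrete distributions $\sum_x Q_1(x)\log(Q_1(x)/Q_2(x))$, where a term is $0$ if $Q_1(x)=0$ and $\infty$ if $Q_1(x)>0=Q_2(x)$; for path distributions it is the relative entropy of the measures on infinite state sequences, equivalently the limit as $k\to\infty$ of the KL divergences between the distributions of the first $k+1$ states. The same conventions apply in (II): for each $(s,q)$, the sum over $a$ of the terms is $0$ if $\sum_{a}x^{\mathcal{A}}_{s,a}P_{s,a,q}=0$, and is $\infty$ if this sum is positive and $\pi^{\mathcal{S}}_{s,q}=0$. $\Pr^{\pi}_{\mathcal{M}}(s_0\models\lozenge R)$ is the probability under $\pi$ that the path visits some state of $R$. The state-action occupation measure of $\pi$ at $(s,a)$ is the expected number of times that action $a$ is taken at state $s$ along a path under $\pi$. $\mathds{1}_{y}(x)=1$ if $x=y$ and $0$ otherwise. A convex optimization problem is the minimization of a convex (extended-real-valued) function over a set given by affine equalities and inequalities (or, more generally, convex inequalities). *)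

theory Defs
  imports "HOL-Probability.Probability"
begin

text \<open>
  The state and action sets are finite types. The values \<open>tprob M s a q\<close> with
  \<open>a \<notin> avail M s\<close> are never used.
\<close>

record ('s, 'a) mdp =
  avail :: "'s \<Rightarrow> 'a set"
  tprob :: "'s \<Rightarrow> 'a \<Rightarrow> 's \<Rightarrow> real"
  start :: 's

definition is_mdp :: "('s::finite, 'a::finite) mdp \<Rightarrow> bool" where
  "is_mdp M \<longleftrightarrow>
    (\<forall>s a q. 0 \<le> tprob M s a q \<and> tprob M s a q \<le> 1) \<and>
    (\<forall>s. \<forall>a\<in>avail M s. (\<Sum>q\<in>UNIV. tprob M s a q) = 1)"

definition Succ :: "('s, 'a) mdp \<Rightarrow> 's \<Rightarrow> 's set" where
  "Succ M s = {q. \<exists>a\<in>avail M s. tprob M s a q > 0}"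

definition absorbing :: "('s, 'a) mdp \<Rightarrow> 's \<Rightarrow> bool" where
  "absorbing M s \<longleftrightarrow> (\<forall>a\<in>avail M s. tprob M s a s = 1)"

text \<open>
  The history \<open>s\<^sub>0 a\<^sub>0 \<dots> s\<^bsub>t-1\<^esub> a\<^bsub>t-1\<^esub> s\<^sub>t\<close> is represented by the list
  \<open>[(s\<^sub>0, a\<^sub>0), \<dots>, (s\<^bsub>t-1\<^esub>, a\<^bsub>t-1\<^esub>)]\<close> together with the state \<open>s\<^sub>t\<close>;
  the time \<open>t\<close> is the length of the list.
\<close>

type_synonym ('s, 'a) policy = "('s \<times> 'a) list \<Rightarrow> 's \<Rightarrow> 'a pmf"

definition policies :: "('s, 'a) mdp \<Rightarrow> ('s, 'a) policy set" where
  "policies M = {\<pi>. \<forall>h s. set_pmf (\<pi> h s) \<subseteq> avail M s}"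

definition stationary_policies :: "('s, 'a) mdp \<Rightarrow> ('s \<Rightarrow> 'a pmf) set" where
  "stationary_policies M = {\<mu>. \<forall>s. set_pmf (\<mu> s) \<subseteq> avail M s}"

definition stationary :: "('s \<Rightarrow> 'a pmf) \<Rightarrow> ('s, 'a) policy" where
  "stationary \<mu> = (\<lambda>h s. \<mu> s)"

lemma stationary_in_policies:
  "\<mu> \<in> stationary_policies M \<Longrightarrow> stationary \<mu> \<in> policies M"
  by (auto simp: stationary_policies_def policies_def stationary_def)

text \<open>
  The distribution of the state-action pair at time \<open>t\<close> given the earlier ones. For an MDP and
  \<open>a \<in> avail M s\<close> the function \<open>tprob M s a\<close> is a probability mass function, so that
  \<^const>\<open>embed_pmf\<close> turns it into the corresponding distribution.
\<close>

definition trajectory_kernel ::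
    "('s::finite, 'a::finite) mdp \<Rightarrow> ('s, 'a) policy \<Rightarrow> nat \<Rightarrow> (nat \<Rightarrow> 's \<times> 'a) \<Rightarrow> ('s \<times> 'a) pmf" where
  "trajectory_kernel M \<pi> t \<omega> =
    bind_pmf
      (case t of
         0 \<Rightarrow> return_pmf (start M)
       | Suc k \<Rightarrow> embed_pmf (tprob M (fst (\<omega> k)) (snd (\<omega> k))))
      (\<lambda>s. map_pmf (Pair s) (\<pi> (map \<omega> [0..<t]) s))"

text \<open>
  The joint law of all state-action pairs is the Ionescu-Tulcea limit of these kernels; lemma
  \<open>emeasure_trajectories_cylinder\<close> below gives its values on cylinders.
\<close>

definition trajectories ::
    "('s::finite, 'a::finite) mdp \<Rightarrow> ('s, 'a) policy \<Rightarrow> (nat \<Rightarrow> 's \<times> 'a) measure" where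
  "trajectories M \<pi> =
    projective_family.lim UNIV
      (Ionescu_Tulcea.CI (\<lambda>t \<omega>. measure_pmf (trajectory_kernel M \<pi> t \<omega>)) (\<lambda>_. count_space UNIV))
      (\<lambda>_. count_space UNIV)"

definition paths ::
    "('s::finite, 'a::finite) mdp \<Rightarrow> ('s, 'a) policy \<Rightarrow> (nat \<Rightarrow> 's) measure" where
  "paths M \<pi> =
    distr (trajectories M \<pi>) (\<Pi>\<^sub>M t\<in>UNIV. count_space UNIV) (\<lambda>\<omega> t. fst (\<omega> t))"

lemma trajectory_kernel_cong:
  "(\<And>k. k < t \<Longrightarrow> \<omega> k = \<omega>' k) \<Longrightarrow> trajectory_kernel M \<pi> t \<omega> = trajectory_kernel M \<pi> t \<omega>'"
proof -
  assume eq: "\<And>k. k < t \<Longrightarrow> \<omega> k = \<omega>' k"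
  then have "map \<omega> [0..<t] = map \<omega>' [0..<t]" by simp
  with eq show ?thesis
    unfolding trajectory_kernel_def by (cases t) (simp_all only: nat.case lessI)
qed

lemma pmf_trajectory_kernel_0:
  "pmf (trajectory_kernel M \<pi> 0 \<omega>) (s, a) = of_bool (s = start M) * pmf (\<pi> [] s) a"
proof -
  have "pmf (map_pmf (Pair (start M)) (\<pi> [] (start M))) (s, a)
      = of_bool (s = start M) * pmf (\<pi> [] s) a"
  proof (cases "s = start M")
    case True
    then show ?thesis by (simp add: pmf_map_inj' inj_on_def)
  next
    case False
    then have "(s, a) \<notin> Pair (start M) ` set_pmf (\<pi> [] (start M))" by auto
    then show ?thesis using False by (simp add: pmf_eq_0_set_pmf)
  qed
  then show ?thesis by (simp add: trajectory_kernel_def bind_return_pmf)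
qed

lemma pmf_trajectory_kernel_Suc:
  assumes "is_mdp M" "snd (\<omega> k) \<in> avail M (fst (\<omega> k))"
  shows "pmf (trajectory_kernel M \<pi> (Suc k) \<omega>) (s, a) =
    tprob M (fst (\<omega> k)) (snd (\<omega> k)) s * pmf (\<pi> (map \<omega> [0..<Suc k]) s) a"
proof -
  let ?K = "embed_pmf (tprob M (fst (\<omega> k)) (snd (\<omega> k)))"
  let ?\<pi> = "\<lambda>q. \<pi> (map \<omega> [0..<Suc k]) q"
  have K: "pmf ?K q = tprob M (fst (\<omega> k)) (snd (\<omega> k)) q" for q
    using assms
    by (intro pmf_embed_pmf)
       (auto simp: is_mdp_def nn_integral_count_space_finite sum_ennreal)
  have "pmf (map_pmf (Pair q) (?\<pi> q)) (s, a) = of_bool (q = s) * pmf (?\<pi> s) a" for q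
  proof (cases "q = s")
    case True
    then show ?thesis by (simp add: pmf_map_inj' inj_on_def)
  next
    case False
    then have "(s, a) \<notin> Pair q ` set_pmf (?\<pi> q)" by auto
    then show ?thesis using False by (simp add: pmf_eq_0_set_pmf)
  qed
  note \<pi> = this
  have "pmf (trajectory_kernel M \<pi> (Suc k) \<omega>) (s, a)
      = (\<Sum>q\<in>UNIV. pmf ?K q * pmf (map_pmf (Pair q) (?\<pi> q)) (s, a))"
    unfolding trajectory_kernel_def nat.case
    by (simp add: pmf_bind integral_measure_pmf[of UNIV] mult.commute del: upt_Suc)
  also have "\<dots> = (\<Sum>q\<in>UNIV. pmf ?K q * (of_bool (q = s) * pmf (?\<pi> s) a))"
    by (simp only: \<pi>)
  also have "\<dots> = pmf ?K s * pmf (?\<pi> s) a"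
    by (subst sum.remove[of _ s]) auto
  finally show ?thesis by (simp add: K)
qed

interpretation trajectory: Ionescu_Tulcea
  "\<lambda>t \<omega>. measure_pmf (trajectory_kernel M \<pi> t \<omega>)" "\<lambda>_. count_space UNIV"
  for M :: "('s::finite, 'a::finite) mdp" and \<pi> :: "('s, 'a) policy"
proof
  show "(\<lambda>\<omega>. measure_pmf (trajectory_kernel M \<pi> i \<omega>)) \<in>
    (\<Pi>\<^sub>M i\<in>{0..<i}. count_space UNIV) \<rightarrow>\<^sub>M subprob_algebra (count_space UNIV)" for i
    by (subst count_space_PiM_finite)
       (auto simp: space_subprob_algebra measure_pmf.subprob_space_axioms)
qed

lemma space_trajectories [simp]: "space (trajectories M \<pi>) = UNIV"
  by (simp add: trajectories_def space_PiM)

lemma sets_trajectories [simp, measurable_cong]: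
  "sets (trajectories M \<pi>) = sets (\<Pi>\<^sub>M t\<in>UNIV. count_space UNIV)"
  by (simp add: trajectories_def)

lemma emeasure_trajectories_cylinder:
  "emeasure (trajectories M \<pi>) {\<omega>. \<forall>t<n. \<omega> t = x t} =
    (\<Prod>t<n. ennreal (pmf (trajectory_kernel M \<pi> t x) (x t)))"
proof -
  let ?N = "\<lambda>_::nat. count_space (UNIV :: ('a \<times> 'b) set)"
  let ?C = "trajectory.C M \<pi> 0"
  let ?u = "\<lambda>_::nat. undefined :: 'a \<times> 'b"
  have PiM: "PiM {0..<n} ?N = count_space ({0..<n} \<rightarrow>\<^sub>E UNIV)" for n
    by (rule count_space_PiM_finite) auto
  have C: "emeasure (?C n ?u) {restrict x {0..<n}} =
      (\<Prod>t<n. ennreal (pmf (trajectory_kernel M \<pi> t x) (x t)))" for n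
  proof (induction n)
    case 0
    then show ?case by (simp add: PiM_empty restrict_def)
  next
    case (Suc n)
    let ?r = "restrict x {0..<n}"
    let ?p = "pmf (trajectory_kernel M \<pi> n x) (x n)"
    have u: "?u \<in> space (PiM {0..<0} ?N)" by (simp add: space_PiM)
    have spC: "space (?C n ?u) = {0..<n} \<rightarrow>\<^sub>E UNIV"
      using trajectory.space_C[OF u, of M \<pi> n] by (simp add: space_PiM)
    have stC: "sets (?C n ?u) = sets (PiM {0..<n} ?N)"
      using trajectory.sets_C[OF u, of M \<pi> n] by simp
    have r: "{restrict x {0..<Suc n}} \<in> sets (PiM {0..<Suc n} ?N)"
      unfolding PiM by auto
    have e: "emeasure (trajectory.eP M \<pi> n \<omega>) {restrict x {0..<Suc n}}
        = ennreal ?p * indicator {?r} \<omega>" if "\<omega> \<in> {0..<n} \<rightarrow>\<^sub>E UNIV" for \<omega>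
    proof -
      have \<omega>: "\<omega> \<in> space (PiM {0..<n} ?N)" using that by (simp add: space_PiM)
      have "emeasure (trajectory.eP M \<pi> n \<omega>) {restrict x {0..<Suc n}}
          = emeasure (trajectory_kernel M \<pi> n \<omega>)
              (fun_upd \<omega> n -` {restrict x {0..<Suc n}})"
        using trajectory.emeasure_eP[OF \<omega> r] by simp
      also have "fun_upd \<omega> n -` {restrict x {0..<Suc n}} = (if \<omega> = ?r then {x n} else {})"
      proof -
        have "fun_upd \<omega> n y = restrict x {0..<Suc n} \<longleftrightarrow> \<omega> = ?r \<and> y = x n" for y
          using that by (auto simp: fun_eq_iff restrict_def PiE_iff extensional_def)
        then show ?thesis by auto
      qed
      also have "emeasure (trajectory_kernel M \<pi> n \<omega>) \<dots> = ennreal ?p * indicator {?r} \<omega>"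
      proof (cases "\<omega> = ?r")
        case True
        then have "trajectory_kernel M \<pi> n \<omega> = trajectory_kernel M \<pi> n x"
          by (intro trajectory_kernel_cong) auto
        with True show ?thesis by (simp add: emeasure_pmf_single)
      qed simp
      finally show ?thesis .
    qed
    have "emeasure (?C (Suc n) ?u) {restrict x {0..<Suc n}}
        = (\<integral>\<^sup>+\<omega>. emeasure (trajectory.eP M \<pi> n \<omega>) {restrict x {0..<Suc n}} \<partial>?C n ?u)"
      using r spC
      by (subst trajectory.C.simps(2), subst emeasure_bind[where N="PiM {0..<Suc n} ?N"])
         (auto simp: measurable_cong_sets[OF stC] intro: trajectory.measurable_eP)
    also have "\<dots> = (\<integral>\<^sup>+\<omega>. ennreal ?p * indicator {?r} \<omega> \<partial>?C n ?u)"
      using spC e by (intro nn_integral_cong) auto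
    also have "\<dots> = ennreal ?p * emeasure (?C n ?u) {?r}"
      by (subst nn_integral_cmult_indicator) (auto simp: stC PiM)
    finally show ?case
      unfolding Suc.IH prod.lessThan_Suc by (simp only: mult.commute)
  qed
  have X: "{restrict x {0..<n}} \<in> sets (PiM {0..<n} ?N)"
    unfolding PiM by auto
  have "{\<omega>. \<forall>t<n. \<omega> t = x t} = prod_emb UNIV ?N {0..<n} {restrict x {0..<n}}"
    by (auto simp: prod_emb_def restrict_def fun_eq_iff) metis
  then have "emeasure (trajectories M \<pi>) {\<omega>. \<forall>t<n. \<omega> t = x t}
      = emeasure (trajectory.CI M \<pi> {0..<n}) {restrict x {0..<n}}"
    unfolding trajectories_def using trajectory.lim[OF _ X] by simp
  also have "\<dots> = emeasure (?C n ?u) (prod_emb {0..<n} ?N {0..<n} {restrict x {0..<n}})"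
    by (rule trajectory.emeasure_CI[OF order_refl X])
  also have "prod_emb {0..<n} ?N {0..<n} {restrict x {0..<n}} = {restrict x {0..<n}}"
    by (subst prod_emb_id) auto
  finally show ?thesis by (simp add: C)
qed

lemma prob_space_trajectories: "prob_space (trajectories M \<pi>)"
  using emeasure_trajectories_cylinder[of M \<pi> 0] by (intro prob_spaceI) simp

lemma prob_space_paths: "prob_space (paths M \<pi>)"
proof -
  have [measurable]: "(\<lambda>\<omega> t. fst (\<omega> t)) \<in>
      trajectories M \<pi> \<rightarrow>\<^sub>M (\<Pi>\<^sub>M t\<in>UNIV. count_space UNIV)"
    unfolding measurable_cong_sets[OF sets_trajectories refl]
    by (intro measurable_PiM_single' measurable_compose[OF measurable_component_singleton]) auto
  show ?thesis
    unfolding paths_def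
    by (intro prob_space.prob_space_distr prob_space_trajectories) measurable
qed

definition reach_prob ::
    "('s::finite, 'a::finite) mdp \<Rightarrow> ('s, 'a) policy \<Rightarrow> 's set \<Rightarrow> real" where
  "reach_prob M \<pi> R = measure (paths M \<pi>) {\<omega>. \<exists>t. \<omega> t \<in> R}"

definition occupation ::
    "('s::finite, 'a::finite) mdp \<Rightarrow> ('s, 'a) policy \<Rightarrow> 's \<Rightarrow> 'a \<Rightarrow> ennreal" where
  "occupation M \<pi> s a = (\<integral>\<^sup>+\<omega>. (\<Sum>t. indicator {(s, a)} (\<omega> t)) \<partial>trajectories M \<pi>)"

text \<open>
  \<^const>\<open>KL_divergence\<close> is real-valued with the reference measure as its first measure argument.
  For probability measures \<open>Q \<lless> Q'\<close> the negative part of the log-likelihood ratio is always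
  \<open>Q\<close>-integrable, so non-integrability means that the divergence is infinite.
\<close>

definition KL :: "'b measure \<Rightarrow> 'b measure \<Rightarrow> ereal" where
  "KL Q Q' =
    (if absolutely_continuous Q' Q \<and> integrable Q (entropy_density (exp 1) Q' Q)
     then ereal (KL_divergence (exp 1) Q' Q) else \<infinity>)"

definition chain_prob :: "('s, 'a) mdp \<Rightarrow> ('s \<Rightarrow> 'a pmf) \<Rightarrow> 's \<Rightarrow> 's \<Rightarrow> real" where
  "chain_prob M \<mu> s q = (\<Sum>a\<in>avail M s. tprob M s a q * pmf (\<mu> s) a)"

definition accessible :: "('s, 'a) mdp \<Rightarrow> ('s \<Rightarrow> 'a pmf) \<Rightarrow> ('s \<times> 's) set" where
  "accessible M \<mu> = {(s, q). chain_prob M \<mu> s q > 0}\<^sup>*"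

definition communicating_classes :: "('s, 'a) mdp \<Rightarrow> ('s \<Rightarrow> 'a pmf) \<Rightarrow> 's set set" where
  "communicating_classes M \<mu> = UNIV // (accessible M \<mu> \<inter> (accessible M \<mu>)\<inverse>)"

definition closed_class :: "('s, 'a) mdp \<Rightarrow> ('s \<Rightarrow> 'a pmf) \<Rightarrow> 's set \<Rightarrow> bool" where
  "closed_class M \<mu> C \<longleftrightarrow> accessible M \<mu> `` C \<subseteq> C"

definition closed_states :: "('s, 'a) mdp \<Rightarrow> ('s \<Rightarrow> 'a pmf) \<Rightarrow> 's set" where
  "closed_states M \<mu> = \<Union>{C \<in> communicating_classes M \<mu>. closed_class M \<mu> C}"

definition ereal_convex_on :: "'v::real_vector set \<Rightarrow> ('v \<Rightarrow> ereal) \<Rightarrow> bool" where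
  "ereal_convex_on D f \<longleftrightarrow>
    convex D \<and> (\<forall>x\<in>D. f x \<noteq> -\<infinity>) \<and>
    (\<forall>x\<in>D. \<forall>y\<in>D. \<forall>u\<ge>0. \<forall>v\<ge>0. u + v = 1 \<longrightarrow>
      f (u *\<^sub>R x + v *\<^sub>R y) \<le> ereal u * f x + ereal v * f y)"

text \<open>
  Minimization over \<open>F\<close> of a function \<open>f\<close> that is convex on its domain \<open>D\<close>, where \<open>F\<close> is given
  by finitely many affine equalities and inequalities.
\<close>

definition convex_problem :: "'v::euclidean_space set \<Rightarrow> ('v \<Rightarrow> ereal) \<Rightarrow> 'v set \<Rightarrow> bool" where
  "convex_problem D f F \<longleftrightarrow> F \<subseteq> D \<and> polyhedron F \<and> ereal_convex_on D f"

definition optimal_value :: "('v \<Rightarrow> ereal) \<Rightarrow> 'v set \<Rightarrow> ereal" where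
  "optimal_value f F = (INF x\<in>F. f x)"

definition KL_to_reference ::
    "('s::finite, 'a::finite) mdp \<Rightarrow> ('s \<Rightarrow> 'a pmf) \<Rightarrow> ('s, 'a) policy \<Rightarrow> ereal" where
  "KL_to_reference M \<mu> \<pi> = KL (paths M \<pi>) (paths M (stationary \<mu>))"

definition reaching_policies ::
    "('s::finite, 'a::finite) mdp \<Rightarrow> 's set \<Rightarrow> real \<Rightarrow> ('s, 'a) policy set" where
  "reaching_policies M R \<nu> = {\<pi> \<in> policies M. reach_prob M \<pi> R \<ge> \<nu>}"

definition decision_states ::
    "('s, 'a) mdp \<Rightarrow> 's set \<Rightarrow> ('s \<Rightarrow> 'a pmf) \<Rightarrow> 's set" where
  "decision_states M R \<mu> = UNIV - (closed_states M \<mu> \<union> R)"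

text \<open>
  The variables are the components \<open>x $ (s, a)\<close> with \<open>s \<in> decision_states M R \<mu>\<close> and
  \<open>a \<in> avail M s\<close>. The remaining components of the vector do not occur in the objective and
  are set to zero in \<open>occ_feasible\<close>.
\<close>

definition occ_domain ::
    "('s::finite, 'a::finite) mdp \<Rightarrow> 's set \<Rightarrow> ('s \<Rightarrow> 'a pmf) \<Rightarrow> (real ^ ('s \<times> 'a)) set" where
  "occ_domain M R \<mu> = {x. \<forall>s\<in>decision_states M R \<mu>. \<forall>a\<in>avail M s. x $ (s, a) \<ge> 0}"

definition occ_feasible ::
    "('s::finite, 'a::finite) mdp \<Rightarrow> 's set \<Rightarrow> real \<Rightarrow> ('s \<Rightarrow> 'a pmf) \<Rightarrow> (real ^ ('s \<times> 'a)) set" where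
  "occ_feasible M R \<nu> \<mu> =
    {x. (\<forall>s a. \<not> (s \<in> decision_states M R \<mu> \<and> a \<in> avail M s) \<longrightarrow> x $ (s, a) = 0) \<and>
        (\<forall>s\<in>decision_states M R \<mu>. \<forall>a\<in>avail M s. x $ (s, a) \<ge> 0) \<and>
        (\<forall>s\<in>decision_states M R \<mu>.
          (\<Sum>a\<in>avail M s. x $ (s, a)) -
          (\<Sum>q\<in>decision_states M R \<mu>. \<Sum>a\<in>avail M q. x $ (q, a) * tprob M q a s) =
          of_bool (s = start M)) \<and>
        (\<Sum>q\<in>R.
          (\<Sum>s\<in>decision_states M R \<mu>. \<Sum>a\<in>avail M s. x $ (s, a) * tprob M s a q) +
          of_bool (q = start M)) \<ge> \<nu>}"

text \<open>
  The sum over \<open>a\<close> is innermost because the conventions for \<open>0\<close> and \<open>\<infinity>\<close> apply to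
  the sum over \<open>a\<close> of the terms for a given pair \<open>(s, q)\<close>.
\<close>

definition occ_objective ::
    "('s::finite, 'a::finite) mdp \<Rightarrow> 's set \<Rightarrow> ('s \<Rightarrow> 'a pmf) \<Rightarrow> real ^ ('s \<times> 'a) \<Rightarrow> ereal" where
  "occ_objective M R \<mu> x =
    (\<Sum>s\<in>decision_states M R \<mu>. \<Sum>q\<in>Succ M s.
      if (\<Sum>a\<in>avail M s. x $ (s, a) * tprob M s a q) = 0 then 0
      else if chain_prob M \<mu> s q = 0 then \<infinity>
      else ereal (\<Sum>a\<in>avail M s. x $ (s, a) * tprob M s a q *
        ln ((\<Sum>a'\<in>avail M s. x $ (s, a') * tprob M s a' q) /
            (chain_prob M \<mu> s q * (\<Sum>a'\<in>avail M s. x $ (s, a'))))))"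

definition occ_vector ::
    "('s::finite, 'a::finite) mdp \<Rightarrow> 's set \<Rightarrow> ('s \<Rightarrow> 'a pmf) \<Rightarrow> ('s, 'a) policy \<Rightarrow> real ^ ('s \<times> 'a)" where
  "occ_vector M R \<mu> \<pi> =
    (\<chi> i. let (s, a) = i in if s \<in> decision_states M R \<mu> \<and> a \<in> avail M s
      then enn2real (occupation M \<pi> s a) else 0)"

end

theory Submission
  imports Defs
begin

text \<open>
  The states of \<open>R\<close> are absorbing, so the decision states are exactly the transient states of the
  reference chain. There is a function \<open>h \<ge> 1\<close>, equal to 1 on the closed states, with
  \<open>E h(next) \<le> exp (- c) * h\<close> on the transient ones; the Donsker-Varadhan inequality for the
  likelihood \<open>h(s\<^sub>n) / h(s\<^sub>0) * exp (c * N)\<close>, with \<open>N\<close> the number of visits to transient states,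
  bounds the expected time in transient states by the divergence. The same inequality for
  the likelihood of the averaged kernel of the occupation measure \<open>x\<close> of a policy shows that the
  objective of (II) at \<open>x\<close> is at most the divergence of the policy, so that (II) \<open>\<le>\<close> (I).

  Conversely, normalizing a feasible \<open>x\<close> gives a stationary policy whose occupation measure is the
  minimal solution of the balance equations. It differs from \<open>x\<close> by a circulation without outflow,
  hence has the same flow into \<open>R\<close> and an objective that is no larger, and its divergence equals
  that objective. The minimum of (II) is therefore one over a compact set of occupation measures,
  on which the objective is continuous.
\<close>

subsection \<open>Functionals of finitely many coordinates\<close>

text \<open>Two obstacles shape the proof. A policy may react to the whole history, actions
  included, whereas paths forget the actions, so the divergence of a general policy has no usable
  formula. It is therefore only bounded from below: a nonnegative weight \<open>w\<close> on
  transitions whose mean under every row of the reference chain is at most 1 yields a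
  supermartingale, and Donsker-Varadhan turns it into a bound that is linear in the transition
  probabilities \<open>flow\<close>. The two bounds named above are two choices of \<open>w\<close>.
  An exact divergence is computed only for stationary policies that copy the reference on the closed
  states. The other obstacle is that the feasible set of (II) may be unbounded, since circulations
  can be added, so compactness has to come from elsewhere. The bound on the time in transient states
  has constants that do not depend on the policy; occupation measures of policies below a given
  divergence thus lie in one box, and every feasible point that competes for the minimum can be
  replaced by one of them.\<close>

definition determined_by :: "nat \<Rightarrow> ((nat \<Rightarrow> 'b) \<Rightarrow> 'c) \<Rightarrow> bool" where
  "determined_by n F \<longleftrightarrow> (\<forall>\<omega> \<omega>'. (\<forall>k<n. \<omega> k = \<omega>' k) \<longrightarrow> F \<omega> = F \<omega>')"

lemma determined_byI:
  "(\<And>\<omega> \<omega>'. (\<And>k. k < n \<Longrightarrow> \<omega> k = \<omega>' k) \<Longrightarrow> F \<omega> = F \<omega>') \<Longrightarrow> determined_by n F"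
  unfolding determined_by_def by blast

lemma determined_byD:
  "determined_by n F \<Longrightarrow> (\<And>k. k < n \<Longrightarrow> \<omega> k = \<omega>' k) \<Longrightarrow> F \<omega> = F \<omega>'"
  unfolding determined_by_def by blast

abbreviation seq_space :: "(nat \<Rightarrow> 'b) measure" where
  "seq_space \<equiv> \<Pi>\<^sub>M t\<in>UNIV. count_space UNIV"

lemma determined_by_restrict: "determined_by n F \<Longrightarrow> F (restrict \<omega> {..<n}) = F \<omega>"
  by (rule determined_byD) auto

lemma finite_PiE_lessThan: "finite ({..<n::nat} \<rightarrow>\<^sub>E (UNIV :: 'b::finite set))"
  by (rule finite_PiE) auto

text \<open>With finitely many values per coordinate, restriction to the first \<open>n\<close>
  coordinates lands in a finite discrete space, on which every map is measurable. Finite-horizon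
  functionals thus never require a measurability proof of their own.\<close>

lemma determined_by_measurable:
  fixes F :: "(nat \<Rightarrow> 'b::finite) \<Rightarrow> 'c"
  assumes "determined_by n F" "\<And>x. F x \<in> space N"
  shows "F \<in> seq_space \<rightarrow>\<^sub>M N"
proof -
  have PiM: "PiM {..<n} (\<lambda>_. count_space (UNIV::'b set)) = count_space ({..<n} \<rightarrow>\<^sub>E UNIV)"
    by (rule count_space_PiM_finite) auto
  have "(\<lambda>\<omega>. restrict \<omega> {..<n}) \<in> seq_space \<rightarrow>\<^sub>M PiM {..<n} (\<lambda>_. count_space (UNIV::'b set))"
    by (rule measurable_restrict_subset) auto
  then have "(\<lambda>\<omega>. F (restrict \<omega> {..<n})) \<in> seq_space \<rightarrow>\<^sub>M N"
    by (rule measurable_compose) (auto simp: PiM assms(2))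
  then show ?thesis
    by (simp add: determined_by_restrict[OF assms(1)])
qed

lemma determined_by_finite_range:
  fixes F :: "(nat \<Rightarrow> 'b::finite) \<Rightarrow> 'c"
  assumes "determined_by n F"
  shows "finite (range F)"
proof -
  have "range F \<subseteq> F ` ({..<n} \<rightarrow>\<^sub>E UNIV)"
  proof (rule image_subsetI)
    fix \<omega> :: "nat \<Rightarrow> 'b"
    have "restrict \<omega> {..<n} \<in> {..<n} \<rightarrow>\<^sub>E UNIV" by auto
    then show "F \<omega> \<in> F ` ({..<n} \<rightarrow>\<^sub>E UNIV)"
      by (metis determined_by_restrict[OF assms] imageI)
  qed
  then show ?thesis by (rule finite_subset) (intro finite_imageI finite_PiE_lessThan)
qed

lemma determined_by_integrable:
  fixes F :: "(nat \<Rightarrow> 'b::finite) \<Rightarrow> real"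
  assumes "determined_by n F" "prob_space N" "sets N = sets seq_space"
  shows "integrable N F"
proof -
  interpret prob_space N by fact
  have "F \<in> borel_measurable N"
    using determined_by_measurable[OF assms(1), of borel] by (simp add: measurable_cong_sets[OF assms(3)])
  moreover have "norm (F \<omega>) \<le> (\<Sum>y\<in>range F. norm y)" for \<omega>
    by (rule member_le_sum) (auto simp: determined_by_finite_range[OF assms(1)])
  ultimately show ?thesis by (intro integrable_const_bound) auto
qed

lemma sets_determined_by:
  fixes F :: "(nat \<Rightarrow> 'b::finite) \<Rightarrow> bool"
  assumes "determined_by n F"
  shows "{\<omega>. F \<omega>} \<in> sets seq_space"
proof -
  have "F -` {True} \<inter> space seq_space \<in> sets seq_space"
    by (rule measurable_sets[OF determined_by_measurable[OF assms, of "count_space UNIV"]]) auto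
  then show ?thesis by (simp add: space_PiM vimage_def)
qed

text \<open>The cylinders of length \<open>n\<close> partition the sequence space, and the
  extensional functions on \<open>{..<n}\<close> index each of them exactly once.\<close>

lemma integral_determined_by:
  fixes F :: "(nat \<Rightarrow> 'b::finite) \<Rightarrow> real"
  assumes F: "determined_by n F" and N: "prob_space N" "sets N = sets seq_space"
  shows "integral\<^sup>L N F = (\<Sum>x\<in>{..<n} \<rightarrow>\<^sub>E UNIV. measure N {\<omega>. \<forall>t<n. \<omega> t = x t} * F x)"
proof -
  interpret prob_space N by fact
  let ?c = "\<lambda>x. {\<omega>. \<forall>t<n. \<omega> t = x t}"
  have c: "?c x \<in> sets N" for x
    unfolding N(2) by (intro sets_determined_by[of n] determined_byI) auto
  have "F \<omega> = (\<Sum>x\<in>{..<n} \<rightarrow>\<^sub>E UNIV. indicator (?c x) \<omega> * F x)" for \<omega>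
  proof -
    have "(\<Sum>x\<in>{..<n} \<rightarrow>\<^sub>E UNIV. indicator (?c x) \<omega> * F x)
       = (\<Sum>x\<in>{restrict \<omega> {..<n}}. indicator (?c x) \<omega> * F x)"
    proof (rule sum.mono_neutral_right)
      show "\<forall>i\<in>({..<n} \<rightarrow>\<^sub>E UNIV) - {restrict \<omega> {..<n}}. indicator (?c i) \<omega> * F i = 0"
        by (auto simp: indicator_def PiE_iff extensional_def fun_eq_iff)
    qed (auto simp: finite_PiE_lessThan)
    also have "\<dots> = F \<omega>" by (simp add: determined_by_restrict[OF F])
    finally show ?thesis ..
  qed
  then have "integral\<^sup>L N F = (\<integral>\<omega>. (\<Sum>x\<in>{..<n} \<rightarrow>\<^sub>E UNIV. indicator (?c x) \<omega> * F x) \<partial>N)"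
    by (rule Bochner_Integration.integral_cong[OF refl])
  also have "\<dots> = (\<Sum>x\<in>{..<n} \<rightarrow>\<^sub>E UNIV. \<integral>\<omega>. indicator (?c x) \<omega> * F x \<partial>N)"
    using c by (intro Bochner_Integration.integral_sum integrable_mult_left
        integrable_real_indicator) (auto simp: emeasure_eq_measure)
  also have "\<dots> = (\<Sum>x\<in>{..<n} \<rightarrow>\<^sub>E UNIV. measure N (?c x) * F x)"
    using c by simp
  finally show ?thesis .
qed

section \<open>Integrating out the last step of a trajectory\<close>

lemma measure_trajectories_cylinder_Suc:
  "measure (trajectories M \<pi>) {\<omega>. \<forall>t<Suc n. \<omega> t = x t} =
   measure (trajectories M \<pi>) {\<omega>. \<forall>t<n. \<omega> t = x t} * pmf (trajectory_kernel M \<pi> n x) (x n)"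
  by (simp only: measure_def emeasure_trajectories_cylinder prod.lessThan_Suc enn2real_mult
      enn2real_ennreal pmf_nonneg)

text \<open>The cylinder formula yields this conditioning step: a cylinder of length
  \<open>Suc n\<close> is one of length \<open>n\<close> with a last pair adjoined, and the kernel
  at time \<open>n\<close> does not look at that pair.\<close>

lemma trajectories_tower:
  fixes F :: "(nat \<Rightarrow> 's::finite \<times> 'a::finite) \<Rightarrow> real"
  assumes F: "determined_by (Suc n) F"
  shows "integral\<^sup>L (trajectories M \<pi>) F =
    (\<integral>\<omega>. (\<Sum>y\<in>UNIV. pmf (trajectory_kernel M \<pi> n \<omega>) y * F (fun_upd \<omega> n y)) \<partial>trajectories M \<pi>)"
proof -
  note T = prob_space_trajectories[of M \<pi>] sets_trajectories[of M \<pi>]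
  let ?E = "\<lambda>n. {..<n} \<rightarrow>\<^sub>E (UNIV :: ('s \<times> 'a) set)"
  let ?m = "\<lambda>n x. measure (trajectories M \<pi>) {\<omega>. \<forall>t<n. \<omega> t = x t}"
  let ?G = "\<lambda>\<omega>. (\<Sum>y\<in>UNIV. pmf (trajectory_kernel M \<pi> n \<omega>) y * F (fun_upd \<omega> n y))"
  have G: "determined_by n ?G"
  proof (rule determined_byI)
    fix \<omega> \<omega>' :: "nat \<Rightarrow> 's \<times> 'a" assume eq: "\<And>k. k < n \<Longrightarrow> \<omega> k = \<omega>' k"
    then have "F (fun_upd \<omega> n y) = F (fun_upd \<omega>' n y)" for y
      by (intro determined_byD[OF F]) (auto simp: less_Suc_eq)
    moreover have "trajectory_kernel M \<pi> n \<omega> = trajectory_kernel M \<pi> n \<omega>'"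
      using eq by (rule trajectory_kernel_cong)
    ultimately show "?G \<omega> = ?G \<omega>'" by simp
  qed
  have "integral\<^sup>L (trajectories M \<pi>) F = (\<Sum>x\<in>?E (Suc n). ?m (Suc n) x * F x)"
    by (rule integral_determined_by[OF F T])
  also have "?E (Suc n) = (\<lambda>(y, g). fun_upd g n y) ` (UNIV \<times> ?E n)"
    by (simp add: lessThan_Suc PiE_insert_eq)
  also have "(\<Sum>x\<in>\<dots>. ?m (Suc n) x * F x)
      = (\<Sum>(y, g)\<in>UNIV \<times> ?E n. ?m (Suc n) (fun_upd g n y) * F (fun_upd g n y))"
    by (subst sum.reindex) (auto intro!: inj_combinator simp: case_prod_beta)
  also have "\<dots> = (\<Sum>(y, g)\<in>UNIV \<times> ?E n. ?m n g * (pmf (trajectory_kernel M \<pi> n g) y * F (fun_upd g n y)))"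
  proof (intro sum.cong refl prod.case_cong)
    fix z g y
    have "trajectory_kernel M \<pi> n (fun_upd g n y) = trajectory_kernel M \<pi> n g"
      by (rule trajectory_kernel_cong) auto
    moreover have "{\<omega>. \<forall>t<n. \<omega> t = (fun_upd g n y) t} = {\<omega>. \<forall>t<n. \<omega> t = g t}" by auto
    ultimately have "?m (Suc n) (fun_upd g n y) = ?m n g * pmf (trajectory_kernel M \<pi> n g) y"
      unfolding measure_trajectories_cylinder_Suc by (simp only: fun_upd_same)
    then show "?m (Suc n) (fun_upd g n y) * F (fun_upd g n y)
       = ?m n g * (pmf (trajectory_kernel M \<pi> n g) y * F (fun_upd g n y))" by simp
  qed
  also have "\<dots> = (\<Sum>g\<in>?E n. ?m n g * ?G g)"
    by (subst sum.cartesian_product[symmetric], subst sum.swap) (simp add: sum_distrib_left)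
  also have "\<dots> = integral\<^sup>L (trajectories M \<pi>) ?G"
    by (rule integral_determined_by[OF G T, symmetric])
  finally show ?thesis .
qed

text \<open>The first stage of \<open>trajectory_kernel\<close>, before an action is drawn.
  Splitting it off leaves the policy as a separate factor, which sums to 1.\<close>

definition next_state :: "('s::finite, 'a::finite) mdp \<Rightarrow> nat \<Rightarrow> (nat \<Rightarrow> 's \<times> 'a) \<Rightarrow> 's pmf" where
  "next_state M n \<omega> = (case n of 0 \<Rightarrow> return_pmf (start M)
       | Suc k \<Rightarrow> embed_pmf (tprob M (fst (\<omega> k)) (snd (\<omega> k))))"

lemma pmf_trajectory_kernel:
  "pmf (trajectory_kernel M \<pi> n \<omega>) (s, a) = pmf (next_state M n \<omega>) s * pmf (\<pi> (map \<omega> [0..<n]) s) a"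
proof -
  let ?\<pi> = "\<lambda>q. \<pi> (map \<omega> [0..<n]) q"
  have *: "pmf (map_pmf (Pair q) (?\<pi> q)) (s, a) = of_bool (q = s) * pmf (?\<pi> s) a" for q
  proof (cases "q = s")
    case True
    then show ?thesis by (simp add: pmf_map_inj' inj_on_def)
  next
    case False
    then have "(s, a) \<notin> Pair q ` set_pmf (?\<pi> q)" by auto
    then show ?thesis using False by (simp add: pmf_eq_0_set_pmf)
  qed
  have "pmf (trajectory_kernel M \<pi> n \<omega>) (s, a)
      = (\<Sum>q\<in>UNIV. pmf (next_state M n \<omega>) q * pmf (map_pmf (Pair q) (?\<pi> q)) (s, a))"
    unfolding trajectory_kernel_def next_state_def[symmetric]
    by (simp add: pmf_bind integral_measure_pmf[of UNIV] mult.commute del: upt_Suc)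
  also have "\<dots> = (\<Sum>q\<in>UNIV. pmf (next_state M n \<omega>) q * (of_bool (q = s) * pmf (?\<pi> s) a))"
    by (simp only: *)
  also have "\<dots> = pmf (next_state M n \<omega>) s * pmf (?\<pi> s) a"
    by (subst sum.remove[of _ s]) auto
  finally show ?thesis .
qed

lemma next_state_cong:
  "(\<And>k. k < n \<Longrightarrow> \<omega> k = \<omega>' k) \<Longrightarrow> next_state M n \<omega> = next_state M n \<omega>'"
  by (cases n) (simp_all add: next_state_def)

lemma pmf_next_state_Suc:
  assumes "is_mdp M" "snd (\<omega> k) \<in> avail M (fst (\<omega> k))"
  shows "pmf (next_state M (Suc k) \<omega>) q = tprob M (fst (\<omega> k)) (snd (\<omega> k)) q"
  unfolding next_state_def nat.case using assms
  by (intro pmf_embed_pmf) (auto simp: is_mdp_def nn_integral_count_space_finite sum_ennreal)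

lemma pmf_policy_unavailable:
  "\<pi> \<in> policies M \<Longrightarrow> a \<notin> avail M s \<Longrightarrow> pmf (\<pi> h s) a = 0"
  by (auto simp: policies_def pmf_eq_0_set_pmf)

lemma sum_pmf_finite: "(\<Sum>a\<in>UNIV. pmf (p :: 'a::finite pmf) a) = 1"
  by (rule sum_pmf_eq_1) auto

lemma sum_pairs: "(\<Sum>y\<in>UNIV. f y) = (\<Sum>s\<in>UNIV. \<Sum>a\<in>UNIV. f (s, a))"
  for f :: "'s::finite \<times> 'a::finite \<Rightarrow> 'c::comm_monoid_add"
  by (simp add: sum.cartesian_product flip: UNIV_Times_UNIV)

text \<open>\<open>embed_pmf (tprob M s a)\<close> is known to have the probabilities
  \<open>tprob M s a\<close> only for available \<open>a\<close>. This supplies the null set outside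
  of which \<open>next_state\<close> may be replaced by \<open>tprob\<close>.\<close>

lemma AE_trajectories_available:
  assumes "\<pi> \<in> policies M"
  shows "AE \<omega> in trajectories M \<pi>. snd (\<omega> n) \<in> avail M (fst (\<omega> n))"
proof -
  let ?T = "trajectories M \<pi>"
  let ?F = "\<lambda>\<omega>. of_bool (snd (\<omega> n) \<notin> avail M (fst (\<omega> n))) :: real"
  have F: "determined_by (Suc n) ?F" by (rule determined_byI) auto
  have "integral\<^sup>L ?T ?F = (\<integral>\<omega>. 0 \<partial>?T)"
    unfolding trajectories_tower[OF F]
    by (intro Bochner_Integration.integral_cong refl sum.neutral)
       (auto simp: pmf_trajectory_kernel pmf_policy_unavailable[OF assms] simp del: upt_Suc)
  then have "AE \<omega> in ?T. ?F \<omega> = 0"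
    by (subst integral_nonneg_eq_0_iff_AE[symmetric])
       (auto intro!: determined_by_integrable[OF F] prob_space_trajectories)
  then show ?thesis by (rule AE_mp) (auto intro!: AE_I2 split: if_splits simp: of_bool_def)
qed

text \<open>Given the pair at time \<open>n\<close>, the next state does not depend on the policy,
  and the action drawn after it sums out. History-dependent policies therefore cause no difficulty,
  even for a \<open>g\<close> that sees the whole past.\<close>

lemma trajectories_next_state:
  fixes g :: "(nat \<Rightarrow> 's::finite \<times> 'a::finite) \<Rightarrow> 's \<Rightarrow> real"
  assumes M: "is_mdp M" and \<pi>: "\<pi> \<in> policies M"
    and g: "\<And>q. determined_by (Suc n) (\<lambda>\<omega>. g \<omega> q)"
  shows "(\<integral>\<omega>. g \<omega> (fst (\<omega> (Suc n))) \<partial>trajectories M \<pi>) =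
    (\<integral>\<omega>. (\<Sum>q\<in>UNIV. tprob M (fst (\<omega> n)) (snd (\<omega> n)) q * g \<omega> q) \<partial>trajectories M \<pi>)"
proof -
  let ?T = "trajectories M \<pi>"
  have F: "determined_by (Suc (Suc n)) (\<lambda>\<omega>. g \<omega> (fst (\<omega> (Suc n))))"
  proof (rule determined_byI)
    fix \<omega> \<omega>' :: "nat \<Rightarrow> 's \<times> 'a" assume "\<And>k. k < Suc (Suc n) \<Longrightarrow> \<omega> k = \<omega>' k"
    then show "g \<omega> (fst (\<omega> (Suc n))) = g \<omega>' (fst (\<omega>' (Suc n)))"
      using determined_byD[OF g, of \<omega> \<omega>'] by simp
  qed
  have upd: "g (fun_upd \<omega> (Suc n) y) q = g \<omega> q" for \<omega> y q
    by (rule determined_byD[OF g]) auto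
  have "(\<integral>\<omega>. g \<omega> (fst (\<omega> (Suc n))) \<partial>?T) =
    (\<integral>\<omega>. (\<Sum>q\<in>UNIV. pmf (next_state M (Suc n) \<omega>) q * g \<omega> q) \<partial>?T)"
  proof (subst trajectories_tower[OF F], rule Bochner_Integration.integral_cong[OF refl])
    fix \<omega> :: "nat \<Rightarrow> 's \<times> 'a"
    have "(\<Sum>a\<in>UNIV. pmf (next_state M (Suc n) \<omega>) s * pmf (\<pi> (map \<omega> [0..<Suc n]) s) a * g \<omega> s)
      = pmf (next_state M (Suc n) \<omega>) s * g \<omega> s" for s
      by (simp add: sum_distrib_left[symmetric] sum_distrib_right[symmetric] sum_pmf_finite del: upt_Suc)
    then show "(\<Sum>y\<in>UNIV. pmf (trajectory_kernel M \<pi> (Suc n) \<omega>) y *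
          g (fun_upd \<omega> (Suc n) y) (fst (fun_upd \<omega> (Suc n) y (Suc n))))
       = (\<Sum>q\<in>UNIV. pmf (next_state M (Suc n) \<omega>) q * g \<omega> q)"
      by (simp only: sum_pairs pmf_trajectory_kernel fun_upd_same fst_conv upd)
  qed
  also have "\<dots> = (\<integral>\<omega>. (\<Sum>q\<in>UNIV. tprob M (fst (\<omega> n)) (snd (\<omega> n)) q * g \<omega> q) \<partial>?T)"
  proof (rule integral_cong_AE)
    have 1: "determined_by (Suc n) (\<lambda>\<omega>. \<Sum>q\<in>UNIV. pmf (next_state M (Suc n) \<omega>) q * g \<omega> q)"
      by (rule determined_byI, intro sum.cong refl arg_cong2[where f="(*)"] determined_byD[OF g]
          arg_cong2[where f=pmf] next_state_cong) auto
    have 2: "determined_by (Suc n) (\<lambda>\<omega>. \<Sum>q\<in>UNIV. tprob M (fst (\<omega> n)) (snd (\<omega> n)) q * g \<omega> q)"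
      by (rule determined_byI, intro sum.cong refl arg_cong2[where f="(*)"] determined_byD[OF g]) auto
    show "(\<lambda>\<omega>. \<Sum>q\<in>UNIV. pmf (next_state M (Suc n) \<omega>) q * g \<omega> q) \<in> borel_measurable ?T"
      "(\<lambda>\<omega>. \<Sum>q\<in>UNIV. tprob M (fst (\<omega> n)) (snd (\<omega> n)) q * g \<omega> q) \<in> borel_measurable ?T"
      by (rule borel_measurable_integrable determined_by_integrable[OF _ prob_space_trajectories] 1 2
          sets_trajectories)+
    show "AE \<omega> in ?T. (\<Sum>q\<in>UNIV. pmf (next_state M (Suc n) \<omega>) q * g \<omega> q)
        = (\<Sum>q\<in>UNIV. tprob M (fst (\<omega> n)) (snd (\<omega> n)) q * g \<omega> q)"
      using AE_trajectories_available[OF \<pi>, of n]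
      by (rule AE_mp) (auto intro!: AE_I2 simp: pmf_next_state_Suc[OF M])
  qed
  finally show ?thesis .
qed

section \<open>Visit probabilities and transition flows\<close>

definition visit_prob :: "('s::finite, 'a::finite) mdp \<Rightarrow> ('s, 'a) policy \<Rightarrow> nat \<Rightarrow> 's \<Rightarrow> 'a \<Rightarrow> real" where
  "visit_prob M \<pi> t s a = measure (trajectories M \<pi>) {\<omega>. \<omega> t = (s, a)}"

lemma visit_prob_nonneg: "0 \<le> visit_prob M \<pi> t s a"
  by (simp add: visit_prob_def)

lemma sets_trajectories_determined:
  fixes F :: "(nat \<Rightarrow> 's::finite \<times> 'a::finite) \<Rightarrow> bool"
  assumes "determined_by n F"
  shows "{\<omega>. F \<omega>} \<in> sets (trajectories M \<pi>)"
  using sets_determined_by[OF assms] by simp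

lemma integral_at_time:
  fixes f :: "'s::finite \<times> 'a::finite \<Rightarrow> real"
  shows "(\<integral>\<omega>. f (\<omega> t) \<partial>trajectories M \<pi>) = (\<Sum>s\<in>UNIV. \<Sum>a\<in>UNIV. visit_prob M \<pi> t s a * f (s, a))"
proof -
  let ?T = "trajectories M \<pi>"
  interpret prob_space ?T by (rule prob_space_trajectories)
  have m: "{\<omega>. \<omega> t = y} \<in> sets ?T" for y
    by (rule sets_trajectories_determined[of "Suc t"], rule determined_byI) auto
  have "f (\<omega> t) = (\<Sum>y\<in>UNIV. indicator {\<omega>. \<omega> t = y} \<omega> * f y)" for \<omega>
    by (subst sum.remove[of _ "\<omega> t"]) auto
  then have "(\<integral>\<omega>. f (\<omega> t) \<partial>?T) = (\<integral>\<omega>. (\<Sum>y\<in>UNIV. indicator {\<omega>. \<omega> t = y} \<omega> * f y) \<partial>?T)"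
    by (rule Bochner_Integration.integral_cong[OF refl])
  also have "\<dots> = (\<Sum>y\<in>UNIV. measure ?T {\<omega>. \<omega> t = y} * f y)"
    using m by (subst Bochner_Integration.integral_sum)
      (auto intro!: integrable_mult_left integrable_real_indicator simp: emeasure_eq_measure)
  finally show ?thesis by (simp add: sum_pairs visit_prob_def)
qed

lemma visit_prob_unavailable:
  assumes "\<pi> \<in> policies M" "a \<notin> avail M s"
  shows "visit_prob M \<pi> t s a = 0"
proof -
  have "AE \<omega> in trajectories M \<pi>. \<omega> \<notin> {\<omega>. \<omega> t = (s, a)}"
    using AE_trajectories_available[OF assms(1), of t] by (rule AE_mp) (use assms(2) in auto)
  moreover have "{\<omega>. \<omega> t = (s, a)} \<in> sets (trajectories M \<pi>)"
    by (rule sets_trajectories_determined[of "Suc t"], rule determined_byI) auto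
  ultimately show ?thesis unfolding visit_prob_def
    by (simp add: AE_iff_measurable[OF _ refl] measure_eq_AE measure_def)
qed

definition flow :: "('s::finite, 'a::finite) mdp \<Rightarrow> ('s, 'a) policy \<Rightarrow> nat \<Rightarrow> 's \<Rightarrow> 's \<Rightarrow> real" where
  "flow M \<pi> t s q = (\<Sum>a\<in>UNIV. visit_prob M \<pi> t s a * tprob M s a q)"

definition state_prob :: "('s::finite, 'a::finite) mdp \<Rightarrow> ('s, 'a) policy \<Rightarrow> nat \<Rightarrow> 's \<Rightarrow> real" where
  "state_prob M \<pi> t s = (\<Sum>a\<in>UNIV. visit_prob M \<pi> t s a)"

lemma integral_transition:
  assumes M: "is_mdp M" and \<pi>: "\<pi> \<in> policies M"
  shows "(\<integral>\<omega>. g (fst (\<omega> t)) (fst (\<omega> (Suc t))) \<partial>trajectories M \<pi>) =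
    (\<Sum>s\<in>UNIV. \<Sum>q\<in>UNIV. flow M \<pi> t s q * g s q)"
proof -
  have "(\<integral>\<omega>. g (fst (\<omega> t)) (fst (\<omega> (Suc t))) \<partial>trajectories M \<pi>) =
    (\<integral>\<omega>. (\<Sum>q\<in>UNIV. tprob M (fst (\<omega> t)) (snd (\<omega> t)) q * g (fst (\<omega> t)) q) \<partial>trajectories M \<pi>)"
    by (rule trajectories_next_state[OF M \<pi>, where g="\<lambda>\<omega>. g (fst (\<omega> t))"])
       (rule determined_byI, auto)
  also have "\<dots> = (\<Sum>s\<in>UNIV. \<Sum>a\<in>UNIV. visit_prob M \<pi> t s a * (\<Sum>q\<in>UNIV. tprob M s a q * g s q))"
    by (subst integral_at_time[where f="\<lambda>y. \<Sum>q\<in>UNIV. tprob M (fst y) (snd y) q * g (fst y) q"]) simp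
  also have "\<dots> = (\<Sum>s\<in>UNIV. \<Sum>q\<in>UNIV. flow M \<pi> t s q * g s q)"
    unfolding flow_def sum_distrib_left sum_distrib_right
    by (subst sum.swap[of _ UNIV]) (simp add: mult.assoc)
  finally show ?thesis .
qed

lemma integral_state:
  "(\<integral>\<omega>. g (fst (\<omega> t)) \<partial>trajectories M \<pi>) = (\<Sum>s\<in>UNIV. state_prob M \<pi> t s * g s)"
  by (subst integral_at_time[where f="\<lambda>y. g (fst y)"]) (simp add: state_prob_def sum_distrib_right)

lemma state_prob_Suc:
  assumes M: "is_mdp M" and \<pi>: "\<pi> \<in> policies M"
  shows "state_prob M \<pi> (Suc t) q = (\<Sum>s\<in>UNIV. flow M \<pi> t s q)"
  using integral_transition[OF M \<pi>, where g="\<lambda>s q'. of_bool (q' = q)" and t=t]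
    integral_state[where g="\<lambda>q'. of_bool (q' = q)" and t="Suc t" and M=M and \<pi>=\<pi>]
  by (simp add: of_bool_def if_distrib[of "(*) _"] cong: if_cong)

lemma state_prob_0: "state_prob M \<pi> 0 q = of_bool (q = start M)"
proof -
  let ?F = "\<lambda>\<omega> :: nat \<Rightarrow> 'a \<times> 'b. of_bool (fst (\<omega> 0) = q) :: real"
  have F: "determined_by (Suc 0) ?F" by (rule determined_byI) auto
  have "(\<Sum>y\<in>UNIV. pmf (trajectory_kernel M \<pi> 0 \<omega>) y * ?F (fun_upd \<omega> 0 y)) = of_bool (q = start M)" for \<omega>
  proof -
    have "(\<Sum>a\<in>UNIV. pmf (trajectory_kernel M \<pi> 0 \<omega>) (s, a) * ?F (fun_upd \<omega> 0 (s, a)))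
        = (if s = start M then of_bool (s = q) else 0)" for s
      by (cases "s = start M") (simp_all add: pmf_trajectory_kernel_0 sum_pmf_finite
          flip: sum_distrib_right)
    then show ?thesis by (simp add: sum_pairs)
  qed
  then have "integral\<^sup>L (trajectories M \<pi>) ?F = of_bool (q = start M)"
    unfolding trajectories_tower[OF F]
    by (simp add: prob_space.prob_space[OF prob_space_trajectories[of M \<pi>], simplified])
  then show ?thesis
    using integral_state[where g="\<lambda>q'. of_bool (q' = q)" and t=0 and M=M and \<pi>=\<pi>]
    by (simp add: of_bool_def if_distrib[of "(*) _"] cong: if_cong)
qed

subsection \<open>Path laws\<close>

lemma space_paths [simp]: "space (paths M \<pi>) = UNIV"
  by (simp add: paths_def space_PiM)

lemma sets_paths [simp, measurable_cong]: "sets (paths M \<pi>) = sets seq_space"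
  by (simp add: paths_def)

lemma measurable_states:
  "(\<lambda>\<omega> t. fst (\<omega> t)) \<in> trajectories M \<pi> \<rightarrow>\<^sub>M (seq_space :: (nat \<Rightarrow> 's::finite) measure)"
  unfolding measurable_cong_sets[OF sets_trajectories refl]
  by (intro measurable_PiM_single' measurable_compose[OF measurable_component_singleton]) auto

lemma integral_paths:
  fixes F :: "(nat \<Rightarrow> 's::finite) \<Rightarrow> real"
  assumes "F \<in> borel_measurable seq_space"
  shows "integral\<^sup>L (paths M \<pi>) F = (\<integral>\<omega>. F (\<lambda>t. fst (\<omega> t)) \<partial>trajectories M \<pi>)"
  unfolding paths_def by (rule integral_distr[OF measurable_states assms])

lemma determined_by_borel:
  fixes F :: "(nat \<Rightarrow> 'b::finite) \<Rightarrow> real"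
  shows "determined_by n F \<Longrightarrow> F \<in> borel_measurable seq_space"
  by (rule determined_by_measurable) auto

lemma integrable_paths:
  fixes F :: "(nat \<Rightarrow> 's::finite) \<Rightarrow> real"
  shows "determined_by n F \<Longrightarrow> integrable (paths M \<pi>) F"
  by (erule determined_by_integrable[OF _ prob_space_paths]) simp

lemma integral_paths_transition:
  assumes M: "is_mdp M" and \<pi>: "\<pi> \<in> policies M"
  shows "(\<integral>\<omega>. g (\<omega> t) (\<omega> (Suc t)) \<partial>paths M \<pi>) = (\<Sum>s\<in>UNIV. \<Sum>q\<in>UNIV. flow M \<pi> t s q * g s q)"
  by (subst integral_paths)
     (auto intro!: determined_by_borel[of "Suc (Suc t)"] determined_byI simp: integral_transition[OF assms])

lemma integral_paths_state:
  "(\<integral>\<omega>. g (\<omega> t) \<partial>paths M \<pi>) = (\<Sum>s\<in>UNIV. state_prob M \<pi> t s * g s)"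
  by (subst integral_paths)
     (auto intro!: determined_by_borel[of "Suc t"] determined_byI simp: integral_state)

lemma sets_paths_determined:
  fixes F :: "(nat \<Rightarrow> 's::finite) \<Rightarrow> bool"
  assumes "determined_by n F"
  shows "{\<omega>. F \<omega>} \<in> sets (paths M \<pi>)"
  using sets_determined_by[OF assms] by simp

lemma measure_paths_eq_integral:
  fixes F :: "(nat \<Rightarrow> 's::finite) \<Rightarrow> bool"
  assumes "determined_by n F"
  shows "measure (paths M \<pi>) {\<omega>. F \<omega>} = (\<integral>\<omega>. of_bool (F \<omega>) \<partial>paths M \<pi>)"
proof -
  have "(\<lambda>\<omega>. of_bool (F \<omega>) :: real) = indicator {\<omega>. F \<omega>}" by (auto simp: fun_eq_iff)
  then show ?thesis using sets_paths_determined[OF assms, of M \<pi>] by simp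
qed

lemma flow_eq_measure:
  assumes M: "is_mdp M" and \<pi>: "\<pi> \<in> policies M"
  shows "flow M \<pi> t s q = measure (paths M \<pi>) {\<omega>. \<omega> t = s \<and> \<omega> (Suc t) = q}"
proof -
  have d: "determined_by (Suc (Suc t)) (\<lambda>\<omega> :: nat \<Rightarrow> 'a. \<omega> t = s \<and> \<omega> (Suc t) = q)"
    by (rule determined_byI) auto
  have "(\<Sum>s'\<in>UNIV. \<Sum>q'\<in>UNIV. flow M \<pi> t s' q' * of_bool (s' = s \<and> q' = q))
     = (\<Sum>s'\<in>UNIV. if s' = s then \<Sum>q'\<in>UNIV. if q' = q then flow M \<pi> t s' q' else 0 else 0)"
    by (intro sum.cong refl) (auto intro!: sum.cong sum.neutral)
  then show ?thesis
    unfolding measure_paths_eq_integral[OF d]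
    by (subst integral_paths_transition[OF M \<pi>, where g="\<lambda>s' q'. of_bool (s' = s \<and> q' = q)"]) simp
qed

lemma flow_nonneg: "is_mdp M \<Longrightarrow> 0 \<le> flow M \<pi> t s q"
  unfolding flow_def by (intro sum_nonneg mult_nonneg_nonneg visit_prob_nonneg) (auto simp: is_mdp_def)

lemma state_prob_nonneg: "0 \<le> state_prob M \<pi> t s"
  unfolding state_prob_def by (intro sum_nonneg visit_prob_nonneg)

lemma AE_paths_start: "AE \<omega> in paths M \<pi>. \<omega> 0 = start M"
proof -
  interpret prob_space "paths M \<pi>" by (rule prob_space_paths)
  have d: "determined_by (Suc 0) (\<lambda>\<omega> :: nat \<Rightarrow> 'a. \<omega> 0 = start M)" by (rule determined_byI) auto
  have "measure (paths M \<pi>) {\<omega>. \<omega> 0 = start M} = 1"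
    unfolding measure_paths_eq_integral[OF d]
    by (subst integral_paths_state[where g="\<lambda>s. of_bool (s = start M)"])
       (simp add: state_prob_0 of_bool_def if_distrib[of "\<lambda>x. x * _"] cong: if_cong)
  then have "AE \<omega> in paths M \<pi>. \<omega> \<in> {\<omega>. \<omega> 0 = start M}"
    by (subst prob_eq_1[symmetric]) (rule sets_paths_determined[OF d])
  then show ?thesis by simp
qed

lemma AE_paths_transition:
  assumes M: "is_mdp M" and \<pi>: "\<pi> \<in> policies M"
  shows "AE \<omega> in paths M \<pi>. \<forall>t. flow M \<pi> t (\<omega> t) (\<omega> (Suc t)) > 0"
proof (subst AE_all_countable, rule allI)
  fix t
  have d: "determined_by (Suc (Suc t)) (\<lambda>\<omega> :: nat \<Rightarrow> 'a. of_bool (flow M \<pi> t (\<omega> t) (\<omega> (Suc t)) = 0) :: real)"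
    by (rule determined_byI) auto
  have "(\<integral>\<omega>. of_bool (flow M \<pi> t (\<omega> t) (\<omega> (Suc t)) = 0) \<partial>paths M \<pi>) = (0::real)"
    by (subst integral_paths_transition[OF M \<pi>, where g="\<lambda>s' q'. of_bool (flow M \<pi> t s' q' = 0)"])
       (auto intro!: sum.neutral)
  then have "AE \<omega> in paths M \<pi>. of_bool (flow M \<pi> t (\<omega> t) (\<omega> (Suc t)) = 0) = (0::real)"
    by (subst integral_nonneg_eq_0_iff_AE[symmetric]) (auto intro!: integrable_paths[OF d])
  then show "AE \<omega> in paths M \<pi>. flow M \<pi> t (\<omega> t) (\<omega> (Suc t)) > 0"
    by (rule AE_mp) (use flow_nonneg[OF M, of \<pi> t] in \<open>auto intro!: AE_I2 simp: less_le\<close>)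
qed

section \<open>The Markov chain of a stationary policy\<close>

lemma chain_prob_UNIV:
  fixes M :: "('s, 'a::finite) mdp"
  assumes "\<mu> \<in> stationary_policies M"
  shows "chain_prob M \<mu> s q = (\<Sum>a\<in>UNIV. pmf (\<mu> s) a * tprob M s a q)"
  unfolding chain_prob_def
  by (rule sum.mono_neutral_cong_left)
     (use assms in \<open>auto simp: stationary_policies_def pmf_eq_0_set_pmf mult.commute\<close>)

lemma chain_prob_nonneg: "is_mdp M \<Longrightarrow> 0 \<le> chain_prob M \<mu> s q"
  unfolding chain_prob_def by (intro sum_nonneg mult_nonneg_nonneg) (auto simp: is_mdp_def)

lemma sum_chain_prob:
  assumes "is_mdp M" "\<mu> \<in> stationary_policies M"
  shows "(\<Sum>q\<in>UNIV. chain_prob M \<mu> s q) = 1"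
proof -
  have "(\<Sum>q\<in>UNIV. chain_prob M \<mu> s q) = (\<Sum>a\<in>avail M s. pmf (\<mu> s) a * (\<Sum>q\<in>UNIV. tprob M s a q))"
    unfolding chain_prob_def by (subst sum.swap) (simp add: sum_distrib_left mult.commute)
  also have "\<dots> = (\<Sum>a\<in>avail M s. pmf (\<mu> s) a)"
    using assms(1) by (intro sum.cong) (auto simp: is_mdp_def)
  also have "\<dots> = 1" using assms(2) by (intro sum_pmf_eq_1) (auto simp: stationary_policies_def)
  finally show ?thesis .
qed

text \<open>Once the state at time \<open>t\<close> is drawn, the action depends on nothing else, so
  its probability leaves the integral over the past.\<close>

lemma visit_prob_stationary:
  "visit_prob M (stationary \<sigma>) t s a = state_prob M (stationary \<sigma>) t s * pmf (\<sigma> s) a"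
proof -
  let ?T = "trajectories M (stationary \<sigma>)"
  have v: "visit_prob M (stationary \<sigma>) t s b = (\<integral>\<omega>. pmf (next_state M t \<omega>) s \<partial>?T) * pmf (\<sigma> s) b" for b
  proof -
    let ?F = "\<lambda>\<omega> :: nat \<Rightarrow> 'a \<times> 'b. of_bool (\<omega> t = (s, b)) :: real"
    have F: "determined_by (Suc t) ?F" by (rule determined_byI) auto
    have m: "{\<omega>. \<omega> t = (s, b)} \<in> sets ?T"
      by (rule sets_trajectories_determined[of "Suc t"], rule determined_byI) auto
    have "?F = indicator {\<omega>. \<omega> t = (s, b)}" by (auto simp: fun_eq_iff)
    then have "visit_prob M (stationary \<sigma>) t s b = integral\<^sup>L ?T ?F"
      using m by (simp add: visit_prob_def)
    also have "\<dots> = (\<integral>\<omega>. pmf (next_state M t \<omega>) s * pmf (\<sigma> s) b \<partial>?T)"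
    proof (subst trajectories_tower[OF F], rule Bochner_Integration.integral_cong[OF refl])
      fix \<omega> :: "nat \<Rightarrow> 'a \<times> 'b"
      show "(\<Sum>y\<in>UNIV. pmf (trajectory_kernel M (stationary \<sigma>) t \<omega>) y * ?F (fun_upd \<omega> t y))
          = pmf (next_state M t \<omega>) s * pmf (\<sigma> s) b"
        by (subst sum.remove[of _ "(s, b)"]) (auto simp: pmf_trajectory_kernel stationary_def)
    qed
    finally show ?thesis by simp
  qed
  have "state_prob M (stationary \<sigma>) t s = (\<integral>\<omega>. pmf (next_state M t \<omega>) s \<partial>?T)"
    unfolding state_prob_def v by (simp add: sum_distrib_left[symmetric] sum_pmf_finite)
  with v show ?thesis by simp
qed

lemma flow_stationary:
  assumes "\<sigma> \<in> stationary_policies M"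
  shows "flow M (stationary \<sigma>) t s q = state_prob M (stationary \<sigma>) t s * chain_prob M \<sigma> s q"
  by (simp add: flow_def visit_prob_stationary chain_prob_UNIV[OF assms] sum_distrib_left mult.assoc)

text \<open>The Markov property of the states alone. It rests on stationarity: given the state at
  time \<open>n\<close>, the hidden action has law \<open>\<sigma>\<close> whatever the history
  was.\<close>

lemma paths_step:
  fixes F :: "(nat \<Rightarrow> 's::finite) \<Rightarrow> real" and M :: "('s, 'a::finite) mdp"
  assumes M: "is_mdp M" and \<sigma>: "\<sigma> \<in> stationary_policies M"
    and F: "determined_by (Suc (Suc n)) F"
  shows "integral\<^sup>L (paths M (stationary \<sigma>)) F =
    (\<integral>\<omega>. (\<Sum>q\<in>UNIV. chain_prob M \<sigma> (\<omega> n) q * F (fun_upd \<omega> (Suc n) q)) \<partial>paths M (stationary \<sigma>))"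
proof -
  let ?T = "trajectories M (stationary \<sigma>)"
  let ?p = "\<lambda>(\<omega> :: nat \<Rightarrow> 's \<times> 'a) t. fst (\<omega> t)"
  let ?g = "\<lambda>\<omega> q. F (fun_upd (?p \<omega>) (Suc n) q)"
  let ?H = "\<lambda>\<omega>. \<Sum>q\<in>UNIV. tprob M (fst (\<omega> n)) (snd (\<omega> n)) q * ?g \<omega> q"
  let ?K = "\<lambda>\<omega>. \<Sum>q\<in>UNIV. chain_prob M \<sigma> (fst (\<omega> n)) q * ?g \<omega> q"
  have g: "determined_by (Suc n) (\<lambda>\<omega>. ?g \<omega> q)" for q
    by (rule determined_byI, rule determined_byD[OF F]) (auto simp: less_Suc_eq)
  have H: "determined_by (Suc n) ?H" and K: "determined_by (Suc n) ?K"
    by (rule determined_byI, intro sum.cong refl arg_cong2[where f="(*)"] determined_byD[OF g], auto)+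
  have R: "determined_by (Suc n) (\<lambda>\<omega>. \<Sum>q\<in>UNIV. chain_prob M \<sigma> (\<omega> n) q * F (fun_upd \<omega> (Suc n) q))"
    by (rule determined_byI, intro sum.cong refl arg_cong2[where f="(*)"] determined_byD[OF F])
       (auto simp: less_Suc_eq)
  have "integral\<^sup>L (paths M (stationary \<sigma>)) F = (\<integral>\<omega>. ?g \<omega> (fst (\<omega> (Suc n))) \<partial>?T)"
    by (subst integral_paths[OF determined_by_borel[OF F]]) (simp add: fun_upd_idem)
  also have "\<dots> = integral\<^sup>L ?T ?H"
    by (rule trajectories_next_state[OF M stationary_in_policies[OF \<sigma>] g])
  \<comment> \<open>Expanding both integrals once more, over the pair at time \<open>n\<close>,
    averages the action by \<open>\<sigma>\<close>. Fact \<open>X\<close> then turns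
    \<open>tprob\<close> into \<open>chain_prob\<close>; its right side keeps a vacuous average over
    \<open>a\<close> in order to match the expansion of \<open>?K\<close>.\<close>
  also have "\<dots> = integral\<^sup>L ?T ?K"
    unfolding trajectories_tower[OF H] trajectories_tower[OF K]
  proof (rule Bochner_Integration.integral_cong[OF refl])
    fix \<omega> :: "nat \<Rightarrow> 's \<times> 'a"
    have p: "?p (fun_upd \<omega> n (s, a)) = fun_upd (?p \<omega>) n s" for s a by auto
    have X: "(\<Sum>a\<in>UNIV. pmf (\<sigma> s) a * (\<Sum>q\<in>UNIV. tprob M s a q * h q))
      = (\<Sum>a\<in>UNIV. pmf (\<sigma> s) a * (\<Sum>q\<in>UNIV. chain_prob M \<sigma> s q * h q))" for s h
    proof -
      have "(\<Sum>a\<in>UNIV. pmf (\<sigma> s) a * (\<Sum>q\<in>UNIV. tprob M s a q * h q))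
        = (\<Sum>a\<in>UNIV. \<Sum>q\<in>UNIV. pmf (\<sigma> s) a * tprob M s a q * h q)"
        by (simp only: sum_distrib_left mult.assoc)
      also have "\<dots> = (\<Sum>q\<in>UNIV. chain_prob M \<sigma> s q * h q)"
        by (subst sum.swap) (simp only: chain_prob_UNIV[OF \<sigma>] sum_distrib_right)
      also have "\<dots> = (\<Sum>a\<in>UNIV. pmf (\<sigma> s) a * (\<Sum>q\<in>UNIV. chain_prob M \<sigma> s q * h q))"
        by (simp only: sum_distrib_right[symmetric] sum_pmf_finite mult_1_left)
      finally show ?thesis .
    qed
    have Y: "(\<Sum>y\<in>UNIV. pmf (trajectory_kernel M (stationary \<sigma>) n \<omega>) y * h y)
      = (\<Sum>s\<in>UNIV. pmf (next_state M n \<omega>) s * (\<Sum>a\<in>UNIV. pmf (\<sigma> s) a * h (s, a)))" for h :: "'s \<times> 'a \<Rightarrow> real"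
      by (simp only: sum_pairs pmf_trajectory_kernel stationary_def sum_distrib_left mult.assoc)
    show "(\<Sum>y\<in>UNIV. pmf (trajectory_kernel M (stationary \<sigma>) n \<omega>) y * ?H (fun_upd \<omega> n y))
      = (\<Sum>y\<in>UNIV. pmf (trajectory_kernel M (stationary \<sigma>) n \<omega>) y * ?K (fun_upd \<omega> n y))"
      unfolding Y p fun_upd_same fst_conv snd_conv X ..
  qed
  also have "\<dots> = (\<integral>\<omega>. (\<Sum>q\<in>UNIV. chain_prob M \<sigma> (\<omega> n) q * F (fun_upd \<omega> (Suc n) q)) \<partial>paths M (stationary \<sigma>))"
    by (subst integral_paths[OF determined_by_borel[OF R]]) simp
  finally show ?thesis .
qed

text \<open>A candidate likelihood ratio of the first \<open>n\<close> transitions: the genuine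
  ratio of two chains if \<open>w\<close> is the quotient of their transition probabilities, and a
  supermartingale under the reference chain if \<open>w\<close> is nonnegative with row means at
  most 1.\<close>

definition weight_prod :: "('s \<Rightarrow> 's \<Rightarrow> real) \<Rightarrow> nat \<Rightarrow> (nat \<Rightarrow> 's) \<Rightarrow> real" where
  "weight_prod w n \<omega> = (\<Prod>t<n. w (\<omega> t) (\<omega> (Suc t)))"

lemma determined_by_weight_prod: "determined_by (Suc n) (weight_prod w n)"
  unfolding weight_prod_def by (rule determined_byI, rule prod.cong) auto

lemma weight_prod_upd: "weight_prod w (Suc n) (fun_upd \<omega> (Suc n) q) = weight_prod w n \<omega> * w (\<omega> n) q"
  by (simp add: weight_prod_def)

lemma weight_prod_nonneg: "(\<And>s q. 0 \<le> w s q) \<Longrightarrow> 0 \<le> weight_prod w n \<omega>"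
  unfolding weight_prod_def by (rule prod_nonneg) auto

lemma integral_weight_prod_le_1:
  assumes M: "is_mdp M" and \<mu>: "\<mu> \<in> stationary_policies M"
    and w: "\<And>s q. 0 \<le> w s q" "\<And>s. (\<Sum>q\<in>UNIV. chain_prob M \<mu> s q * w s q) \<le> 1"
  shows "integral\<^sup>L (paths M (stationary \<mu>)) (weight_prod w n) \<le> 1"
proof (induction n)
  case 0
  interpret prob_space "paths M (stationary \<mu>)" by (rule prob_space_paths)
  show ?case by (simp add: weight_prod_def prob_space[simplified])
next
  case (Suc n)
  have "integral\<^sup>L (paths M (stationary \<mu>)) (weight_prod w (Suc n)) =
    (\<integral>\<omega>. weight_prod w n \<omega> * (\<Sum>q\<in>UNIV. chain_prob M \<mu> (\<omega> n) q * w (\<omega> n) q) \<partial>paths M (stationary \<mu>))"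
    by (subst paths_step[OF M \<mu> determined_by_weight_prod])
       (simp add: weight_prod_upd sum_distrib_left ac_simps)
  also have "\<dots> \<le> integral\<^sup>L (paths M (stationary \<mu>)) (weight_prod w n)"
  proof (rule integral_mono)
    have "determined_by (Suc n) (\<lambda>\<omega>. weight_prod w n \<omega> * (\<Sum>q\<in>UNIV. chain_prob M \<mu> (\<omega> n) q * w (\<omega> n) q))"
      by (rule determined_byI, intro arg_cong2[where f="(*)"] determined_byD[OF determined_by_weight_prod])
         auto
    then show "integrable (paths M (stationary \<mu>))
        (\<lambda>\<omega>. weight_prod w n \<omega> * (\<Sum>q\<in>UNIV. chain_prob M \<mu> (\<omega> n) q * w (\<omega> n) q))"
      by (rule integrable_paths)
    show "integrable (paths M (stationary \<mu>)) (weight_prod w n)"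
      by (rule integrable_paths[OF determined_by_weight_prod])
    show "weight_prod w n \<omega> * (\<Sum>q\<in>UNIV. chain_prob M \<mu> (\<omega> n) q * w (\<omega> n) q) \<le> weight_prod w n \<omega>" for \<omega>
      using mult_left_mono[OF w(2) weight_prod_nonneg[of w n \<omega>, OF w(1)]] by simp
  qed
  finally show ?case using Suc by simp
qed

text \<open>The last step of \<open>\<sigma>\<close> is integrated out first, which leaves a
  functional of one coordinate fewer for the induction hypothesis; the last factor of
  \<open>w\<close> then converts that step into one of \<open>\<mu>\<close>.\<close>

lemma change_of_measure:
  assumes M: "is_mdp M" and \<mu>: "\<mu> \<in> stationary_policies M" and \<sigma>: "\<sigma> \<in> stationary_policies M"
    and w: "\<And>s q. chain_prob M \<sigma> s q = chain_prob M \<mu> s q * w s q"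
    and F: "determined_by (Suc n) F"
  shows "integral\<^sup>L (paths M (stationary \<sigma>)) F = (\<integral>\<omega>. weight_prod w n \<omega> * F \<omega> \<partial>paths M (stationary \<mu>))"
  using F
proof (induction n arbitrary: F)
  case 0
  have *: "integral\<^sup>L (paths M \<pi>) F = F (\<lambda>_. start M)" for \<pi>
  proof -
    interpret prob_space "paths M \<pi>" by (rule prob_space_paths)
    have "integral\<^sup>L (paths M \<pi>) F = (\<integral>\<omega>. F (\<lambda>_. start M) \<partial>paths M \<pi>)"
    proof (rule integral_cong_AE)
      show "AE \<omega> in paths M \<pi>. F \<omega> = F (\<lambda>_. start M)"
        using AE_paths_start by (rule AE_mp) (auto intro!: AE_I2 determined_byD[OF 0])
    qed (use integrable_paths[OF 0] in auto)
    also have "\<dots> = F (\<lambda>_. start M)" by (simp add: prob_space[simplified])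
    finally show ?thesis .
  qed
  show ?case by (simp add: * weight_prod_def)
next
  case (Suc n)
  let ?G = "\<lambda>\<omega>. \<Sum>q\<in>UNIV. chain_prob M \<sigma> (\<omega> n) q * F (fun_upd \<omega> (Suc n) q)"
  have G: "determined_by (Suc n) ?G"
    by (rule determined_byI, intro sum.cong refl arg_cong2[where f="(*)"] determined_byD[OF Suc.prems])
       (auto simp: less_Suc_eq)
  have WF: "determined_by (Suc (Suc n)) (\<lambda>\<omega>. weight_prod w (Suc n) \<omega> * F \<omega>)"
    by (rule determined_byI, intro arg_cong2[where f="(*)"] determined_byD[OF Suc.prems]
      determined_byD[OF determined_by_weight_prod]) auto
  have "integral\<^sup>L (paths M (stationary \<sigma>)) F = (\<integral>\<omega>. weight_prod w n \<omega> * ?G \<omega> \<partial>paths M (stationary \<mu>))"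
    unfolding paths_step[OF M \<sigma> Suc.prems] by (rule Suc.IH[OF G])
  also have "\<dots> = (\<integral>\<omega>. weight_prod w (Suc n) \<omega> * F \<omega> \<partial>paths M (stationary \<mu>))"
    unfolding paths_step[OF M \<mu> WF] weight_prod_upd
    by (simp add: w sum_distrib_left ac_simps)
  finally show ?case .
qed

subsection \<open>Bounds for the Kullback-Leibler divergence\<close>

text \<open>The Donsker-Varadhan bound: integrate \<open>ln t \<le> t - 1\<close> at \<open>t = G / (dQ/dP)\<close>.\<close>

lemma integral_ln_le_KL_divergence:
  assumes P: "prob_space P" and Q: "prob_space Q" and sets: "sets Q = sets P"
    and ac: "absolutely_continuous P Q"
    and int: "integrable Q (entropy_density (exp 1) P Q)"
    and G: "integrable P G" "\<And>x. 0 \<le> G x" "integral\<^sup>L P G \<le> 1"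
    and lnG: "AE x in Q. 0 < G x" "integrable Q (\<lambda>x. ln (G x))"
  shows "(\<integral>x. ln (G x) \<partial>Q) \<le> KL_divergence (exp 1) P Q"
proof -
  interpret P: prob_space P by fact
  interpret Q: prob_space Q by fact
  obtain D where D: "D \<in> borel_measurable P" "AE x in P. RN_deriv P Q x = ennreal (D x)"
    "AE x in Q. 0 < D x" "\<And>x. 0 \<le> D x"
    using P.real_RN_deriv[OF Q.finite_measure_axioms ac sets] by blast
  have RNQ: "AE x in Q. RN_deriv P Q x = ennreal (D x)"
    using absolutely_continuous_AE[OF sets ac D(2)] .
  have DQ [measurable]: "D \<in> borel_measurable Q" and GQ [measurable]: "G \<in> borel_measurable Q"
    using D(1) borel_measurable_integrable[OF G(1)] by (simp_all add: measurable_cong_sets[OF sets refl])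
  have GP [measurable]: "G \<in> borel_measurable P" using G(1) by simp
  note D(1)[measurable]
  have "(\<integral>\<^sup>+x. ennreal (G x / D x) \<partial>Q) = (\<integral>\<^sup>+x. RN_deriv P Q x * ennreal (G x / D x) \<partial>P)"
    by (rule P.RN_deriv_nn_integral[OF ac sets]) measurable
  \<comment> \<open>Only an inequality: where \<open>D x = 0\<close> the left integrand vanishes,
    while \<open>G x\<close> may be positive.\<close>
  also have "\<dots> \<le> (\<integral>\<^sup>+x. ennreal (G x) \<partial>P)"
  proof (rule nn_integral_mono_AE, use D(2) in eventually_elim)
    fix x assume "RN_deriv P Q x = ennreal (D x)"
    then show "RN_deriv P Q x * ennreal (G x / D x) \<le> ennreal (G x)"
      using D(4)[of x] G(2)[of x] by (cases "D x = 0") (auto simp flip: ennreal_mult)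
  qed
  also have "\<dots> = ennreal (integral\<^sup>L P G)"
    by (rule nn_integral_eq_integral[OF G(1)]) (use G(2) in auto)
  also have "\<dots> \<le> ennreal 1" using G(3) by (rule ennreal_leI)
  finally have nn: "(\<integral>\<^sup>+x. ennreal (G x / D x) \<partial>Q) \<le> 1" by simp
  have pos: "0 \<le> G x / D x" for x using D(4)[of x] G(2)[of x] by simp
  have i: "integrable Q (\<lambda>x. G x / D x)"
    by (rule integrableI_nonneg) (use nn pos in \<open>auto simp: order_le_less_trans\<close>)
  have le1: "(\<integral>x. G x / D x \<partial>Q) \<le> 1"
    using nn_integral_eq_integral[OF i] nn pos by (simp add: ennreal_le_1)
  have dens: "AE x in Q. entropy_density (exp 1) P Q x = ln (D x)"
    using RNQ by eventually_elim (use D(4) in \<open>simp add: entropy_density_def log_def\<close>)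
  have "(\<integral>x. ln (G x) \<partial>Q) - KL_divergence (exp 1) P Q
      = (\<integral>x. ln (G x) - entropy_density (exp 1) P Q x \<partial>Q)"
    unfolding KL_divergence_def by (rule Bochner_Integration.integral_diff[symmetric, OF lnG(2) int])
  also have "\<dots> \<le> (\<integral>x. G x / D x - 1 \<partial>Q)"
  proof (rule integral_mono_AE)
    show "AE x in Q. ln (G x) - entropy_density (exp 1) P Q x \<le> G x / D x - 1"
      using dens lnG(1) D(3)
      proof eventually_elim
      fix x assume *: "entropy_density (exp 1) P Q x = ln (D x)" "0 < G x" "0 < D x"
      then show "ln (G x) - entropy_density (exp 1) P Q x \<le> G x / D x - 1"
        using ln_le_minus_one[of "G x / D x"] by (simp add: ln_div)
    qed
  qed (use lnG(2) int i in auto)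
  also have "\<dots> = (\<integral>x. G x / D x \<partial>Q) - 1"
    using i by (simp add: Q.prob_space)
  finally show ?thesis using le1 by simp
qed

section \<open>Lower bounds for the divergence of an arbitrary policy\<close>

lemma KL_to_reference_finiteD:
  assumes "KL_to_reference M \<mu> \<pi> < \<infinity>"
  shows "absolutely_continuous (paths M (stationary \<mu>)) (paths M \<pi>)"
    "integrable (paths M \<pi>) (entropy_density (exp 1) (paths M (stationary \<mu>)) (paths M \<pi>))"
    "KL_to_reference M \<mu> \<pi> = ereal (KL_divergence (exp 1) (paths M (stationary \<mu>)) (paths M \<pi>))"
  using assms unfolding KL_to_reference_def KL_def by (auto split: if_splits)

text \<open>Donsker-Varadhan with \<open>weight_prod w n\<close> as test function: its logarithm is
  a sum over transitions, whose expectation is linear in \<open>flow\<close>. The bound is stated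
  for each finite horizon so that it can be used to prove summability over time. Positivity is asked
  only where the policy moves, because the averaged kernel used later vanishes elsewhere.\<close>

lemma KL_lower_bound:
  assumes M: "is_mdp M" and \<mu>: "\<mu> \<in> stationary_policies M" and \<pi>: "\<pi> \<in> policies M"
    and fin: "KL_to_reference M \<mu> \<pi> < \<infinity>"
    and w: "\<And>s q. 0 \<le> w s q" "\<And>s. (\<Sum>q\<in>UNIV. chain_prob M \<mu> s q * w s q) \<le> 1"
    and pos: "\<And>t s q. 0 < flow M \<pi> t s q \<Longrightarrow> 0 < w s q"
  shows "ereal (\<Sum>t<n. \<Sum>s\<in>UNIV. \<Sum>q\<in>UNIV. flow M \<pi> t s q * ln (w s q)) \<le> KL_to_reference M \<mu> \<pi>"
proof -
  let ?Q = "paths M \<pi>"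
  note KL = KL_to_reference_finiteD[OF fin]
  have d1: "determined_by (Suc n) (\<lambda>\<omega>. ln (weight_prod w n \<omega>))"
    by (rule determined_byI, rule arg_cong[where f=ln], rule determined_byD[OF determined_by_weight_prod])
  have d2: "determined_by (Suc (Suc t)) (\<lambda>\<omega>. ln (w (\<omega> t) (\<omega> (Suc t))))" for t
    by (rule determined_byI) auto
  have AEw: "AE \<omega> in ?Q. \<forall>t. 0 < w (\<omega> t) (\<omega> (Suc t))"
    using AE_paths_transition[OF M \<pi>] by eventually_elim (use pos in blast)
  have "(\<Sum>t<n. \<Sum>s\<in>UNIV. \<Sum>q\<in>UNIV. flow M \<pi> t s q * ln (w s q))
      = (\<Sum>t<n. \<integral>\<omega>. ln (w (\<omega> t) (\<omega> (Suc t))) \<partial>?Q)"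
    by (simp add: integral_paths_transition[OF M \<pi>, where g="\<lambda>s q. ln (w s q)"])
  also have "\<dots> = (\<integral>\<omega>. (\<Sum>t<n. ln (w (\<omega> t) (\<omega> (Suc t)))) \<partial>?Q)"
    by (rule Bochner_Integration.integral_sum[symmetric]) (rule integrable_paths[OF d2])
  also have "\<dots> = (\<integral>\<omega>. ln (weight_prod w n \<omega>) \<partial>?Q)"
  proof (rule integral_cong_AE)
    show "AE \<omega> in ?Q. (\<Sum>t<n. ln (w (\<omega> t) (\<omega> (Suc t)))) = ln (weight_prod w n \<omega>)"
      using AEw by eventually_elim (unfold weight_prod_def, rule ln_prod[symmetric], simp, metis less_irrefl)
    show "(\<lambda>\<omega>. \<Sum>t<n. ln (w (\<omega> t) (\<omega> (Suc t)))) \<in> borel_measurable ?Q"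
      by (intro borel_measurable_sum borel_measurable_integrable integrable_paths[OF d2])
    show "(\<lambda>\<omega>. ln (weight_prod w n \<omega>)) \<in> borel_measurable ?Q"
      by (intro borel_measurable_integrable integrable_paths[OF d1])
  qed
  also have "\<dots> \<le> KL_divergence (exp 1) (paths M (stationary \<mu>)) ?Q"
  proof (rule integral_ln_le_KL_divergence[OF prob_space_paths prob_space_paths _ KL(1,2)])
    show "AE \<omega> in ?Q. 0 < weight_prod w n \<omega>"
      using AEw by eventually_elim (simp add: weight_prod_def prod_pos)
  qed (use integral_weight_prod_le_1[OF M \<mu> w] integrable_paths[OF determined_by_weight_prod]
      integrable_paths[OF d1] weight_prod_nonneg[of w, OF w(1)] in auto)
  finally show ?thesis by (simp add: KL(3))
qed

lemma flow_eq_0_if_chain_prob_eq_0: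
  assumes M: "is_mdp M" and \<mu>: "\<mu> \<in> stationary_policies M" and \<pi>: "\<pi> \<in> policies M"
    and ac: "absolutely_continuous (paths M (stationary \<mu>)) (paths M \<pi>)"
    and 0: "chain_prob M \<mu> s q = 0"
  shows "flow M \<pi> t s q = 0"
proof -
  let ?A = "{\<omega> :: nat \<Rightarrow> 'a. \<omega> t = s \<and> \<omega> (Suc t) = q}"
  interpret P: prob_space "paths M (stationary \<mu>)" by (rule prob_space_paths)
  have A: "?A \<in> sets (paths M \<pi>)" for \<pi> :: "('a, 'b) policy"
    by (rule sets_paths_determined[of "Suc (Suc t)"], rule determined_byI) auto
  have "measure (paths M (stationary \<mu>)) ?A = 0"
    using flow_eq_measure[OF M stationary_in_policies[OF \<mu>], of t s q]
    by (simp add: flow_stationary[OF \<mu>] 0)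
  then have "?A \<in> null_sets (paths M (stationary \<mu>))"
    using A[of "stationary \<mu>"] by (intro null_setsI) (auto simp: P.emeasure_eq_measure)
  then have "?A \<in> null_sets (paths M \<pi>)" using ac by (auto simp: absolutely_continuous_def)
  then show ?thesis
    by (simp add: flow_eq_measure[OF M \<pi>] null_sets_def measure_def)
qed

section \<open>Exact divergence of stationary policies that copy the reference on a closed
  set\<close>

lemma AE_paths_chain:
  assumes M: "is_mdp M" and \<sigma>: "\<sigma> \<in> stationary_policies M"
  shows "AE \<omega> in paths M (stationary \<sigma>). \<forall>t. 0 < chain_prob M \<sigma> (\<omega> t) (\<omega> (Suc t))"
  using AE_paths_transition[OF M stationary_in_policies[OF \<sigma>]]
proof eventually_elim
  fix \<omega> assume *: "\<forall>t. 0 < flow M (stationary \<sigma>) t (\<omega> t) (\<omega> (Suc t))"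
  show "\<forall>t. 0 < chain_prob M \<sigma> (\<omega> t) (\<omega> (Suc t))"
  proof
    fix t
    have "chain_prob M \<sigma> (\<omega> t) (\<omega> (Suc t)) \<noteq> 0"
      using *[rule_format, of t] by (auto simp: flow_stationary[OF \<sigma>])
    then show "0 < chain_prob M \<sigma> (\<omega> t) (\<omega> (Suc t))"
      using chain_prob_nonneg[OF M, of \<sigma> "\<omega> t" "\<omega> (Suc t)"] by simp
  qed
qed

lemma measure_paths_not_in:
  "measure (paths M \<pi>) {\<omega>. \<omega> t \<notin> C} = (\<Sum>s\<in>-C. state_prob M \<pi> t s)"
proof -
  have "determined_by (Suc t) (\<lambda>\<omega> :: nat \<Rightarrow> 'a. \<omega> t \<notin> C)" by (rule determined_byI) auto
  then have "measure (paths M \<pi>) {\<omega>. \<omega> t \<notin> C} = (\<Sum>s\<in>UNIV. state_prob M \<pi> t s * of_bool (s \<notin> C))"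
    by (subst measure_paths_eq_integral)
       (auto simp: integral_paths_state[where g="\<lambda>s. of_bool (s \<notin> C)"])
  also have "\<dots> = (\<Sum>s\<in>-C. state_prob M \<pi> t s)"
    by (rule sum.mono_neutral_cong_right) auto
  finally show ?thesis .
qed

text \<open>
  The density of the path law of \<open>\<sigma>\<close> is the limit of the finite-horizon likelihood ratios, which
  become constant once the path has entered the closed set \<open>C\<close>; truncating them outside of that
  event makes them monotone.
\<close>

lemma density_paths:
  assumes M: "is_mdp M" and \<mu>: "\<mu> \<in> stationary_policies M" and \<sigma>: "\<sigma> \<in> stationary_policies M"
    and w: "\<And>s q. 0 \<le> w s q" "\<And>s q. chain_prob M \<sigma> s q = chain_prob M \<mu> s q * w s q"
    and closed: "\<And>s q. s \<in> C \<Longrightarrow> q \<notin> C \<Longrightarrow> chain_prob M \<mu> s q = 0"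
    and one: "\<And>s q. s \<in> C \<Longrightarrow> w s q = 1"
    and summ: "\<And>s. s \<notin> C \<Longrightarrow> summable (\<lambda>t. state_prob M (stationary \<sigma>) t s)"
  shows "density (paths M (stationary \<mu>)) (\<lambda>\<omega>. SUP n. ennreal (weight_prod w n \<omega> * of_bool (\<omega> n \<in> C)))
    = paths M (stationary \<sigma>)"
proof -
  let ?P = "paths M (stationary \<mu>)" and ?Q = "paths M (stationary \<sigma>)"
  interpret Q: prob_space ?Q by (rule prob_space_paths)
  let ?f = "\<lambda>n \<omega>. ennreal (weight_prod w n \<omega> * of_bool (\<omega> n \<in> C))"
  have fd: "determined_by (Suc n) (\<lambda>\<omega>. weight_prod w n \<omega> * of_bool (\<omega> n \<in> C))" for n
    by (rule determined_byI, intro arg_cong2[where f="(*)"] determined_byD[OF determined_by_weight_prod]) auto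
  have f [measurable]: "?f n \<in> borel_measurable ?P" for n
    by (intro measurable_compose[OF _ measurable_ennreal] borel_measurable_integrable[OF integrable_paths[OF fd]])
  have D [measurable]: "(\<lambda>\<omega>. SUP n. ?f n \<omega>) \<in> borel_measurable ?P" by measurable
  have mono: "AE \<omega> in ?P. ?f n \<omega> \<le> ?f (Suc n) \<omega>" for n
    using AE_paths_chain[OF M \<mu>]
  proof eventually_elim
    fix \<omega> assume "\<forall>t. 0 < chain_prob M \<mu> (\<omega> t) (\<omega> (Suc t))"
    then have "\<omega> n \<in> C \<Longrightarrow> \<omega> (Suc n) \<in> C" using closed by (metis less_irrefl)
    then show "?f n \<omega> \<le> ?f (Suc n) \<omega>"
      by (cases "\<omega> n \<in> C") (auto simp: weight_prod_def one)
  qed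
  \<comment> \<open>Truncation loses no mass in the limit: the expected time outside
    \<open>C\<close> is finite, so the probability of still being outside tends to 0.\<close>
  have lim0: "(\<lambda>n. measure ?Q {\<omega>. \<omega> n \<notin> C}) \<longlonglongrightarrow> 0"
    unfolding measure_paths_not_in using summ by (intro tendsto_null_sum summable_LIMSEQ_zero) auto
  have cyl: "emeasure (density ?P (\<lambda>\<omega>. SUP n. ?f n \<omega>)) {\<omega>. A \<omega>} = emeasure ?Q {\<omega>. A \<omega>}"
    if A: "determined_by m A" for A m
  proof -
    have sA: "{\<omega>. A \<omega>} \<in> sets (paths M \<pi>)" for \<pi> :: "('a, 'b) policy" by (rule sets_paths_determined[OF A])
    note sA[of "stationary \<mu>", measurable]
    let ?I = "\<lambda>n. \<integral>\<^sup>+\<omega>. ?f n \<omega> * indicator {\<omega>. A \<omega>} \<omega> \<partial>?P"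
    have "emeasure (density ?P (\<lambda>\<omega>. SUP n. ?f n \<omega>)) {\<omega>. A \<omega>}
      = (\<integral>\<^sup>+\<omega>. (SUP n. ?f n \<omega> * indicator {\<omega>. A \<omega>} \<omega>) \<partial>?P)"
      by (subst emeasure_density[OF D sA]) (simp add: SUP_mult_right_ennreal)
    also have "\<dots> = (SUP n. ?I n)"
    proof (rule nn_integral_monotone_convergence_SUP_AE)
      show "AE \<omega> in ?P. ?f n \<omega> * indicator {\<omega>. A \<omega>} \<omega> \<le> ?f (Suc n) \<omega> * indicator {\<omega>. A \<omega>} \<omega>" for n
        using mono[of n] by eventually_elim (rule mult_right_mono, auto)
    qed measurable
    finally have eq: "emeasure (density ?P (\<lambda>\<omega>. SUP n. ?f n \<omega>)) {\<omega>. A \<omega>} = (SUP n. ?I n)" .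
    have "incseq ?I"
    proof (rule incseq_SucI, rule nn_integral_mono_AE)
      show "AE \<omega> in ?P. ?f n \<omega> * indicator {\<omega>. A \<omega>} \<omega> \<le> ?f (Suc n) \<omega> * indicator {\<omega>. A \<omega>} \<omega>" for n
        using mono[of n] by eventually_elim (rule mult_right_mono, auto)
    qed
    then have l1: "?I \<longlonglongrightarrow> (SUP n. ?I n)" by (rule LIMSEQ_SUP)
    \<comment> \<open>From \<open>n = m\<close> on, \<open>A\<close> is decided by the coordinates
      that the weight depends on, so \<open>change_of_measure\<close> evaluates the truncated
      integral.\<close>
    have In: "?I n = ennreal (measure ?Q {\<omega>. A \<omega> \<and> \<omega> n \<in> C})" if "m \<le> n" for n
    proof -
      have d: "determined_by (Suc n) (\<lambda>\<omega>. A \<omega> \<and> \<omega> n \<in> C)"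
        by (rule determined_byI, intro arg_cong2[where f="(\<and>)"] determined_byD[OF A]) (use that in auto)
      have d': "determined_by (Suc n) (\<lambda>\<omega>. of_bool (A \<omega> \<and> \<omega> n \<in> C) :: real)"
        by (rule determined_byI, rule arg_cong[where f=of_bool], rule determined_byD[OF d])
      have d'': "determined_by (Suc n) (\<lambda>\<omega>. weight_prod w n \<omega> * of_bool (A \<omega> \<and> \<omega> n \<in> C))"
        by (rule determined_byI, intro arg_cong2[where f="(*)"] determined_byD[OF determined_by_weight_prod]
            determined_byD[OF d']) auto
      have "?I n = (\<integral>\<^sup>+\<omega>. ennreal (weight_prod w n \<omega> * of_bool (A \<omega> \<and> \<omega> n \<in> C)) \<partial>?P)"
        by (intro nn_integral_cong) (auto simp: indicator_def)
      also have "\<dots> = ennreal (\<integral>\<omega>. weight_prod w n \<omega> * of_bool (A \<omega> \<and> \<omega> n \<in> C) \<partial>?P)"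
        using weight_prod_nonneg[of w n, OF w(1)]
        by (intro nn_integral_eq_integral integrable_paths[OF d'']) auto
      also have "(\<integral>\<omega>. weight_prod w n \<omega> * of_bool (A \<omega> \<and> \<omega> n \<in> C) \<partial>?P)
          = measure ?Q {\<omega>. A \<omega> \<and> \<omega> n \<in> C}"
        unfolding measure_paths_eq_integral[OF d] by (rule change_of_measure[OF M \<mu> \<sigma> w(2) d', symmetric])
      finally show ?thesis .
    qed
    have "(\<lambda>n. measure ?Q {\<omega>. A \<omega> \<and> \<omega> n \<in> C}) \<longlonglongrightarrow> measure ?Q {\<omega>. A \<omega>}"
    proof (rule tendsto_sandwich)
      have sC: "{\<omega>. \<omega> n \<notin> C} \<in> sets ?Q" "{\<omega>. \<omega> n \<in> C} \<in> sets ?Q" for n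
        by (rule sets_paths_determined[of "Suc n"], rule determined_byI, simp)+
      have sAC: "{\<omega>. A \<omega> \<and> \<omega> n \<in> C} \<in> sets ?Q" for n
        using sets.Int[OF sA[of "stationary \<sigma>"] sC(2)[of n]] by (simp add: Collect_conj_eq)
      show "\<forall>\<^sub>F n in sequentially. measure ?Q {\<omega>. A \<omega>} - measure ?Q {\<omega>. \<omega> n \<notin> C}
          \<le> measure ?Q {\<omega>. A \<omega> \<and> \<omega> n \<in> C}"
      proof (rule always_eventually, rule allI)
        fix n
        have "measure ?Q {\<omega>. A \<omega>} \<le> measure ?Q ({\<omega>. A \<omega> \<and> \<omega> n \<in> C} \<union> {\<omega>. \<omega> n \<notin> C})"
          using sAC sC by (intro Q.finite_measure_mono) auto
        also have "\<dots> \<le> measure ?Q {\<omega>. A \<omega> \<and> \<omega> n \<in> C} + measure ?Q {\<omega>. \<omega> n \<notin> C}"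
          by (rule measure_Un_le[OF sAC sC(1)])
        finally show "measure ?Q {\<omega>. A \<omega>} - measure ?Q {\<omega>. \<omega> n \<notin> C} \<le> measure ?Q {\<omega>. A \<omega> \<and> \<omega> n \<in> C}"
          by simp
      qed
      show "\<forall>\<^sub>F n in sequentially. measure ?Q {\<omega>. A \<omega> \<and> \<omega> n \<in> C} \<le> measure ?Q {\<omega>. A \<omega>}"
        by (intro always_eventually allI Q.finite_measure_mono) (use sA in auto)
      show "(\<lambda>n. measure ?Q {\<omega>. A \<omega>} - measure ?Q {\<omega>. \<omega> n \<notin> C}) \<longlonglongrightarrow> measure ?Q {\<omega>. A \<omega>}"
        using tendsto_diff[OF tendsto_const lim0] by simp
    qed auto
    then have "(\<lambda>n. ennreal (measure ?Q {\<omega>. A \<omega> \<and> \<omega> n \<in> C})) \<longlonglongrightarrow> ennreal (measure ?Q {\<omega>. A \<omega>})"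
      by (rule tendsto_ennrealI)
    then have "?I \<longlonglongrightarrow> emeasure ?Q {\<omega>. A \<omega>}"
      unfolding Q.emeasure_eq_measure
      by (rule Lim_transform_eventually) (use In in \<open>auto simp: eventually_sequentially intro!: exI[of _ m]\<close>)
    with l1 show ?thesis unfolding eq by (rule LIMSEQ_unique)
  qed
  show ?thesis
  proof (rule measure_eqI_PiM_infinite[symmetric])
    show "finite_measure ?Q" by (rule Q.finite_measure_axioms)
    fix A :: "nat \<Rightarrow> 'a set" and J :: "nat set" assume "finite J"
    then obtain m where m: "J \<subseteq> {..<m}" using finite_nat_iff_bounded by blast
    have "prod_emb UNIV (\<lambda>_. count_space UNIV) J (Pi\<^sub>E J A) = {\<omega>. \<forall>j\<in>J. \<omega> j \<in> A j}"
      by (auto simp: prod_emb_def PiE_iff)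
    moreover have "determined_by m (\<lambda>\<omega>. \<forall>j\<in>J. \<omega> j \<in> A j)"
      by (rule determined_byI) (use m in \<open>auto simp: subset_iff\<close>)
    ultimately show "emeasure ?Q (prod_emb UNIV (\<lambda>_. count_space UNIV) J (Pi\<^sub>E J A))
       = emeasure (density ?P (\<lambda>\<omega>. SUP n. ?f n \<omega>)) (prod_emb UNIV (\<lambda>_. count_space UNIV) J (Pi\<^sub>E J A))"
      using cyl by simp
  qed simp_all
qed

text \<open>By Borel-Cantelli almost every path is eventually in \<open>C\<close>, where the
  log-ratio stops growing; the log-density is thus a finite sum along the path. It is dominated by a
  constant times the time outside \<open>C\<close>, which permits exchanging expectation and
  summation over time.\<close>

lemma KL_stationary:
  fixes M :: "('s::finite, 'a::finite) mdp"
  assumes M: "is_mdp M" and \<mu>: "\<mu> \<in> stationary_policies M" and \<sigma>: "\<sigma> \<in> stationary_policies M"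
    and w: "\<And>s q. 0 \<le> w s q" "\<And>s q. chain_prob M \<sigma> s q = chain_prob M \<mu> s q * w s q"
    and closed: "\<And>s q. s \<in> C \<Longrightarrow> q \<notin> C \<Longrightarrow> chain_prob M \<mu> s q = 0"
    and one: "\<And>s q. s \<in> C \<Longrightarrow> w s q = 1"
    and summ: "\<And>s. s \<notin> C \<Longrightarrow> summable (\<lambda>t. state_prob M (stationary \<sigma>) t s)"
  shows "absolutely_continuous (paths M (stationary \<mu>)) (paths M (stationary \<sigma>))"
    and "KL_to_reference M \<mu> (stationary \<sigma>) =
      ereal (\<Sum>t. \<Sum>s\<in>UNIV. \<Sum>q\<in>UNIV. flow M (stationary \<sigma>) t s q * ln (w s q))"
proof -
  let ?P = "paths M (stationary \<mu>)" and ?Q = "paths M (stationary \<sigma>)"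
  interpret P: prob_space ?P by (rule prob_space_paths)
  interpret Q: prob_space ?Q by (rule prob_space_paths)
  let ?D = "\<lambda>\<omega>. SUP n. ennreal (weight_prod w n \<omega> * of_bool (\<omega> n \<in> C))"
  have dens: "density ?P ?D = ?Q"
    by (rule density_paths[OF assms(1-3)]) (use assms(4-) in auto)
  have D [measurable]: "?D \<in> borel_measurable ?P"
  proof -
    have fd: "determined_by (Suc n) (\<lambda>\<omega>. weight_prod w n \<omega> * of_bool (\<omega> n \<in> C))" for n
      by (rule determined_byI, intro arg_cong2[where f="(*)"] determined_byD[OF determined_by_weight_prod]) auto
    have [measurable]: "(\<lambda>\<omega>. ennreal (weight_prod w n \<omega> * of_bool (\<omega> n \<in> C))) \<in> borel_measurable ?P" for n
      by (intro measurable_compose[OF _ measurable_ennreal] borel_measurable_integrable[OF integrable_paths[OF fd]])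
    show ?thesis by measurable
  qed
  show ac: "absolutely_continuous ?P ?Q"
    unfolding dens[symmetric] by (rule absolutely_continuousI_density[OF D])
  have RN: "AE \<omega> in ?Q. ?D \<omega> = RN_deriv ?P ?Q \<omega>"
    using P.RN_deriv_unique[OF D dens] by (rule absolutely_continuous_AE[OF _ ac, rotated]) simp
  have ev: "AE \<omega> in ?Q. eventually (\<lambda>n. \<omega> n \<in> C) sequentially"
  proof -
    have "AE \<omega> in ?Q. eventually (\<lambda>n. \<omega> \<in> space ?Q - {\<omega>. \<omega> n \<notin> C}) sequentially"
    proof (rule borel_cantelli_AE1)
      show "{\<omega>. \<omega> n \<notin> C} \<in> sets ?Q" for n
        by (rule sets_paths_determined[of "Suc n"], rule determined_byI, auto)
      show "summable (\<lambda>n. measure ?Q {\<omega>. \<omega> n \<notin> C})"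
        unfolding measure_paths_not_in using summ by (intro summable_sum) auto
    qed (simp add: Q.emeasure_eq_measure)
    then show ?thesis by simp
  qed
  let ?c = "\<lambda>t \<omega>. ln (w (\<omega> t) (\<omega> (Suc t)))"
  have zero: "?c t \<omega> = 0" if "\<omega> t \<in> C" for t \<omega> using one[OF that] by simp
  have L: "AE \<omega> in ?Q. entropy_density (exp 1) ?P ?Q \<omega> = (\<Sum>t. ?c t \<omega>)"
    using RN ev AE_paths_chain[OF M \<sigma>]
  proof eventually_elim
    fix \<omega>
    assume RN: "?D \<omega> = RN_deriv ?P ?Q \<omega>" and ev: "eventually (\<lambda>n. \<omega> n \<in> C) sequentially"
      and pos: "\<forall>t. 0 < chain_prob M \<sigma> (\<omega> t) (\<omega> (Suc t))"
    obtain N where N: "\<And>n. N \<le> n \<Longrightarrow> \<omega> n \<in> C" using ev by (auto simp: eventually_sequentially)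
    have wpos: "w (\<omega> t) (\<omega> (Suc t)) \<noteq> 0" for t
      using pos[rule_format, of t] by (auto simp: w(2))
    have step': "\<omega> n \<in> C \<Longrightarrow> \<omega> (Suc n) \<in> C" for n
      using pos[rule_format, of n] closed[of "\<omega> n" "\<omega> (Suc n)"] unfolding w(2)
      by (metis less_irrefl mult_zero_left)
    have stay: "weight_prod w m \<omega> = weight_prod w n \<omega>" if "\<omega> n \<in> C" "n \<le> m" for n m
      using that(2)
    proof (induction m rule: dec_induct)
      case (step k)
      have "\<omega> k \<in> C" using step(1) that(1) step'
        by (induction k rule: dec_induct) auto
      then show ?case using step(3) by (simp add: weight_prod_def one)
    qed simp
    \<comment> \<open>A path that is in \<open>C\<close> once stays there, so every truncated ratio,
      also one before \<open>N\<close>, is either 0 or equal to the ratio at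
      \<open>N\<close>.\<close>
    have "?D \<omega> = ennreal (weight_prod w N \<omega>)"
    proof (rule antisym)
      show "?D \<omega> \<le> ennreal (weight_prod w N \<omega>)"
      proof (rule SUP_least)
        fix n
        have "weight_prod w n \<omega> = weight_prod w N \<omega>" if "\<omega> n \<in> C"
          using stay[OF that] stay[OF N] N[of N] by (metis nat_le_linear order_refl)
        then show "ennreal (weight_prod w n \<omega> * of_bool (\<omega> n \<in> C)) \<le> ennreal (weight_prod w N \<omega>)"
          by (cases "\<omega> n \<in> C") auto
      qed
      show "ennreal (weight_prod w N \<omega>) \<le> ?D \<omega>"
        by (rule SUP_upper2[of N]) (use N[of N] in auto)
    qed
    then have "entropy_density (exp 1) ?P ?Q \<omega> = ln (weight_prod w N \<omega>)"
      using weight_prod_nonneg[of w N \<omega>, OF w(1)]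
      by (simp add: entropy_density_def RN[symmetric] log_def)
    also have "\<dots> = (\<Sum>t<N. ?c t \<omega>)"
      unfolding weight_prod_def by (rule ln_prod) (use wpos in auto)
    also have "\<dots> = (\<Sum>t. ?c t \<omega>)"
      by (rule suminf_finite[symmetric]) (use N zero in auto)
    finally show "entropy_density (exp 1) ?P ?Q \<omega> = (\<Sum>t. ?c t \<omega>)" .
  qed
  have c: "determined_by (Suc (Suc t)) (?c t)" for t
    by (rule determined_byI) auto
  \<comment> \<open>There are finitely many pairs, so one constant bounds all log-ratios, whatever
    value \<open>ln\<close> takes at weight 0.\<close>
  define B where "B = (\<Sum>(s, q)\<in>UNIV. \<bar>ln (w s q)\<bar>)"
  have B: "\<bar>ln (w s q)\<bar> \<le> B" for s q
    unfolding B_def using member_le_sum[of "(s, q)" UNIV "\<lambda>(s, q). \<bar>ln (w s q)\<bar>"] by auto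
  have int: "integrable ?Q (?c t)" for t by (rule integrable_paths[OF c])
  have AEs: "AE \<omega> in ?Q. summable (\<lambda>t. norm (?c t \<omega>))"
    using ev
  proof eventually_elim
    fix \<omega> assume "eventually (\<lambda>n. \<omega> n \<in> C) sequentially"
    then obtain N where N: "\<And>n. N \<le> n \<Longrightarrow> \<omega> n \<in> C" by (auto simp: eventually_sequentially)
    show "summable (\<lambda>t. norm (?c t \<omega>))"
      by (rule summable_finite[of "{..<N}"]) (use N zero in auto)
  qed
  have sn: "summable (\<lambda>t. \<integral>\<omega>. norm (?c t \<omega>) \<partial>?Q)"
  proof (rule summable_comparison_test')
    show "summable (\<lambda>t. B * measure ?Q {\<omega>. \<omega> t \<notin> C})"
      unfolding measure_paths_not_in using summ by (intro summable_mult summable_sum) auto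
    fix t
    have d: "determined_by (Suc t) (\<lambda>\<omega> :: nat \<Rightarrow> 's. \<omega> t \<notin> C)" by (rule determined_byI) auto
    have d': "determined_by (Suc t) (\<lambda>\<omega> :: nat \<Rightarrow> 's. B * of_bool (\<omega> t \<notin> C))" by (rule determined_byI) auto
    have "(\<integral>\<omega>. norm (?c t \<omega>) \<partial>?Q) \<le> (\<integral>\<omega>. B * of_bool (\<omega> t \<notin> C) \<partial>?Q)"
    proof (rule integral_mono)
      show "norm (?c t \<omega>) \<le> B * of_bool (\<omega> t \<notin> C)" for \<omega>
        using zero[of \<omega> t] B[of "\<omega> t" "\<omega> (Suc t)"] by (cases "\<omega> t \<in> C") auto
    qed (use int integrable_paths[OF d'] in auto)
    also have "\<dots> = B * measure ?Q {\<omega>. \<omega> t \<notin> C}"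
      by (simp add: measure_paths_eq_integral[OF d])
    finally show "norm (\<integral>\<omega>. norm (?c t \<omega>) \<partial>?Q) \<le> B * measure ?Q {\<omega>. \<omega> t \<notin> C}"
      by simp
  qed
  have iL: "integrable ?Q (\<lambda>\<omega>. \<Sum>t. ?c t \<omega>)"
    by (rule integrable_suminf[OF int AEs sn])
  have mE: "entropy_density (exp 1) ?P ?Q \<in> borel_measurable ?Q"
    using measurable_entropy_density[of "exp 1" ?P ?Q] by simp
  have iE: "integrable ?Q (entropy_density (exp 1) ?P ?Q)"
    using iL by (rule integrable_cong_AE_imp[OF _ mE]) (use L in auto)
  have "KL_divergence (exp 1) ?P ?Q = (\<integral>\<omega>. (\<Sum>t. ?c t \<omega>) \<partial>?Q)"
    unfolding KL_divergence_def by (rule integral_cong_AE[OF mE _ L]) (use iL in simp)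
  also have "\<dots> = (\<Sum>t. integral\<^sup>L ?Q (?c t))"
    by (rule integral_suminf[OF int AEs sn])
  also have "\<dots> = (\<Sum>t. \<Sum>s\<in>UNIV. \<Sum>q\<in>UNIV. flow M (stationary \<sigma>) t s q * ln (w s q))"
    by (simp add: integral_paths_transition[OF M stationary_in_policies[OF \<sigma>], where g="\<lambda>s q. ln (w s q)"])
  finally show "KL_to_reference M \<mu> (stationary \<sigma>) =
      ereal (\<Sum>t. \<Sum>s\<in>UNIV. \<Sum>q\<in>UNIV. flow M (stationary \<sigma>) t s q * ln (w s q))"
    using ac iE by (simp add: KL_to_reference_def KL_def)
qed

subsection \<open>Closed states and time spent outside of them\<close>

text \<open>Every member represents its communicating class, so closedness can be tested on the
  class of \<open>s\<close> itself.\<close>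

lemma closed_states_iff:
  "s \<in> closed_states M \<mu> \<longleftrightarrow> (\<forall>q. (s, q) \<in> accessible M \<mu> \<longrightarrow> (q, s) \<in> accessible M \<mu>)"
proof -
  let ?A = "accessible M \<mu>"
  let ?r = "?A \<inter> ?A\<inverse>"
  have A: "(x, x) \<in> ?A" "(x, y) \<in> ?A \<Longrightarrow> (y, z) \<in> ?A \<Longrightarrow> (x, z) \<in> ?A" for x y z
    unfolding accessible_def by auto
  have "s \<in> closed_states M \<mu> \<longleftrightarrow> (\<exists>x. s \<in> ?r `` {x} \<and> ?A `` (?r `` {x}) \<subseteq> ?r `` {x})"
    unfolding closed_states_def communicating_classes_def closed_class_def quotient_def by blast
  also have "\<dots> \<longleftrightarrow> (\<forall>q. (s, q) \<in> ?A \<longrightarrow> (q, s) \<in> ?A)" (is "?L \<longleftrightarrow> ?R")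
  proof
    assume ?L then show ?R using A by blast
  next
    assume ?R
    then have "?A `` (?r `` {s}) \<subseteq> ?r `` {s}" using A by blast
    moreover have "s \<in> ?r `` {s}" using A by blast
    ultimately show ?L by blast
  qed
  finally show ?thesis .
qed

lemma accessible_step: "0 < chain_prob M \<mu> s q \<Longrightarrow> (s, q) \<in> accessible M \<mu>"
  unfolding accessible_def by auto

lemma accessible_trans:
  "(s, q) \<in> accessible M \<mu> \<Longrightarrow> (q, r) \<in> accessible M \<mu> \<Longrightarrow> (s, r) \<in> accessible M \<mu>"
  unfolding accessible_def by (rule rtrancl_trans)

lemma closed_states_accessible:
  "s \<in> closed_states M \<mu> \<Longrightarrow> (s, q) \<in> accessible M \<mu> \<Longrightarrow> q \<in> closed_states M \<mu>"
  unfolding closed_states_iff using accessible_trans by metis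

lemma chain_prob_leaves_closed_states:
  assumes "is_mdp M" "s \<in> closed_states M \<mu>" "q \<notin> closed_states M \<mu>"
  shows "chain_prob M \<mu> s q = 0"
  using assms chain_prob_nonneg[OF assms(1), of \<mu> s q] closed_states_accessible accessible_step
  by (metis less_le)

lemma absorbing_tprob:
  assumes M: "is_mdp M" and "absorbing M s" "a \<in> avail M s"
  shows "tprob M s a q = of_bool (q = s)"
proof (cases "q = s")
  case False
  have "(\<Sum>q\<in>UNIV. tprob M s a q) = 1" "tprob M s a s = 1"
    using assms by (auto simp: is_mdp_def absorbing_def)
  then have "(\<Sum>q\<in>UNIV - {s}. tprob M s a q) = 0"
    by (subst (asm) sum.remove[of _ s]) auto
  then have "\<forall>q\<in>UNIV - {s}. tprob M s a q = 0"
    by (subst (asm) sum_nonneg_eq_0_iff) (use M in \<open>auto simp: is_mdp_def\<close>)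
  then show ?thesis using False by auto
qed (use assms in \<open>auto simp: absorbing_def\<close>)

lemma absorbing_accessible:
  assumes M: "is_mdp M" and s: "absorbing M s" and q: "(s, q) \<in> accessible M \<mu>"
  shows "q = s"
  using q unfolding accessible_def
proof (induction rule: rtrancl_induct)
  case (step y z)
  have "chain_prob M \<mu> s z = (\<Sum>a\<in>avail M s. of_bool (z = s) * pmf (\<mu> s) a)"
    unfolding chain_prob_def by (intro sum.cong refl) (simp add: absorbing_tprob[OF M s])
  then show ?case using step by (cases "z = s") auto
qed simp

lemma absorbing_closed_states:
  assumes M: "is_mdp M" and s: "absorbing M s"
  shows "s \<in> closed_states M \<mu>"
  unfolding closed_states_iff using absorbing_accessible[OF assms] by auto

text \<open>Ensures that no closed state feeds the target set from outside, which is why the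
  reachability constraint of (II) may count inflow from decision states only.\<close>

lemma chain_prob_closed_to_absorbing:
  assumes M: "is_mdp M" and q: "q \<in> closed_states M \<mu>" and s: "absorbing M s" "q \<noteq> s"
  shows "chain_prob M \<mu> q s = 0"
proof (rule ccontr)
  assume "chain_prob M \<mu> q s \<noteq> 0"
  then have "(q, s) \<in> accessible M \<mu>"
    using chain_prob_nonneg[OF M, of \<mu> q s] by (intro accessible_step) simp
  then have "(s, q) \<in> accessible M \<mu>" using q by (auto simp: closed_states_iff)
  then show False using absorbing_accessible[OF M s(1)] s(2) by blast
qed

text \<open>Among the states accessible from \<open>s\<close>, take one with the fewest accessible
  states. Whatever it reaches has an accessible set contained in its own, by minimality an equal
  one, and hence leads back.\<close>

lemma closed_states_reachable:
  fixes M :: "('s::finite, 'a) mdp"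
  shows "\<exists>q\<in>closed_states M \<mu>. (s, q) \<in> accessible M \<mu>"
proof -
  let ?A = "accessible M \<mu>"
  have ref: "(x, x) \<in> ?A" for x unfolding accessible_def by auto
  define q where "q = (ARG_MIN (\<lambda>q. card (?A `` {q})) q. (s, q) \<in> ?A)"
  have q: "(s, q) \<in> ?A" and min: "\<And>y. (s, y) \<in> ?A \<Longrightarrow> card (?A `` {q}) \<le> card (?A `` {y})"
    unfolding q_def
    using arg_min_natI[of "\<lambda>q. (s, q) \<in> ?A" s "\<lambda>q. card (?A `` {q})", OF ref]
      arg_min_nat_le[of "\<lambda>q. (s, q) \<in> ?A" _ "\<lambda>q. card (?A `` {q})"] by auto
  have "(y, q) \<in> ?A" if y: "(q, y) \<in> ?A" for y
  proof -
    have sub: "?A `` {y} \<subseteq> ?A `` {q}" by (auto intro: accessible_trans[OF y])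
    have "card (?A `` {q}) \<le> card (?A `` {y})" by (rule min[OF accessible_trans[OF q y]])
    then have "?A `` {y} = ?A `` {q}" using sub by (intro card_seteq) auto
    then show ?thesis using ref by blast
  qed
  then show ?thesis using q by (auto simp: closed_states_iff)
qed

text \<open>
  With \<open>d\<close> the distance to the closed states and \<open>\<beta>\<close> half the least positive transition
  probability, \<open>2 - \<beta> ^ d\<close> decreases in expectation along the chain outside of the closed states.
\<close>

lemma lyapunov_function:
  fixes M :: "('s::finite, 'a::finite) mdp"
  assumes M: "is_mdp M" and \<mu>: "\<mu> \<in> stationary_policies M"
  obtains h :: "'s \<Rightarrow> real" and c :: real
  where "0 < c" "\<And>s. 1 \<le> h s" "\<And>s. s \<in> closed_states M \<mu> \<Longrightarrow> h s = 1"
    "\<And>s. s \<notin> closed_states M \<mu> \<Longrightarrow> exp c * (\<Sum>q\<in>UNIV. chain_prob M \<mu> s q * h q) \<le> h s"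
proof -
  let ?C = "closed_states M \<mu>"
  let ?E = "{(s, q). chain_prob M \<mu> s q > 0}"
  define d where "d s = (LEAST n. \<exists>q\<in>?C. (s, q) \<in> ?E ^^ n)" for s
  have ex: "\<exists>n. \<exists>q\<in>?C. (s, q) \<in> ?E ^^ n" for s
    using closed_states_reachable[of M \<mu> s] unfolding accessible_def by (meson rtrancl_imp_relpow)
  have dI: "\<exists>q\<in>?C. (s, q) \<in> ?E ^^ d s" for s
    unfolding d_def using ex by (rule LeastI_ex)
  have d0: "d s = 0" if "s \<in> ?C" for s
    unfolding d_def by (rule Least_eq_0) (use that in auto)
  \<comment> \<open>Inserting 1 guards against an empty set and gives
    \<open>\<delta> \<le> 1\<close>.\<close>
  define \<delta> where "\<delta> = Min (insert 1 {p. \<exists>s q. p = chain_prob M \<mu> s q \<and> 0 < p})"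
  have fin: "finite {p. \<exists>s q. p = chain_prob M \<mu> s q \<and> 0 < p}"
    by (rule finite_subset[of _ "(\<lambda>(s, q). chain_prob M \<mu> s q) ` UNIV"]) auto
  have \<delta>: "0 < \<delta>" "\<delta> \<le> 1" unfolding \<delta>_def using fin by auto
  have \<delta>_le: "\<delta> \<le> chain_prob M \<mu> s q" if "0 < chain_prob M \<mu> s q" for s q
    unfolding \<delta>_def using fin that by (intro Min_le) auto
  \<comment> \<open>The factor 2 creates the drift: the transition towards the closed states alone
    contributes \<open>\<delta> * \<beta> ^ k = 2 * \<beta> ^ Suc k\<close>, twice the current
    value, and the surplus is at least \<open>\<eta>\<close>.\<close>
  define \<beta> where "\<beta> = \<delta> / 2"
  have \<beta>: "0 < \<beta>" "\<beta> \<le> 1" using \<delta> by (auto simp: \<beta>_def)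
  define N where "N = Max (range d)"
  define \<eta> where "\<eta> = \<beta> ^ N"
  have \<eta>: "0 < \<eta>" using \<beta> by (simp add: \<eta>_def)
  define h where "h s = 2 - \<beta> ^ d s" for s
  have h: "1 \<le> h s" "h s \<le> 2" for s
    unfolding h_def using \<beta> power_le_one[of \<beta> "d s"] by auto
  have drift: "(\<Sum>q\<in>UNIV. chain_prob M \<mu> s q * h q) \<le> h s - \<eta>" if s: "s \<notin> ?C" for s
  proof -
    have "d s \<noteq> 0"
    proof
      assume "d s = 0"
      then obtain q where "q \<in> ?C" "(s, q) \<in> ?E ^^ 0" using dI[of s] by metis
      then show False using s by simp
    qed
    then obtain k where k: "d s = Suc k" using not0_implies_Suc by blast
    obtain q r where r: "r \<in> ?C" "(s, q) \<in> ?E" "(q, r) \<in> ?E ^^ k"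
      using dI[of s] unfolding k by (meson relpow_Suc_D2)
    have "d q \<le> k" unfolding d_def by (rule Least_le) (use r in blast)
    have "d s \<le> N" unfolding N_def by (rule Max_ge) auto
    have "\<beta> ^ d s + \<eta> \<le> \<delta> * \<beta> ^ k"
    proof -
      have "\<eta> \<le> \<beta> ^ d s" unfolding \<eta>_def using \<open>d s \<le> N\<close> \<beta> by (intro power_decreasing) auto
      then show ?thesis unfolding k by (simp add: \<beta>_def)
    qed
    also have "\<dots> \<le> chain_prob M \<mu> s q * \<beta> ^ d q"
      using \<delta>_le[of s q] r(2) \<open>d q \<le> k\<close> \<beta> \<delta> by (intro mult_mono power_decreasing) auto
    also have "\<dots> \<le> (\<Sum>q\<in>UNIV. chain_prob M \<mu> s q * \<beta> ^ d q)"
      using \<beta> chain_prob_nonneg[OF M] by (intro member_le_sum) auto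
    finally have "\<beta> ^ d s + \<eta> \<le> (\<Sum>q\<in>UNIV. chain_prob M \<mu> s q * \<beta> ^ d q)" .
    moreover have "(\<Sum>q\<in>UNIV. chain_prob M \<mu> s q * h q) = 2 - (\<Sum>q\<in>UNIV. chain_prob M \<mu> s q * \<beta> ^ d q)"
      using sum_chain_prob[OF M \<mu>, of s]
      by (simp add: h_def right_diff_distrib sum_subtractf flip: sum_distrib_right)
    ultimately show ?thesis by (simp add: h_def)
  qed
  show thesis
  proof
    \<comment> \<open>Since \<open>h\<close> is at most 2, an additive decrease by
      \<open>\<eta>\<close> is a multiplicative one by \<open>1 - \<eta> / 2\<close>, which is at
      most \<open>exp (- (\<eta> / 2))\<close>.\<close>
    show "0 < \<eta> / 2" using \<eta> by simp
    show "h s = 1" if "s \<in> ?C" for s using d0[OF that] by (simp add: h_def)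
    show "1 \<le> h s" for s by (rule h)
    show "exp (\<eta> / 2) * (\<Sum>q\<in>UNIV. chain_prob M \<mu> s q * h q) \<le> h s" if "s \<notin> ?C" for s
    proof -
      have "(\<Sum>q\<in>UNIV. chain_prob M \<mu> s q * h q) \<le> h s * (1 + - (\<eta> / 2))"
      proof -
        have "\<eta> * h s \<le> \<eta> * 2" using h(2) \<eta> by (intro mult_left_mono) auto
        moreover have "h s * (1 + - (\<eta> / 2)) = h s - \<eta> * h s / 2" by (simp add: algebra_simps)
        ultimately show ?thesis using drift[OF that] by linarith
      qed
      also have "\<dots> \<le> h s * exp (- (\<eta> / 2))"
        using h(1)[of s] by (intro mult_left_mono exp_ge_add_one_self) auto
      finally show ?thesis by (simp add: exp_minus field_simps)
    qed
  qed
qed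

section \<open>Uniform bound for the expected time in transient states\<close>

lemma sum_flow:
  assumes M: "is_mdp M" and \<pi>: "\<pi> \<in> policies M"
  shows "(\<Sum>q\<in>UNIV. flow M \<pi> t s q) = state_prob M \<pi> t s"
proof -
  have "(\<Sum>q\<in>UNIV. flow M \<pi> t s q) = (\<Sum>a\<in>UNIV. visit_prob M \<pi> t s a * (\<Sum>q\<in>UNIV. tprob M s a q))"
    unfolding flow_def by (subst sum.swap) (simp add: sum_distrib_left)
  also have "visit_prob M \<pi> t s a * (\<Sum>q\<in>UNIV. tprob M s a q) = visit_prob M \<pi> t s a" for a
    using M visit_prob_unavailable[OF \<pi>] by (cases "a \<in> avail M s") (auto simp: is_mdp_def)
  then have "(\<Sum>a\<in>UNIV. visit_prob M \<pi> t s a * (\<Sum>q\<in>UNIV. tprob M s a q)) = state_prob M \<pi> t s"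
    by (simp only: state_prob_def)
  finally show ?thesis .
qed

text \<open>The logarithm of the weights telescopes in \<open>ln h\<close>: what remains is
  \<open>c\<close> times the expected time in transient states, a final term that is nonnegative
  because \<open>h \<ge> 1\<close>, and the initial term, which is \<open>B\<close>. The constants
  precede the policy in the quantification; the later compactness argument depends on this
  uniformity.\<close>

lemma state_prob_sum_bound:
  fixes M :: "('s::finite, 'a::finite) mdp"
  assumes M: "is_mdp M" and \<mu>: "\<mu> \<in> stationary_policies M"
  obtains c B :: real where "0 < c"
    "\<And>\<pi> s n. \<pi> \<in> policies M \<Longrightarrow> KL_to_reference M \<mu> \<pi> < \<infinity> \<Longrightarrow> s \<notin> closed_states M \<mu> \<Longrightarrow>
      ereal (c * (\<Sum>t<n. state_prob M \<pi> t s)) \<le> KL_to_reference M \<mu> \<pi> + ereal B"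
proof -
  let ?C = "closed_states M \<mu>"
  obtain h c where c: "0 < c" and h: "\<And>s. 1 \<le> h s" and h1: "\<And>s. s \<in> ?C \<Longrightarrow> h s = 1"
    and drift: "\<And>s. s \<notin> ?C \<Longrightarrow> exp c * (\<Sum>q\<in>UNIV. chain_prob M \<mu> s q * h q) \<le> h s"
    by (rule lyapunov_function[OF M \<mu>]) (rule that)
  have hp: "0 < h s" for s using h[of s] by simp
  \<comment> \<open>On closed states \<open>h\<close> is 1 and the chain does not leave them, so the
    row mean is 1 already and has no room for the factor \<open>exp c\<close>.\<close>
  define w where "w s q = h q / h s * (if s \<in> ?C then 1 else exp c)" for s q
  have wp: "0 < w s q" for s q using hp by (simp add: w_def)
  have wle: "(\<Sum>q\<in>UNIV. chain_prob M \<mu> s q * w s q) \<le> 1" for s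
  proof (cases "s \<in> ?C")
    case True
    have "(\<Sum>q\<in>UNIV. chain_prob M \<mu> s q * w s q) = (\<Sum>q\<in>UNIV. chain_prob M \<mu> s q)"
    proof (intro sum.cong refl)
      show "chain_prob M \<mu> s q * w s q = chain_prob M \<mu> s q" for q
        using True h1 chain_prob_leaves_closed_states[OF M True] by (cases "q \<in> ?C") (auto simp: w_def)
    qed
    then show ?thesis by (simp add: sum_chain_prob[OF M \<mu>])
  next
    case False
    have "(\<Sum>q\<in>UNIV. chain_prob M \<mu> s q * w s q) = exp c * (\<Sum>q\<in>UNIV. chain_prob M \<mu> s q * h q) / h s"
      using False by (simp add: w_def sum_distrib_left sum_divide_distrib ac_simps)
    then show ?thesis using drift[OF False] hp[of s] by simp
  qed
  have bound: "ereal (c * (\<Sum>t<n. state_prob M \<pi> t s0)) \<le> KL_to_reference M \<mu> \<pi> + ereal (ln (h (start M)))"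
    if \<pi>: "\<pi> \<in> policies M" and fin: "KL_to_reference M \<mu> \<pi> < \<infinity>" and s0: "s0 \<notin> ?C" for \<pi> s0 n
  proof -
    obtain K where K: "KL_to_reference M \<mu> \<pi> = ereal K" using KL_to_reference_finiteD(3)[OF fin] by blast
    let ?e = "\<lambda>t. \<Sum>s\<in>UNIV. state_prob M \<pi> t s * ln (h s)"
    have "(\<Sum>s\<in>UNIV. \<Sum>q\<in>UNIV. flow M \<pi> t s q * ln (w s q))
      = ?e (Suc t) - ?e t + c * (\<Sum>s\<in>-?C. state_prob M \<pi> t s)" for t
    proof -
      have "ln (w s q) = ln (h q) - ln (h s) + c * of_bool (s \<notin> ?C)" for s q
        using hp[of s] hp[of q] by (simp add: w_def ln_mult ln_div)
      then have e: "flow M \<pi> t s q * ln (w s q) = flow M \<pi> t s q * ln (h q) - flow M \<pi> t s q * ln (h s)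
          + flow M \<pi> t s q * (c * of_bool (s \<notin> ?C))" for s q
        by (simp only: distrib_left right_diff_distrib)
      have "(\<Sum>s\<in>UNIV. \<Sum>q\<in>UNIV. flow M \<pi> t s q * ln (w s q))
        = (\<Sum>s\<in>UNIV. \<Sum>q\<in>UNIV. flow M \<pi> t s q * ln (h q)) - (\<Sum>s\<in>UNIV. (\<Sum>q\<in>UNIV. flow M \<pi> t s q) * ln (h s))
          + (\<Sum>s\<in>UNIV. (\<Sum>q\<in>UNIV. flow M \<pi> t s q) * (c * of_bool (s \<notin> ?C)))"
        unfolding sum_distrib_right by (simp only: e sum.distrib sum_subtractf)
      also have "(\<Sum>s\<in>UNIV. \<Sum>q\<in>UNIV. flow M \<pi> t s q * ln (h q)) = ?e (Suc t)"
        by (subst sum.swap) (simp add: state_prob_Suc[OF M \<pi>] sum_distrib_right)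
      also have "(\<Sum>s\<in>UNIV. (\<Sum>q\<in>UNIV. flow M \<pi> t s q) * (c * of_bool (s \<notin> ?C)))
          = (\<Sum>s\<in>-?C. c * state_prob M \<pi> t s)"
        by (rule sum.mono_neutral_cong_right) (auto simp: sum_flow[OF M \<pi>])
      finally show ?thesis by (simp add: sum_flow[OF M \<pi>] sum_distrib_left)
    qed
    then have "(\<Sum>t<n. \<Sum>s\<in>UNIV. \<Sum>q\<in>UNIV. flow M \<pi> t s q * ln (w s q))
        = (\<Sum>t<n. ?e (Suc t) - ?e t) + (\<Sum>t<n. c * (\<Sum>s\<in>-?C. state_prob M \<pi> t s))"
      by (simp only: sum.distrib)
    also have "(\<Sum>t<n. ?e (Suc t) - ?e t) = ?e n - ?e 0"
      by (rule sum_lessThan_telescope)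
    also have "?e 0 = ln (h (start M))"
      by (simp add: state_prob_0 of_bool_def if_distrib[of "\<lambda>x. x * _"] cong: if_cong)
    finally have "?e n - ln (h (start M)) + (\<Sum>t<n. c * (\<Sum>s\<in>-?C. state_prob M \<pi> t s)) \<le> K"
      using KL_lower_bound[OF M \<mu> \<pi> fin less_imp_le[OF wp] wle wp, of n] K by simp
    moreover have "0 \<le> ?e n" using h by (intro sum_nonneg mult_nonneg_nonneg state_prob_nonneg ln_ge_zero)
    moreover have "c * (\<Sum>t<n. state_prob M \<pi> t s0) \<le> (\<Sum>t<n. c * (\<Sum>s\<in>-?C. state_prob M \<pi> t s))"
      unfolding sum_distrib_left[of c _ "{..<n}"]
      using c s0 by (intro sum_mono mult_left_mono member_le_sum state_prob_nonneg) auto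
    ultimately show ?thesis by (simp add: K)
  qed
  show thesis by (rule that[OF c bound])
qed

lemma summable_state_prob:
  assumes M: "is_mdp M" and \<mu>: "\<mu> \<in> stationary_policies M" and \<pi>: "\<pi> \<in> policies M"
    and fin: "KL_to_reference M \<mu> \<pi> < \<infinity>" and s: "s \<notin> closed_states M \<mu>"
  shows "summable (\<lambda>t. state_prob M \<pi> t s)"
proof -
  obtain c B where c: "0 < c"
    and b: "\<And>n. ereal (c * (\<Sum>t<n. state_prob M \<pi> t s)) \<le> KL_to_reference M \<mu> \<pi> + ereal B"
    using state_prob_sum_bound[OF M \<mu>] \<pi> fin s by metis
  obtain K where K: "KL_to_reference M \<mu> \<pi> = ereal K" using KL_to_reference_finiteD(3)[OF fin] by blast
  show ?thesis
  proof (rule summableI_nonneg_bounded)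
    show "(\<Sum>t<n. state_prob M \<pi> t s) \<le> (K + B) / c" for n
      using b[of n] c by (simp add: pos_le_divide_eq mult.commute K)
  qed (rule state_prob_nonneg)
qed

lemma visit_prob_le_state_prob: "visit_prob M \<pi> t s a \<le> state_prob M \<pi> t s"
  unfolding state_prob_def by (rule member_le_sum) (auto simp: visit_prob_nonneg)

lemma summable_visit_prob:
  "summable (\<lambda>t. state_prob M \<pi> t s) \<Longrightarrow> summable (\<lambda>t. visit_prob M \<pi> t s a)"
  by (rule summable_comparison_test') (auto simp: visit_prob_nonneg visit_prob_le_state_prob)

lemma occupation_eq:
  assumes "summable (\<lambda>t. visit_prob M \<pi> t s a)"
  shows "occupation M \<pi> s a = ennreal (\<Sum>t. visit_prob M \<pi> t s a)"
proof -
  interpret prob_space "trajectories M \<pi>" by (rule prob_space_trajectories)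
  have m: "{\<omega>. \<omega> t = (s, a)} \<in> sets (trajectories M \<pi>)" for t
    by (rule sets_trajectories_determined[of "Suc t"], rule determined_byI) auto
  have i: "(\<lambda>\<omega>. indicator {(s, a)} (\<omega> t) :: ennreal) = indicator {\<omega>. \<omega> t = (s, a)}" for t
    by (auto simp: fun_eq_iff indicator_def)
  have "occupation M \<pi> s a = (\<Sum>t. \<integral>\<^sup>+\<omega>. indicator {(s, a)} (\<omega> t) \<partial>trajectories M \<pi>)"
    unfolding occupation_def by (rule nn_integral_suminf) (use m in \<open>simp add: i\<close>)
  also have "\<dots> = (\<Sum>t. ennreal (visit_prob M \<pi> t s a))"
    using m by (simp add: i visit_prob_def emeasure_eq_measure)
  also have "\<dots> = ennreal (\<Sum>t. visit_prob M \<pi> t s a)"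
    by (rule suminf_ennreal2) (auto simp: assms visit_prob_nonneg)
  finally show ?thesis .
qed

subsection \<open>Occupation measures\<close>

definition state_mass :: "('s::finite, 'a::finite) mdp \<Rightarrow> real ^ ('s \<times> 'a) \<Rightarrow> 's \<Rightarrow> real" where
  "state_mass M x s = (\<Sum>a\<in>avail M s. x $ (s, a))"

text \<open>The objective, the balance equations and the reachability constraint see
  \<open>x\<close> only through \<open>state_mass\<close> and \<open>mass_flow\<close>, both linear
  in \<open>x\<close>.\<close>

definition mass_flow :: "('s::finite, 'a::finite) mdp \<Rightarrow> real ^ ('s \<times> 'a) \<Rightarrow> 's \<Rightarrow> 's \<Rightarrow> real" where
  "mass_flow M x s q = (\<Sum>a\<in>avail M s. x $ (s, a) * tprob M s a q)"

lemma decision_states_eq: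
  assumes "is_mdp M" "\<forall>s\<in>R. absorbing M s"
  shows "decision_states M R \<mu> = - closed_states M \<mu>"
  using absorbing_closed_states[OF assms(1)] assms(2) by (auto simp: decision_states_def)

lemma occ_feasible_iff:
  "x \<in> occ_feasible M R \<nu> \<mu> \<longleftrightarrow>
    (\<forall>s a. \<not> (s \<in> decision_states M R \<mu> \<and> a \<in> avail M s) \<longrightarrow> x $ (s, a) = 0) \<and>
    x \<in> occ_domain M R \<mu> \<and>
    (\<forall>s\<in>decision_states M R \<mu>. state_mass M x s - (\<Sum>q\<in>decision_states M R \<mu>. mass_flow M x q s) =
       of_bool (s = start M)) \<and>
    \<nu> \<le> (\<Sum>q\<in>R. (\<Sum>s\<in>decision_states M R \<mu>. mass_flow M x s q) + of_bool (q = start M))"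
  by (simp add: occ_feasible_def occ_domain_def state_mass_def mass_flow_def)

lemma sum_mass_flow:
  assumes "is_mdp M"
  shows "(\<Sum>q\<in>UNIV. mass_flow M x s q) = state_mass M x s"
  unfolding mass_flow_def state_mass_def using assms
  by (subst sum.swap) (auto simp: is_mdp_def sum_distrib_left[symmetric] intro!: sum.cong)

lemma mass_flow_nonneg:
  assumes "is_mdp M" "x \<in> occ_domain M R \<mu>" "s \<in> decision_states M R \<mu>"
  shows "0 \<le> mass_flow M x s q"
  unfolding mass_flow_def using assms
  by (intro sum_nonneg mult_nonneg_nonneg) (auto simp: is_mdp_def occ_domain_def)

lemma state_mass_nonneg:
  assumes "x \<in> occ_domain M R \<mu>" "s \<in> decision_states M R \<mu>"
  shows "0 \<le> state_mass M x s"
  unfolding state_mass_def using assms by (intro sum_nonneg) (auto simp: occ_domain_def)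

lemma mass_flow_le_state_mass:
  assumes "is_mdp M" "x \<in> occ_domain M R \<mu>" "s \<in> decision_states M R \<mu>"
  shows "mass_flow M x s q \<le> state_mass M x s"
  unfolding sum_mass_flow[OF assms(1), symmetric]
  by (rule member_le_sum) (auto intro: mass_flow_nonneg[OF assms])

lemma occ_vector_domain: "occ_vector M R \<mu> \<pi> \<in> occ_domain M R \<mu>"
  by (auto simp: occ_domain_def occ_vector_def)

text \<open>The last two assumptions follow from a finite divergence. They are stated on their own
  because, for the stationary policy extracted from a feasible point, they are proved before its
  divergence is known.\<close>

context
  fixes M :: "('s::finite, 'a::finite) mdp" and R :: "'s set" and \<mu> :: "'s \<Rightarrow> 'a pmf"
    and \<pi> :: "('s, 'a) policy"
  assumes M: "is_mdp M" and R: "\<forall>s\<in>R. absorbing M s" and \<pi>: "\<pi> \<in> policies M"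
    and compat: "\<And>t s q. s \<in> closed_states M \<mu> \<Longrightarrow> chain_prob M \<mu> s q = 0 \<Longrightarrow> flow M \<pi> t s q = 0"
    and summ: "\<And>s. s \<notin> closed_states M \<mu> \<Longrightarrow> summable (\<lambda>t. state_prob M \<pi> t s)"
begin

lemma occ_vector_nth:
  "occ_vector M R \<mu> \<pi> $ (s, a) = (if s \<notin> closed_states M \<mu> \<and> a \<in> avail M s
     then \<Sum>t. visit_prob M \<pi> t s a else 0)"
proof -
  have "0 \<le> (\<Sum>t. visit_prob M \<pi> t s a)" if "s \<notin> closed_states M \<mu>"
    using summable_visit_prob[OF summ[OF that]] by (intro suminf_nonneg) (auto simp: visit_prob_nonneg)
  then show ?thesis
    using occupation_eq[OF summable_visit_prob[OF summ]]
    by (auto simp: occ_vector_def decision_states_eq[OF M R])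
qed

lemma occupation_finite:
  "s \<in> decision_states M R \<mu> \<Longrightarrow> occupation M \<pi> s a < \<infinity>"
  using occupation_eq[OF summable_visit_prob[OF summ]] by (auto simp: decision_states_eq[OF M R])

lemma state_mass_occ_vector:
  assumes s: "s \<notin> closed_states M \<mu>"
  shows "state_mass M (occ_vector M R \<mu> \<pi>) s = (\<Sum>t. state_prob M \<pi> t s)"
proof -
  have "state_mass M (occ_vector M R \<mu> \<pi>) s = (\<Sum>a\<in>UNIV. \<Sum>t. visit_prob M \<pi> t s a)"
    unfolding state_mass_def
    by (rule sum.mono_neutral_cong_left) (use s visit_prob_unavailable[OF \<pi>] in \<open>auto simp: occ_vector_nth\<close>)
  also have "\<dots> = (\<Sum>t. state_prob M \<pi> t s)"
    unfolding state_prob_def using summable_visit_prob[OF summ[OF s]] by (rule suminf_sum[symmetric])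
  finally show ?thesis .
qed

lemma mass_flow_occ_vector:
  assumes s: "s \<notin> closed_states M \<mu>"
  shows "(\<lambda>t. flow M \<pi> t s q) sums mass_flow M (occ_vector M R \<mu> \<pi>) s q"
proof -
  have "mass_flow M (occ_vector M R \<mu> \<pi>) s q = (\<Sum>a\<in>UNIV. (\<Sum>t. visit_prob M \<pi> t s a) * tprob M s a q)"
    unfolding mass_flow_def
    by (rule sum.mono_neutral_cong_left) (use s visit_prob_unavailable[OF \<pi>] in \<open>auto simp: occ_vector_nth\<close>)
  moreover have "(\<lambda>t. flow M \<pi> t s q) sums (\<Sum>a\<in>UNIV. (\<Sum>t. visit_prob M \<pi> t s a) * tprob M s a q)"
    unfolding flow_def by (intro sums_sum sums_mult2 summable_sums summable_visit_prob summ s)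
  ultimately show ?thesis by simp
qed

text \<open>The one-step recursion summed over time: time 0 gives the source term, and by
  \<open>compat\<close> nothing flows in from closed states.\<close>

lemma occ_vector_balance:
  assumes s: "s \<notin> closed_states M \<mu>"
  shows "state_mass M (occ_vector M R \<mu> \<pi>) s -
    (\<Sum>q\<in>- closed_states M \<mu>. mass_flow M (occ_vector M R \<mu> \<pi>) q s) = of_bool (s = start M)"
proof -
  have "state_prob M \<pi> (Suc t) s = (\<Sum>q\<in>- closed_states M \<mu>. flow M \<pi> t q s)" for t
    unfolding state_prob_Suc[OF M \<pi>]
    by (rule sum.mono_neutral_right)
       (use compat chain_prob_leaves_closed_states[OF M _ s] in auto)
  moreover have "(\<lambda>t. \<Sum>q\<in>- closed_states M \<mu>. flow M \<pi> t q s) sums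
      (\<Sum>q\<in>- closed_states M \<mu>. mass_flow M (occ_vector M R \<mu> \<pi>) q s)"
    by (intro sums_sum mass_flow_occ_vector) auto
  ultimately have "(\<lambda>t. state_prob M \<pi> (Suc t) s) sums
      (\<Sum>q\<in>- closed_states M \<mu>. mass_flow M (occ_vector M R \<mu> \<pi>) q s)" by simp
  then have "(\<Sum>t. state_prob M \<pi> t s) - state_prob M \<pi> 0 s
      = (\<Sum>q\<in>- closed_states M \<mu>. mass_flow M (occ_vector M R \<mu> \<pi>) q s)"
    using suminf_split_head[OF summ[OF s]] by (simp add: sums_iff)
  then show ?thesis
    by (simp add: state_mass_occ_vector[OF s] state_prob_0)
qed

lemma flow_absorbing:
  assumes "s \<in> R"
  shows "flow M \<pi> t s q = of_bool (q = s) * state_prob M \<pi> t s"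
proof -
  have "visit_prob M \<pi> t s a * tprob M s a q = of_bool (q = s) * visit_prob M \<pi> t s a" for a
    using R assms absorbing_tprob[OF M, of s a q] visit_prob_unavailable[OF \<pi>, of a s t]
    by (cases "a \<in> avail M s") auto
  then show ?thesis by (simp only: flow_def state_prob_def sum_distrib_left)
qed

text \<open>Absorbed mass stays where it is, and new mass arrives from transient states only, since
  other closed states do not lead to an absorbing one.\<close>

lemma state_prob_target:
  "(\<Sum>q\<in>R. state_prob M \<pi> n q) =
    (\<Sum>q\<in>R. of_bool (q = start M)) + (\<Sum>t<n. \<Sum>q\<in>R. \<Sum>s\<in>- closed_states M \<mu>. flow M \<pi> t s q)"
proof (induction n)
  case 0
  then show ?case by (simp add: state_prob_0)
next
  case (Suc n)
  have "state_prob M \<pi> (Suc n) q = (\<Sum>s\<in>- closed_states M \<mu>. flow M \<pi> n s q) + state_prob M \<pi> n q"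
    if q: "q \<in> R" for q
  proof -
    have qC: "q \<in> closed_states M \<mu>" using absorbing_closed_states[OF M] R q by auto
    have "state_prob M \<pi> (Suc n) q = (\<Sum>s\<in>insert q (- closed_states M \<mu>). flow M \<pi> n s q)"
      unfolding state_prob_Suc[OF M \<pi>]
      by (rule sum.mono_neutral_right)
         (use compat chain_prob_closed_to_absorbing[OF M] R q in auto)
    then show ?thesis using qC q by (simp add: flow_absorbing)
  qed
  then show ?case using Suc by (simp add: sum.distrib)
qed

text \<open>As \<open>R\<close> is absorbing, having visited it by time \<open>n\<close> almost
  surely means being in it at time \<open>n\<close>. The reaching probability is therefore the limit
  of the mass in \<open>R\<close>, that is, the initial mass plus the total inflow.\<close>

lemma reach_prob_eq:
  "reach_prob M \<pi> R = (\<Sum>q\<in>R. (\<Sum>s\<in>decision_states M R \<mu>. mass_flow M (occ_vector M R \<mu> \<pi>) s q)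
     + of_bool (q = start M))"
proof -
  let ?P = "paths M \<pi>"
  interpret prob_space ?P by (rule prob_space_paths)
  let ?A = "\<lambda>n. {\<omega> :: nat \<Rightarrow> 's. \<exists>t\<le>n. \<omega> t \<in> R}"
  have dA: "determined_by (Suc n) (\<lambda>\<omega> :: nat \<Rightarrow> 's. \<exists>t\<le>n. \<omega> t \<in> R)" for n
    by (rule determined_byI) (metis le_imp_less_Suc)
  have sA: "?A n \<in> sets ?P" for n by (rule sets_paths_determined[OF dA])
  have AE: "AE \<omega> in ?P. \<forall>t. \<omega> t \<in> R \<longrightarrow> \<omega> (Suc t) = \<omega> t"
    using AE_paths_transition[OF M \<pi>]
  proof eventually_elim
    fix \<omega> :: "nat \<Rightarrow> 's" assume *: "\<forall>t. 0 < flow M \<pi> t (\<omega> t) (\<omega> (Suc t))"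
    show "\<forall>t. \<omega> t \<in> R \<longrightarrow> \<omega> (Suc t) = \<omega> t"
    proof (intro allI impI)
      fix t assume "\<omega> t \<in> R"
      then show "\<omega> (Suc t) = \<omega> t" using *[rule_format, of t] by (cases "\<omega> (Suc t) = \<omega> t") (simp_all add: flow_absorbing)
    qed
  qed
  have mA: "measure ?P (?A n) = (\<Sum>q\<in>R. state_prob M \<pi> n q)" for n
  proof -
    have "AE \<omega> in ?P. \<omega> \<in> ?A n \<longleftrightarrow> \<omega> \<in> {\<omega>. \<omega> n \<notin> - R}"
      using AE
    proof eventually_elim
      fix \<omega> :: "nat \<Rightarrow> 's" assume *: "\<forall>t. \<omega> t \<in> R \<longrightarrow> \<omega> (Suc t) = \<omega> t"
      have "\<omega> n \<in> R" if "t \<le> n" "\<omega> t \<in> R" for t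
        using that by (induction n rule: dec_induct) (use * in auto)
      then show "\<omega> \<in> ?A n \<longleftrightarrow> \<omega> \<in> {\<omega>. \<omega> n \<notin> - R}" by auto
    qed
    moreover have "{\<omega>. \<omega> n \<notin> - R} \<in> sets ?P"
      by (rule sets_paths_determined[of "Suc n"], rule determined_byI) auto
    ultimately have "measure ?P (?A n) = measure ?P {\<omega>. \<omega> n \<notin> - R}"
      using sA by (intro measure_eq_AE) auto
    then show ?thesis unfolding measure_paths_not_in by simp
  qed
  have "(\<lambda>n. measure ?P (?A n)) \<longlonglongrightarrow> measure ?P (\<Union>n. ?A n)"
    by (rule finite_Lim_measure_incseq) (use sA in \<open>auto simp: incseq_def intro: order_trans\<close>)
  moreover have "(\<Union>n. ?A n) = {\<omega>. \<exists>t. \<omega> t \<in> R}" by auto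
  ultimately have l1: "(\<lambda>n. measure ?P (?A n)) \<longlonglongrightarrow> reach_prob M \<pi> R" by (simp add: reach_prob_def)
  have "(\<lambda>t. \<Sum>q\<in>R. \<Sum>s\<in>- closed_states M \<mu>. flow M \<pi> t s q) sums
      (\<Sum>q\<in>R. \<Sum>s\<in>- closed_states M \<mu>. mass_flow M (occ_vector M R \<mu> \<pi>) s q)"
    by (intro sums_sum mass_flow_occ_vector) auto
  then have "(\<lambda>n. measure ?P (?A n)) \<longlonglongrightarrow> (\<Sum>q\<in>R. of_bool (q = start M)) +
      (\<Sum>q\<in>R. \<Sum>s\<in>- closed_states M \<mu>. mass_flow M (occ_vector M R \<mu> \<pi>) s q)"
    unfolding mA state_prob_target sums_def by (intro tendsto_add tendsto_const)
  then show ?thesis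
    using LIMSEQ_unique[OF l1] by (simp add: sum.distrib decision_states_eq[OF M R])
qed

lemma occ_vector_feasible_iff: "occ_vector M R \<mu> \<pi> \<in> occ_feasible M R \<nu> \<mu> \<longleftrightarrow> \<nu> \<le> reach_prob M \<pi> R"
  unfolding occ_feasible_iff reach_prob_eq
  using occ_vector_domain occ_vector_balance
  by (auto simp: occ_vector_nth decision_states_eq[OF M R])

end

section \<open>The objective of (II) in terms of masses and flows\<close>

lemma occ_objective_finite:
  assumes M: "is_mdp M"
    and supp: "\<And>s q. s \<in> decision_states M R \<mu> \<Longrightarrow> chain_prob M \<mu> s q = 0 \<Longrightarrow> mass_flow M x s q = 0"
  shows "occ_objective M R \<mu> x = ereal (\<Sum>s\<in>decision_states M R \<mu>. \<Sum>q\<in>UNIV.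
      mass_flow M x s q * ln (mass_flow M x s q / (chain_prob M \<mu> s q * state_mass M x s)))"
proof -
  have "(\<Sum>q\<in>Succ M s.
      if (\<Sum>a\<in>avail M s. x $ (s, a) * tprob M s a q) = 0 then 0
      else if chain_prob M \<mu> s q = 0 then \<infinity>
      else ereal (\<Sum>a\<in>avail M s. x $ (s, a) * tprob M s a q *
        ln ((\<Sum>a'\<in>avail M s. x $ (s, a') * tprob M s a' q) /
            (chain_prob M \<mu> s q * (\<Sum>a'\<in>avail M s. x $ (s, a'))))))
    = (\<Sum>q\<in>UNIV. ereal (mass_flow M x s q * ln (mass_flow M x s q / (chain_prob M \<mu> s q * state_mass M x s))))"
    (is "(\<Sum>q\<in>_. ?f q) = (\<Sum>q\<in>_. ?g q)") if s: "s \<in> decision_states M R \<mu>" for s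
  proof (rule sum.mono_neutral_cong_left)
    \<comment> \<open>Extending the sum from successors to all states is free: the flow to any other
      state is 0, and so is its term.\<close>
    show "\<forall>q\<in>UNIV - Succ M s. ?g q = 0"
    proof
      fix q assume "q \<in> UNIV - Succ M s"
      then have "tprob M s a q = 0" if "a \<in> avail M s" for a
        using that M by (auto simp: Succ_def is_mdp_def not_less intro: antisym)
      then have "mass_flow M x s q = 0" by (simp add: mass_flow_def)
      then show "?g q = 0" by simp
    qed
    show "?f q = ?g q" for q
      using supp[OF s, of q]
      by (auto simp: mass_flow_def[symmetric] state_mass_def[symmetric] sum_distrib_right[symmetric])
  qed auto
  then show ?thesis unfolding occ_objective_def by simp
qed

lemma occ_objective_infinite:
  assumes M: "is_mdp M" and s: "s \<in> decision_states M R \<mu>" and 0: "chain_prob M \<mu> s q = 0" "mass_flow M x s q \<noteq> 0"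
  shows "occ_objective M R \<mu> x = \<infinity>"
proof -
  have "q \<in> Succ M s"
  proof (rule ccontr)
    assume "q \<notin> Succ M s"
    then have "tprob M s a q = 0" if "a \<in> avail M s" for a
      using that M by (auto simp: Succ_def is_mdp_def not_less intro: antisym)
    then show False using 0 by (simp add: mass_flow_def)
  qed
  moreover have "(\<Sum>a\<in>avail M s. x $ (s, a) * tprob M s a q) \<noteq> 0" using 0 by (simp add: mass_flow_def)
  ultimately show ?thesis
    unfolding occ_objective_def sum_Pinfty using s 0(1)
    by (intro conjI bexI[of _ s] bexI[of _ q]) simp_all
qed

text \<open>Turns finiteness into linear equations in \<open>x\<close>, which pass to convex
  combinations and to limits.\<close>

lemma occ_objective_less_infinity_iff:
  assumes M: "is_mdp M"
  shows "occ_objective M R \<mu> x < \<infinity> \<longleftrightarrow>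
    (\<forall>s\<in>decision_states M R \<mu>. \<forall>q. chain_prob M \<mu> s q = 0 \<longrightarrow> mass_flow M x s q = 0)"
proof
  assume "occ_objective M R \<mu> x < \<infinity>"
  then show "\<forall>s\<in>decision_states M R \<mu>. \<forall>q. chain_prob M \<mu> s q = 0 \<longrightarrow> mass_flow M x s q = 0"
    using occ_objective_infinite[OF M] by fastforce
next
  assume "\<forall>s\<in>decision_states M R \<mu>. \<forall>q. chain_prob M \<mu> s q = 0 \<longrightarrow> mass_flow M x s q = 0"
  then show "occ_objective M R \<mu> x < \<infinity>"
    by (subst occ_objective_finite[OF M]) auto
qed

text \<open>A tangent bound, from \<open>ln t \<le> t - 1\<close> at \<open>t = b * r / a\<close>.
  With \<open>r = 1\<close> it gives nonnegativity of relative entropy, with \<open>r\<close> a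
  ratio of sums the log-sum inequality.\<close>

lemma ln_ratio_lower_bound:
  fixes a b r :: real
  assumes "0 \<le> a" "0 \<le> b" "0 < a \<Longrightarrow> 0 < b" "0 < r"
  shows "a * ln r + a - b * r \<le> a * ln (a / b)"
proof (cases "a = 0")
  case False
  then have a: "0 < a" and b: "0 < b" using assms by auto
  have "ln (b * r / a) \<le> b * r / a - 1" using a b assms(4) by (intro ln_le_minus_one) simp
  then have "a * ln (b * r / a) \<le> a * (b * r / a - 1)" using a by (intro mult_left_mono) auto
  also have "\<dots> = b * r - a" using a by (simp add: field_simps)
  also have "ln (b * r / a) = ln r - ln (a / b)" using a b assms(4) by (simp add: ln_mult ln_div)
  finally show ?thesis by (simp add: algebra_simps)
qed (use assms in auto)

text \<open>Here \<open>w\<close> is the averaged kernel \<open>mass_flow / state_mass\<close>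
  divided by the reference kernel. Over all time \<open>flow\<close> sums to
  \<open>mass_flow\<close>, so the finite-horizon bounds converge to the objective itself. On closed
  states, where the expected time may be infinite, \<open>w = 1\<close> discards every
  contribution.\<close>

lemma occ_objective_le_KL:
  fixes M :: "('s::finite, 'a::finite) mdp"
  assumes M: "is_mdp M" and R: "\<forall>s\<in>R. absorbing M s" and \<mu>: "\<mu> \<in> stationary_policies M"
    and \<pi>: "\<pi> \<in> policies M" and fin: "KL_to_reference M \<mu> \<pi> < \<infinity>"
  shows "occ_objective M R \<mu> (occ_vector M R \<mu> \<pi>) \<le> KL_to_reference M \<mu> \<pi>"
    and "occ_vector M R \<mu> \<pi> \<in> occ_feasible M R \<nu> \<mu> \<longleftrightarrow> \<nu> \<le> reach_prob M \<pi> R"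
proof -
  let ?C = "closed_states M \<mu>" and ?x = "occ_vector M R \<mu> \<pi>"
  have dec: "decision_states M R \<mu> = - ?C" by (rule decision_states_eq[OF M R])
  have ac: "chain_prob M \<mu> s q = 0 \<Longrightarrow> flow M \<pi> t s q = 0" for t s q
    by (rule flow_eq_0_if_chain_prob_eq_0[OF M \<mu> \<pi> KL_to_reference_finiteD(1)[OF fin]])
  have summ: "s \<notin> ?C \<Longrightarrow> summable (\<lambda>t. state_prob M \<pi> t s)" for s
    by (rule summable_state_prob[OF M \<mu> \<pi> fin])
  show "?x \<in> occ_feasible M R \<nu> \<mu> \<longleftrightarrow> \<nu> \<le> reach_prob M \<pi> R"
    by (rule occ_vector_feasible_iff[OF M R \<pi> ac summ])
  have dom: "?x \<in> occ_domain M R \<mu>" by (rule occ_vector_domain)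
  have mf: "(\<lambda>t. flow M \<pi> t s q) sums mass_flow M ?x s q" if "s \<notin> ?C" for s q
    by (rule mass_flow_occ_vector[OF M R \<pi> ac summ that])
  have supp: "mass_flow M ?x s q = 0" if "s \<notin> ?C" "chain_prob M \<mu> s q = 0" for s q
    using mf[OF that(1), of q] ac[OF that(2)] by (simp add: sums_iff)
  define w where "w s q = (if s \<in> ?C then 1
      else mass_flow M ?x s q / (chain_prob M \<mu> s q * state_mass M ?x s))" for s q
  have mf0: "0 \<le> mass_flow M ?x s q" "mass_flow M ?x s q \<le> state_mass M ?x s" if "s \<notin> ?C" for s q
    using mass_flow_nonneg[OF M dom] mass_flow_le_state_mass[OF M dom] that dec by auto
  note cp = chain_prob_nonneg[OF M, of \<mu>]
  have w0: "0 \<le> w s q" for s q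
  proof (cases "s \<in> ?C")
    case False
    then show ?thesis using mf0[OF False, of q] cp[of s q] by (auto simp: w_def intro!: divide_nonneg_nonneg mult_nonneg_nonneg)
  qed (simp add: w_def)
  have wle: "(\<Sum>q\<in>UNIV. chain_prob M \<mu> s q * w s q) \<le> 1" for s
  proof (cases "s \<in> ?C")
    case True
    then show ?thesis by (simp add: w_def sum_chain_prob[OF M \<mu>])
  next
    case False
    have "chain_prob M \<mu> s q * w s q = mass_flow M ?x s q / state_mass M ?x s" for q
      using supp[OF False, of q] False by (simp add: w_def)
    \<comment> \<open>The quotient is 1, or 0 at a state without mass because
      \<open>0 / 0 = 0\<close>; the inequality covers both.\<close>
    then have "(\<Sum>q\<in>UNIV. chain_prob M \<mu> s q * w s q) = state_mass M ?x s / state_mass M ?x s"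
      by (simp add: sum_mass_flow[OF M] flip: sum_divide_distrib)
    then show ?thesis by simp
  qed
  have wpos: "0 < w s q" if f: "0 < flow M \<pi> t s q" for t s q
  proof (cases "s \<in> ?C")
    case False
    have "0 < mass_flow M ?x s q"
      using mf[OF False, of q] f flow_nonneg[OF M, of \<pi> _ s q] suminf_pos2[of "\<lambda>t. flow M \<pi> t s q" t]
      by (simp add: sums_iff)
    moreover have "0 < chain_prob M \<mu> s q" using ac[of s q t] f cp[of s q] by (cases "chain_prob M \<mu> s q = 0") auto
    ultimately show ?thesis using mf0[OF False, of q] False by (simp add: w_def)
  qed (simp add: w_def)
  have "(\<lambda>t. \<Sum>s\<in>UNIV. \<Sum>q\<in>UNIV. flow M \<pi> t s q * ln (w s q)) sums
      (\<Sum>s\<in>UNIV. if s \<in> ?C then 0 else \<Sum>q\<in>UNIV. mass_flow M ?x s q * ln (w s q))"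
  proof (rule sums_sum)
    show "(\<lambda>t. \<Sum>q\<in>UNIV. flow M \<pi> t s q * ln (w s q)) sums
      (if s \<in> ?C then 0 else \<Sum>q\<in>UNIV. mass_flow M ?x s q * ln (w s q))" for s
      by (cases "s \<in> ?C") (auto simp: w_def intro!: sums_sum sums_mult2 mf)
  qed
  also have "(\<Sum>s\<in>UNIV. if s \<in> ?C then 0 else \<Sum>q\<in>UNIV. mass_flow M ?x s q * ln (w s q))
      = (\<Sum>s\<in>- ?C. \<Sum>q\<in>UNIV. mass_flow M ?x s q * ln (mass_flow M ?x s q / (chain_prob M \<mu> s q * state_mass M ?x s)))"
    by (rule sum.mono_neutral_cong_right) (auto simp: w_def)
  finally have lim: "(\<lambda>n. \<Sum>t<n. \<Sum>s\<in>UNIV. \<Sum>q\<in>UNIV. flow M \<pi> t s q * ln (w s q)) \<longlonglongrightarrow>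
      (\<Sum>s\<in>- ?C. \<Sum>q\<in>UNIV. mass_flow M ?x s q * ln (mass_flow M ?x s q / (chain_prob M \<mu> s q * state_mass M ?x s)))"
    unfolding sums_def .
  obtain K where K: "KL_to_reference M \<mu> \<pi> = ereal K" using KL_to_reference_finiteD(3)[OF fin] by blast
  have "(\<Sum>s\<in>- ?C. \<Sum>q\<in>UNIV. mass_flow M ?x s q * ln (mass_flow M ?x s q / (chain_prob M \<mu> s q * state_mass M ?x s))) \<le> K"
  proof (rule LIMSEQ_le_const2[OF lim], intro exI allI impI)
    fix n :: nat
    show "(\<Sum>t<n. \<Sum>s\<in>UNIV. \<Sum>q\<in>UNIV. flow M \<pi> t s q * ln (w s q)) \<le> K"
      using KL_lower_bound[OF M \<mu> \<pi> fin w0 wle wpos, where n=n] by (simp add: K)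
  qed
  then show "occ_objective M R \<mu> ?x \<le> KL_to_reference M \<mu> \<pi>"
    by (subst occ_objective_finite[OF M]) (auto simp: K dec supp)
qed

text \<open>The action probabilities are \<open>x $ (s, a) / state_mass M x s\<close>. Where this is
  undefined or irrelevant the reference is copied, which costs no divergence; at a state without
  mass both sides of the flow identity vanish.\<close>

lemma stationary_policy_of_occ:
  fixes M :: "('s::finite, 'a::finite) mdp"
  assumes M: "is_mdp M" and \<mu>: "\<mu> \<in> stationary_policies M" and x: "x \<in> occ_domain M R \<mu>"
  obtains \<sigma> where "\<sigma> \<in> stationary_policies M"
    "\<And>s. s \<notin> decision_states M R \<mu> \<or> state_mass M x s = 0 \<Longrightarrow> \<sigma> s = \<mu> s"
    "\<And>s q. s \<in> decision_states M R \<mu> \<Longrightarrow> mass_flow M x s q = state_mass M x s * chain_prob M \<sigma> s q"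
proof -
  let ?D = "decision_states M R \<mu>"
  let ?p = "\<lambda>s a. if a \<in> avail M s then x $ (s, a) / state_mass M x s else 0"
  define \<sigma> where "\<sigma> s = (if s \<notin> ?D \<or> state_mass M x s = 0 then \<mu> s else embed_pmf (?p s))" for s
  have p: "pmf (\<sigma> s) a = ?p s a" if s: "s \<in> ?D" "state_mass M x s \<noteq> 0" for s a
  proof -
    have nn: "0 \<le> ?p s a" for a
      using x s state_mass_nonneg[OF x s(1)] by (auto simp: occ_domain_def)
    have "(\<Sum>a\<in>UNIV. ?p s a) = (\<Sum>a\<in>avail M s. x $ (s, a) / state_mass M x s)"
      by (rule sum.mono_neutral_cong_right) auto
    also have "\<dots> = 1" using s(2) by (simp add: state_mass_def flip: sum_divide_distrib)
    finally have "(\<integral>\<^sup>+a. ennreal (?p s a) \<partial>count_space UNIV) = 1"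
      using nn by (simp add: nn_integral_count_space_finite sum_ennreal del: ennreal_eq_1)
    then show ?thesis using s nn unfolding \<sigma>_def by (simp add: pmf_embed_pmf)
  qed
  show thesis
  proof
    show "\<sigma> \<in> stationary_policies M"
      unfolding stationary_policies_def
    proof (intro CollectI allI subsetI)
      fix s a assume a: "a \<in> set_pmf (\<sigma> s)"
      show "a \<in> avail M s"
      proof (cases "s \<notin> ?D \<or> state_mass M x s = 0")
        case True
        then show ?thesis using a \<mu> by (auto simp: \<sigma>_def stationary_policies_def)
      next
        case False
        then show ?thesis using a p[of s a] by (auto simp: set_pmf_iff split: if_splits)
      qed
    qed
    show "\<sigma> s = \<mu> s" if "s \<notin> ?D \<or> state_mass M x s = 0" for s using that by (simp add: \<sigma>_def)
    show "mass_flow M x s q = state_mass M x s * chain_prob M \<sigma> s q" if s: "s \<in> ?D" for s q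
    proof (cases "state_mass M x s = 0")
      case True
      then have "mass_flow M x s q = 0"
        using mass_flow_nonneg[OF M x s, of q] mass_flow_le_state_mass[OF M x s, of q] by simp
      then show ?thesis using True by simp
    next
      case False
      then show ?thesis
        by (auto simp: mass_flow_def chain_prob_def p[OF s False] sum_distrib_left intro!: sum.cong)
    qed
  qed
qed

text \<open>
  The occupation measure of the stationary policy of a feasible \<open>x\<close> is the minimal nonnegative
  solution of the balance equations; the difference to \<open>x\<close> is a circulation without outflow.
\<close>

lemma stationary_policy_improves:
  fixes M :: "('s::finite, 'a::finite) mdp"
  assumes M: "is_mdp M" and R: "\<forall>s\<in>R. absorbing M s" and \<mu>: "\<mu> \<in> stationary_policies M"
    and x: "x \<in> occ_feasible M R \<nu> \<mu>" and fin: "occ_objective M R \<mu> x < \<infinity>"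
  obtains \<sigma> where "\<sigma> \<in> stationary_policies M" "stationary \<sigma> \<in> reaching_policies M R \<nu>"
    "\<And>s a. s \<in> decision_states M R \<mu> \<Longrightarrow> occupation M (stationary \<sigma>) s a < \<infinity>"
    "occ_vector M R \<mu> (stationary \<sigma>) \<in> occ_feasible M R \<nu> \<mu>"
    "KL_to_reference M \<mu> (stationary \<sigma>) = occ_objective M R \<mu> (occ_vector M R \<mu> (stationary \<sigma>))"
    "occ_objective M R \<mu> (occ_vector M R \<mu> (stationary \<sigma>)) \<le> occ_objective M R \<mu> x"
proof -
  let ?C = "closed_states M \<mu>"
  have dec: "decision_states M R \<mu> = - ?C" by (rule decision_states_eq[OF M R])
  have RC: "R \<subseteq> ?C" using absorbing_closed_states[OF M] R by auto
  have dom: "x \<in> occ_domain M R \<mu>" using x by (simp add: occ_feasible_iff)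
  have bal: "state_mass M x s = of_bool (s = start M) + (\<Sum>q\<in>-?C. mass_flow M x q s)" if "s \<notin> ?C" for s
    using x that by (simp add: occ_feasible_iff dec algebra_simps)
  obtain \<sigma> where \<sigma>: "\<sigma> \<in> stationary_policies M"
    and \<sigma>\<mu>: "\<And>s. s \<in> ?C \<or> state_mass M x s = 0 \<Longrightarrow> \<sigma> s = \<mu> s"
    and mf: "\<And>s q. s \<notin> ?C \<Longrightarrow> mass_flow M x s q = state_mass M x s * chain_prob M \<sigma> s q"
    using stationary_policy_of_occ[OF M \<mu> dom] unfolding dec by (metis ComplI ComplD)
  note \<sigma>p = stationary_in_policies[OF \<sigma>]
  have cm: "chain_prob M \<sigma> s q = chain_prob M \<mu> s q" if "s \<in> ?C \<or> state_mass M x s = 0" for s q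
    using \<sigma>\<mu>[OF that] by (simp add: chain_prob_def)
  have mass0: "0 \<le> state_mass M x s" if "s \<notin> ?C" for s
    using state_mass_nonneg[OF dom] that dec by auto
  have supp: "mass_flow M x s q = 0" if "s \<notin> ?C" "chain_prob M \<mu> s q = 0" for s q
    using fin that dec unfolding occ_objective_less_infinity_iff[OF M] by auto
  \<comment> \<open>Where \<open>x\<close> has mass this comes from the finite objective, elsewhere
    from \<open>\<sigma> = \<mu>\<close>. It is what makes a likelihood ratio of the two chains
    possible.\<close>
  have \<sigma>0: "chain_prob M \<sigma> s q = 0" if "chain_prob M \<mu> s q = 0" for s q
    using cm[of s q] mf[of s q] supp[of s q] that by (cases "s \<in> ?C \<or> state_mass M x s = 0") auto
  let ?sp = "state_prob M (stationary \<sigma>)"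
  have flow: "flow M (stationary \<sigma>) t s q = ?sp t s * chain_prob M \<sigma> s q" for t s q
    by (rule flow_stationary[OF \<sigma>])
  \<comment> \<open>Minimality: the partial sums arise by iterating the balance equations from 0 and
    stay below the solution \<open>x\<close>. This also gives summability, although
    \<open>\<sigma>\<close> may be recurrent on parts of a circulation that it never reaches from
    the start.\<close>
  have le: "(\<Sum>t<n. ?sp t s) \<le> state_mass M x s" if "s \<notin> ?C" for s n
    using that
  proof (induction n arbitrary: s)
    case 0
    then show ?case using mass0 by simp
  next
    case (Suc n)
    have "(\<Sum>t<Suc n. ?sp t s) = of_bool (s = start M) + (\<Sum>t<n. ?sp (Suc t) s)"
      by (subst sum.lessThan_Suc_shift) (simp add: state_prob_0)
    also have "?sp (Suc t) s = (\<Sum>q\<in>-?C. ?sp t q * chain_prob M \<sigma> q s)" for t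
      unfolding state_prob_Suc[OF M \<sigma>p] flow
      by (rule sum.mono_neutral_right)
        (use \<sigma>0 chain_prob_leaves_closed_states[OF M _ Suc.prems] in auto)
    then have "(\<Sum>t<n. ?sp (Suc t) s) = (\<Sum>q\<in>-?C. (\<Sum>t<n. ?sp t q) * chain_prob M \<sigma> q s)"
      by (simp only: sum_distrib_right sum.swap[of _ _ "{..<n}"])
    also have "\<dots> \<le> (\<Sum>q\<in>-?C. mass_flow M x q s)"
      using Suc.IH mf chain_prob_nonneg[OF M] by (intro sum_mono) (auto intro!: mult_right_mono)
    finally show ?case using bal[OF Suc.prems] by simp
  qed
  have summ: "summable (\<lambda>t. ?sp t s)" if "s \<notin> ?C" for s
    by (rule summableI_nonneg_bounded[OF state_prob_nonneg le[OF that]])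
  have compat: "flow M (stationary \<sigma>) t s q = 0" if "chain_prob M \<mu> s q = 0" for t s q
    using \<sigma>0[OF that] by (simp add: flow)
  let ?y = "occ_vector M R \<mu> (stationary \<sigma>)"
  note facts = M R \<sigma>p compat summ
  have ydom: "?y \<in> occ_domain M R \<mu>" by (rule occ_vector_domain)
  have ym: "state_mass M ?y s = (\<Sum>t. ?sp t s)" if "s \<notin> ?C" for s
    by (rule state_mass_occ_vector[OF facts that])
  have yle: "state_mass M ?y s \<le> state_mass M x s" if "s \<notin> ?C" for s
    unfolding ym[OF that] by (rule suminf_le_const[OF summ[OF that] le[OF that]])
  have ymf: "mass_flow M ?y s q = state_mass M ?y s * chain_prob M \<sigma> s q" if s: "s \<notin> ?C" for s q
    using mass_flow_occ_vector[OF facts s, of q] sums_mult2[OF summable_sums[OF summ[OF s]]]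
    unfolding flow ym[OF s] by (metis sums_unique2)
  have y0: "0 \<le> state_mass M ?y s" if "s \<notin> ?C" for s
    using state_mass_nonneg[OF ydom] that dec by auto
  have ybal: "state_mass M ?y s = of_bool (s = start M) + (\<Sum>q\<in>-?C. mass_flow M ?y q s)" if "s \<notin> ?C" for s
  proof -
    have "state_mass M ?y s - (\<Sum>q\<in>-?C. mass_flow M ?y q s) = of_bool (s = start M)"
      by (rule occ_vector_balance[OF facts that])
    then show ?thesis by simp
  qed
  define z where "z s = state_mass M x s - state_mass M ?y s" for s
  have z0: "0 \<le> z s" if "s \<notin> ?C" for s using yle[OF that] by (simp add: z_def)
  have zbal: "z s = (\<Sum>q\<in>-?C. z q * chain_prob M \<sigma> q s)" if "s \<notin> ?C" for s
    using bal[OF that] ybal[OF that] mf ymf by (simp add: z_def left_diff_distrib sum_subtractf)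
  \<comment> \<open>Summing the source-free balance of \<open>z\<close> over all transient states
    shows that its total flow into \<open>?C\<close> is 0; all terms being nonnegative, each
    vanishes.\<close>
  have "(\<Sum>s\<in>-?C. z s) = (\<Sum>s\<in>-?C. \<Sum>q\<in>-?C. z q * chain_prob M \<sigma> q s)"
    by (rule sum.cong) (use zbal in auto)
  also have "\<dots> = (\<Sum>q\<in>-?C. z q * (\<Sum>s\<in>-?C. chain_prob M \<sigma> q s))"
    by (subst sum.swap) (simp add: sum_distrib_left)
  also have "(\<Sum>s\<in>-?C. chain_prob M \<sigma> q s) = 1 - (\<Sum>s\<in>?C. chain_prob M \<sigma> q s)" for q
    using sum_chain_prob[OF M \<sigma>, of q] sum.union_disjoint[of ?C "-?C" "chain_prob M \<sigma> q"]
    by (simp add: Compl_partition)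
  then have "(\<Sum>q\<in>-?C. z q * (\<Sum>s\<in>-?C. chain_prob M \<sigma> q s))
      = (\<Sum>q\<in>-?C. z q) - (\<Sum>q\<in>-?C. z q * (\<Sum>s\<in>?C. chain_prob M \<sigma> q s))"
    by (simp add: right_diff_distrib sum_subtractf)
  finally have "(\<Sum>q\<in>-?C. z q * (\<Sum>s\<in>?C. chain_prob M \<sigma> q s)) = 0" by simp
  then have "z q * (\<Sum>s\<in>?C. chain_prob M \<sigma> q s) = 0" if "q \<notin> ?C" for q
    by (subst (asm) sum_nonneg_eq_0_iff)
       (use z0 that chain_prob_nonneg[OF M] in \<open>auto intro!: mult_nonneg_nonneg sum_nonneg\<close>)
  then have zout: "z q * chain_prob M \<sigma> q s = 0" if "q \<notin> ?C" "s \<in> ?C" for q s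
    using that by (auto simp: sum_nonneg_eq_0_iff chain_prob_nonneg[OF M])
  have out: "mass_flow M ?y q s = mass_flow M x q s" if "q \<notin> ?C" "s \<in> ?C" for q s
    using zout[OF that] mf[OF that(1), of s] ymf[OF that(1), of s] by (auto simp: z_def left_diff_distrib)
  have "\<nu> \<le> (\<Sum>q\<in>R. (\<Sum>s\<in>-?C. mass_flow M x s q) + of_bool (q = start M))"
    using x by (simp add: occ_feasible_iff dec)
  also have "\<dots> = (\<Sum>q\<in>R. (\<Sum>s\<in>decision_states M R \<mu>. mass_flow M ?y s q) + of_bool (q = start M))"
    unfolding dec using out RC by (intro sum.cong arg_cong2[where f="(+)"] refl) auto
  also have "\<dots> = reach_prob M (stationary \<sigma>) R"
    by (rule reach_prob_eq[OF facts, symmetric])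
  finally have reach: "\<nu> \<le> reach_prob M (stationary \<sigma>) R" .
  have feas: "?y \<in> occ_feasible M R \<nu> \<mu>"
    by (rule occ_vector_feasible_iff[OF facts, THEN iffD2, OF _ _ reach])
  define w where "w s q = (if s \<in> ?C \<or> state_mass M x s = 0 then 1 else chain_prob M \<sigma> s q / chain_prob M \<mu> s q)" for s q
  have w0: "0 \<le> w s q" for s q using chain_prob_nonneg[OF M] by (simp add: w_def)
  have w: "chain_prob M \<sigma> s q = chain_prob M \<mu> s q * w s q" for s q
    using cm[of s q] \<sigma>0[of s q] by (auto simp: w_def)
  \<comment> \<open>The relative entropy of the row of \<open>\<sigma>\<close> at \<open>s\<close>
    with respect to that of \<open>\<mu>\<close>. As \<open>x\<close> and \<open>?y\<close> share
    the kernel \<open>\<sigma>\<close>, both objectives are the same linear function of the masses,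
    with coefficients \<open>k s \<ge> 0\<close>; smaller masses then mean a smaller
    objective.\<close>
  define k where "k s = (\<Sum>q\<in>UNIV. chain_prob M \<sigma> s q * ln (w s q))" for s
  have k0: "0 \<le> k s" for s
  proof -
    have "chain_prob M \<sigma> s q - chain_prob M \<mu> s q \<le> chain_prob M \<sigma> s q * ln (w s q)" for q
    proof (cases "chain_prob M \<sigma> s q = 0")
      case False
      then have "chain_prob M \<mu> s q \<noteq> 0" using \<sigma>0 by auto
      then have "w s q = chain_prob M \<sigma> s q / chain_prob M \<mu> s q" using w[of s q] by simp
      then show ?thesis
        using ln_ratio_lower_bound[of "chain_prob M \<sigma> s q" "chain_prob M \<mu> s q" 1]
          chain_prob_nonneg[OF M] \<open>chain_prob M \<mu> s q \<noteq> 0\<close> by (simp add: less_le)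
    qed (use chain_prob_nonneg[OF M] in simp)
    then have "(\<Sum>q\<in>UNIV. chain_prob M \<sigma> s q - chain_prob M \<mu> s q) \<le> k s"
      unfolding k_def by (rule sum_mono)
    then show ?thesis by (simp add: sum_subtractf sum_chain_prob[OF M \<mu>] sum_chain_prob[OF M \<sigma>])
  qed
  have obj: "occ_objective M R \<mu> v = ereal (\<Sum>s\<in>-?C. state_mass M v s * k s)"
    if v: "\<And>s q. s \<notin> ?C \<Longrightarrow> mass_flow M v s q = state_mass M v s * chain_prob M \<sigma> s q"
      "\<And>s. s \<notin> ?C \<Longrightarrow> state_mass M x s = 0 \<Longrightarrow> state_mass M v s = 0" for v
  proof -
    have "(\<Sum>q\<in>UNIV. mass_flow M v s q * ln (mass_flow M v s q / (chain_prob M \<mu> s q * state_mass M v s)))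
      = state_mass M v s * k s" if s: "s \<notin> ?C" for s
    proof (cases "state_mass M v s = 0")
      case False
      then have "mass_flow M v s q / (chain_prob M \<mu> s q * state_mass M v s) = w s q" for q
        using v[OF s] s by (auto simp: w_def)
      then show ?thesis by (simp add: v(1)[OF s] k_def sum_distrib_left mult.assoc)
    qed (simp add: v(1)[OF s])
    then show ?thesis
      by (subst occ_objective_finite[OF M]) (auto simp: dec v(1) \<sigma>0)
  qed
  have objx: "occ_objective M R \<mu> x = ereal (\<Sum>s\<in>-?C. state_mass M x s * k s)"
    by (rule obj) (use mf in auto)
  have objy: "occ_objective M R \<mu> ?y = ereal (\<Sum>s\<in>-?C. state_mass M ?y s * k s)"
  proof (rule obj)
    show "state_mass M ?y s = 0" if "s \<notin> ?C" "state_mass M x s = 0" for s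
      using yle[OF that(1)] y0[OF that(1)] that(2) by simp
  qed (use ymf in auto)
  have KL: "KL_to_reference M \<mu> (stationary \<sigma>) = occ_objective M R \<mu> ?y"
  proof -
    have one: "w s q = 1" if "s \<in> ?C" for s q using that by (simp add: w_def)
    have "(\<lambda>t. \<Sum>s\<in>UNIV. \<Sum>q\<in>UNIV. flow M (stationary \<sigma>) t s q * ln (w s q)) sums
      (\<Sum>s\<in>UNIV. if s \<in> ?C then 0 else state_mass M ?y s * k s)"
    proof (rule sums_sum)
      fix s
      have "(\<lambda>t. ?sp t s * k s) sums (if s \<in> ?C then 0 else state_mass M ?y s * k s)"
        using ym summ by (cases "s \<in> ?C") (auto simp: k_def one intro!: sums_mult2 summable_sums)
      then show "(\<lambda>t. \<Sum>q\<in>UNIV. flow M (stationary \<sigma>) t s q * ln (w s q)) sums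
        (if s \<in> ?C then 0 else state_mass M ?y s * k s)"
        by (simp add: flow k_def sum_distrib_left mult.assoc)
    qed
    also have "(\<Sum>s\<in>UNIV. if s \<in> ?C then 0 else state_mass M ?y s * k s) = (\<Sum>s\<in>-?C. state_mass M ?y s * k s)"
      by (rule sum.mono_neutral_cong_right) auto
    finally show ?thesis
      using KL_stationary(2)[OF M \<mu> \<sigma> w0 w chain_prob_leaves_closed_states[OF M] one summ]
      by (simp add: objy sums_iff)
  qed
  show thesis
  proof (rule that[OF \<sigma> _ _ feas KL])
    show "stationary \<sigma> \<in> reaching_policies M R \<nu>" using \<sigma>p reach by (simp add: reaching_policies_def)
    show "occupation M (stationary \<sigma>) s a < \<infinity>" if "s \<in> decision_states M R \<mu>" for s a
      by (rule occupation_finite[OF facts that])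
    show "occ_objective M R \<mu> ?y \<le> occ_objective M R \<mu> x"
      unfolding objx objy using yle k0 by (auto intro!: sum_mono mult_right_mono)
  qed
qed

subsection \<open>Convexity and attainment\<close>

text \<open>The adjoint of \<open>f\<close> at 1 is the normal vector of the half-space.\<close>

lemma polyhedron_linear_le:
  fixes f :: "'v::euclidean_space \<Rightarrow> real"
  assumes "linear f"
  shows "polyhedron {x. f x \<le> b}"
proof -
  have "f x = adjoint f 1 \<bullet> x" for x
    using adjoint_works[OF assms, of x 1] by (simp add: inner_commute)
  then show ?thesis by (simp add: polyhedron_halfspace_le)
qed

lemma polyhedron_linear_ge:
  fixes f :: "'v::euclidean_space \<Rightarrow> real"
  assumes "linear f"
  shows "polyhedron {x. b \<le> f x}"
proof -
  have "polyhedron {x. - f x \<le> - b}"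
    by (rule polyhedron_linear_le) (rule linear_compose_neg[OF assms])
  then show ?thesis by simp
qed

lemma polyhedron_linear_eq:
  fixes f :: "'v::euclidean_space \<Rightarrow> real"
  assumes "linear f"
  shows "polyhedron {x. f x = b}"
proof -
  have "{x. f x = b} = {x. f x \<le> b} \<inter> {x. b \<le> f x}" by auto
  then show ?thesis using polyhedron_linear_le[OF assms] polyhedron_linear_ge[OF assms] by simp
qed

lemma polyhedron_Collect_all:
  fixes P :: "'i \<Rightarrow> 'v::euclidean_space \<Rightarrow> bool"
  assumes "finite I" "\<And>i. i \<in> I \<Longrightarrow> polyhedron {x. P i x}"
  shows "polyhedron {x. \<forall>i\<in>I. P i x}"
proof -
  have "{x. \<forall>i\<in>I. P i x} = \<Inter> ((\<lambda>i. {x. P i x}) ` I)" by auto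
  then show ?thesis using assms by (auto intro!: polyhedron_Inter)
qed

lemma polyhedron_Collect_conj:
  "polyhedron {x. P x} \<Longrightarrow> polyhedron {x. Q x} \<Longrightarrow> polyhedron {x. P x \<and> Q x}"
  by (simp add: Collect_conj_eq)

lemma linear_state_mass: "linear (\<lambda>x. state_mass M x s)"
  by (rule linearI) (simp_all add: state_mass_def sum.distrib sum_distrib_left)

lemma linear_mass_flow: "linear (\<lambda>x. mass_flow M x s q)"
  by (rule linearI) (simp_all add: mass_flow_def sum.distrib sum_distrib_left algebra_simps)

lemma polyhedron_occ_feasible: "polyhedron (occ_feasible M R \<nu> \<mu>)"
proof -
  let ?D = "decision_states M R \<mu>"
  have nth: "linear (\<lambda>x :: real ^ ('a \<times> 'b). x $ i)" for i by (rule linearI) simp_all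
  define b :: "'a \<Rightarrow> real" where "b s = of_bool (s = start M)" for s
  have eq: "occ_feasible M R \<nu> \<mu> = {x. (\<forall>i\<in>{(s, a). \<not> (s \<in> ?D \<and> a \<in> avail M s)}. x $ i = 0) \<and>
      (\<forall>i\<in>{(s, a). s \<in> ?D \<and> a \<in> avail M s}. 0 \<le> x $ i) \<and>
      (\<forall>s\<in>?D. state_mass M x s - (\<Sum>q\<in>?D. mass_flow M x q s) = b s) \<and>
      \<nu> - (\<Sum>q\<in>R. b q) \<le> (\<Sum>q\<in>R. \<Sum>s\<in>?D. mass_flow M x s q)}"
    unfolding set_eq_iff occ_feasible_iff b_def[symmetric] by (auto simp: occ_domain_def sum.distrib)
  show ?thesis unfolding eq
    by (intro polyhedron_Collect_conj polyhedron_Collect_all polyhedron_linear_eq polyhedron_linear_ge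
        nth linear_compose_sub linear_compose_sum linear_state_mass linear_mass_flow ballI finite)
qed

text \<open>Both tangent bounds are taken at the common ratio \<open>(a1 + a2) / (b1 + b2)\<close>,
  for which the linear remainders cancel.\<close>

lemma log_sum_inequality:
  fixes a1 a2 b1 b2 :: real
  assumes "0 \<le> a1" "0 \<le> b1" "0 < a1 \<Longrightarrow> 0 < b1" "0 \<le> a2" "0 \<le> b2" "0 < a2 \<Longrightarrow> 0 < b2"
  shows "(a1 + a2) * ln ((a1 + a2) / (b1 + b2)) \<le> a1 * ln (a1 / b1) + a2 * ln (a2 / b2)"
proof (cases "a1 + a2 = 0")
  case True
  then have "a1 = 0" "a2 = 0" using assms by auto
  then show ?thesis by simp
next
  case False
  then have a: "0 < a1 + a2" using assms by linarith
  then have b: "0 < b1 + b2" using assms by (cases "0 < a1") auto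
  let ?r = "(a1 + a2) / (b1 + b2)"
  have r: "0 < ?r" using a b by simp
  have "a1 * ln ?r + a1 - b1 * ?r \<le> a1 * ln (a1 / b1)" "a2 * ln ?r + a2 - b2 * ?r \<le> a2 * ln (a2 / b2)"
    by (rule ln_ratio_lower_bound[OF assms(1-3) r] ln_ratio_lower_bound[OF assms(4-6) r]; assumption)+
  moreover have "b1 * ?r + b2 * ?r = a1 + a2" using b by (subst distrib_right[symmetric]) simp
  ultimately show ?thesis by (simp only: distrib_right)
qed

lemma occ_domain_convex: "convex (occ_domain M R \<mu>)"
  unfolding convex_def occ_domain_def by (auto intro!: add_nonneg_nonneg mult_nonneg_nonneg)

text \<open>Each term is \<open>a * ln (a / b)\<close> with \<open>a\<close> and \<open>b\<close>
  linear in \<open>x\<close>. This function is homogeneous of degree 1, so the log-sum inequality is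
  its joint convexity.\<close>

lemma occ_objective_convex:
  fixes M :: "('s::finite, 'a::finite) mdp"
  assumes M: "is_mdp M"
  shows "ereal_convex_on (occ_domain M R \<mu>) (occ_objective M R \<mu>)"
proof -
  let ?D = "decision_states M R \<mu>" and ?f = "occ_objective M R \<mu>"
  let ?t = "\<lambda>x s q. mass_flow M x s q * ln (mass_flow M x s q / (chain_prob M \<mu> s q * state_mass M x s))"
  have supp: "?f x < \<infinity> \<longleftrightarrow> (\<forall>s\<in>?D. \<forall>q. chain_prob M \<mu> s q = 0 \<longrightarrow> mass_flow M x s q = 0)" for x
    by (rule occ_objective_less_infinity_iff[OF M])
  have fin: "?f x = ereal (\<Sum>s\<in>?D. \<Sum>q\<in>UNIV. ?t x s q)" if "?f x < \<infinity>" for x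
    using that unfolding supp by (intro occ_objective_finite[OF M]) auto
  have nminf: "?f x \<noteq> -\<infinity>" for x
    using fin[of x] by (cases "?f x < \<infinity>") auto
  \<comment> \<open>Weight 0 is kept out: rescaling needs a positive factor, and 0 times an infinite
    value would be 0.\<close>
  have conv: "?f (u *\<^sub>R x + v *\<^sub>R y) \<le> ereal u * ?f x + ereal v * ?f y"
    if x: "x \<in> occ_domain M R \<mu>" and y: "y \<in> occ_domain M R \<mu>" and u: "0 < u" and v: "0 < v" for x y u v
  proof (cases "?f x < \<infinity> \<and> ?f y < \<infinity>")
    case True
    let ?z = "u *\<^sub>R x + v *\<^sub>R y"
    have m: "mass_flow M ?z s q = u * mass_flow M x s q + v * mass_flow M y s q" for s q
      by (simp add: mass_flow_def sum.distrib sum_distrib_left algebra_simps)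
    have X: "state_mass M ?z s = u * state_mass M x s + v * state_mass M y s" for s
      by (simp add: state_mass_def sum.distrib sum_distrib_left)
    have z: "?f ?z < \<infinity>" using True unfolding supp by (simp add: m)
    have scale: "r * a * ln (r * a / (r * b)) = r * (a * ln (a / b))" if "0 < r" for r a b :: real
      using that by simp
    have "?t ?z s q \<le> u * ?t x s q + v * ?t y s q" if s: "s \<in> ?D" for s q
    proof -
      have side: "0 \<le> mass_flow M w s q" "0 \<le> chain_prob M \<mu> s q * state_mass M w s"
        "0 < mass_flow M w s q \<Longrightarrow> 0 < chain_prob M \<mu> s q * state_mass M w s"
        if w: "w \<in> occ_domain M R \<mu>" "?f w < \<infinity>" for w
      proof -
        show "0 \<le> mass_flow M w s q" by (rule mass_flow_nonneg[OF M w(1) s])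
        show "0 \<le> chain_prob M \<mu> s q * state_mass M w s"
          by (intro mult_nonneg_nonneg chain_prob_nonneg[OF M] state_mass_nonneg[OF w(1) s])
        assume p: "0 < mass_flow M w s q"
        then have "chain_prob M \<mu> s q \<noteq> 0" using w(2) s unfolding supp by force
        then show "0 < chain_prob M \<mu> s q * state_mass M w s"
          using p mass_flow_le_state_mass[OF M w(1) s, of q] chain_prob_nonneg[OF M, of \<mu> s q]
          by (intro mult_pos_pos) auto
      qed
      have sx: "0 \<le> u * mass_flow M x s q" "0 \<le> u * (chain_prob M \<mu> s q * state_mass M x s)"
        "0 < u * mass_flow M x s q \<Longrightarrow> 0 < u * (chain_prob M \<mu> s q * state_mass M x s)"
        using side[OF x] True u by (auto simp: zero_less_mult_iff)
      have sy: "0 \<le> v * mass_flow M y s q" "0 \<le> v * (chain_prob M \<mu> s q * state_mass M y s)"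
        "0 < v * mass_flow M y s q \<Longrightarrow> 0 < v * (chain_prob M \<mu> s q * state_mass M y s)"
        using side[OF y] True v by (auto simp: zero_less_mult_iff)
      have "?t ?z s q \<le>
        u * mass_flow M x s q * ln (u * mass_flow M x s q / (u * (chain_prob M \<mu> s q * state_mass M x s))) +
        v * mass_flow M y s q * ln (v * mass_flow M y s q / (v * (chain_prob M \<mu> s q * state_mass M y s)))"
        using log_sum_inequality[OF sx sy] by (simp only: m X distrib_left mult.left_commute)
      then show ?thesis by (simp only: scale u v)
    qed
    then have "(\<Sum>s\<in>?D. \<Sum>q\<in>UNIV. ?t ?z s q) \<le> (\<Sum>s\<in>?D. \<Sum>q\<in>UNIV. u * ?t x s q + v * ?t y s q)"
      by (intro sum_mono) auto
    also have "\<dots> = u * (\<Sum>s\<in>?D. \<Sum>q\<in>UNIV. ?t x s q) + v * (\<Sum>s\<in>?D. \<Sum>q\<in>UNIV. ?t y s q)"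
      by (simp only: sum.distrib sum_distrib_left)
    finally show ?thesis unfolding fin[OF z] fin[OF conjunct1[OF True]] fin[OF conjunct2[OF True]] by simp
  next
    case False
    then have "ereal u * ?f x + ereal v * ?f y = \<infinity>"
      using u v nminf[of x] nminf[of y] by (cases "?f x"; cases "?f y") auto
    then show ?thesis by (metis ereal_less_eq(1))
  qed
  show ?thesis
    unfolding ereal_convex_on_def
  proof (intro conjI ballI allI impI)
    fix x y and u v :: real
    assume "x \<in> occ_domain M R \<mu>" "y \<in> occ_domain M R \<mu>" "0 \<le> u" "0 \<le> v" "u + v = 1"
    then show "?f (u *\<^sub>R x + v *\<^sub>R y) \<le> ereal u * ?f x + ereal v * ?f y"
      using conv[of x y u v] by (cases "u = 0"; cases "v = 0") (auto simp: zero_ereal_def[symmetric] one_ereal_def[symmetric])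
  qed (use nminf occ_domain_convex in auto)
qed

text \<open>Only 0 is delicate: the value there is 0 because of the factor \<open>t\<close>, and
  this is also the limit from the right.\<close>

lemma continuous_on_x_ln_x: "continuous_on {0..} (\<lambda>t::real. t * ln t)"
  unfolding continuous_on_eq_continuous_within
proof
  fix t :: real assume "t \<in> {0..}"
  show "continuous (at t within {0..}) (\<lambda>t. t * ln t)"
  proof (cases "t = 0")
    case True
    have "((\<lambda>t::real. t * ln t) \<longlongrightarrow> 0) (at_right 0)" by real_asymp
    moreover have "at 0 within {0..} = at_right (0::real)"
      by (rule at_within_nhd[of _ UNIV]) auto
    ultimately show ?thesis using True by (simp add: continuous_within)
  next
    case False
    then have "isCont (\<lambda>t. t * ln t) t" by (auto intro!: continuous_intros)
    then show ?thesis by (rule continuous_at_imp_continuous_within)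
  qed
qed

text \<open>
  Since the flows out of \<open>s\<close> sum to the mass at \<open>s\<close>, the objective is a sum of values of
  \<open>t * ln t\<close> at linear functions, hence continuous up to the boundary where masses vanish.
\<close>

lemma occ_objective_attains_min:
  fixes M :: "('s::finite, 'a::finite) mdp" and B :: real
    and R :: "'s set" and \<nu> :: real and \<mu> :: "'s \<Rightarrow> 'a pmf"
  assumes M: "is_mdp M"
  defines "K \<equiv> {x \<in> occ_feasible M R \<nu> \<mu>. occ_objective M R \<mu> x < \<infinity> \<and> (\<forall>i. x $ i \<le> B)}"
  assumes "K \<noteq> {}"
  obtains x where "x \<in> K" "\<And>y. y \<in> K \<Longrightarrow> occ_objective M R \<mu> x \<le> occ_objective M R \<mu> y"
proof -
  let ?D = "decision_states M R \<mu>" and ?f = "occ_objective M R \<mu>"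
  let ?g = "\<lambda>x. \<Sum>s\<in>?D. (\<Sum>q\<in>UNIV. mass_flow M x s q * ln (mass_flow M x s q)
      - mass_flow M x s q * ln (chain_prob M \<mu> s q)) - state_mass M x s * ln (state_mass M x s)"
  have dom: "x \<in> occ_domain M R \<mu>" if "x \<in> K" for x using that by (simp add: K_def occ_feasible_iff)
  have fg: "?f x = ereal (?g x)" if x: "x \<in> K" for x
  proof -
    have supp: "mass_flow M x s q = 0" if "s \<in> ?D" "chain_prob M \<mu> s q = 0" for s q
      using x that unfolding K_def occ_objective_less_infinity_iff[OF M] by auto
    have "(\<Sum>q\<in>UNIV. mass_flow M x s q * ln (mass_flow M x s q / (chain_prob M \<mu> s q * state_mass M x s)))
        = (\<Sum>q\<in>UNIV. mass_flow M x s q * ln (mass_flow M x s q)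
      - mass_flow M x s q * ln (chain_prob M \<mu> s q)) - state_mass M x s * ln (state_mass M x s)"
      if s: "s \<in> ?D" for s
    proof -
      \<comment> \<open>The logarithm is split only where the flow is nonzero, which forces the
        other two quantities to be nonzero; elsewhere both sides are 0.\<close>
      have "mass_flow M x s q * ln (mass_flow M x s q / (chain_prob M \<mu> s q * state_mass M x s))
        = mass_flow M x s q * ln (mass_flow M x s q) - mass_flow M x s q * ln (chain_prob M \<mu> s q)
          - mass_flow M x s q * ln (state_mass M x s)" for q
      proof (cases "mass_flow M x s q = 0")
        case False
        then have "chain_prob M \<mu> s q \<noteq> 0" "state_mass M x s \<noteq> 0"
          using supp[OF s] mass_flow_le_state_mass[OF M dom[OF x] s, of q]
            mass_flow_nonneg[OF M dom[OF x] s, of q] by auto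
        then show ?thesis using False by (simp add: ln_div ln_mult algebra_simps)
      qed simp
      then show ?thesis by (simp add: sum_subtractf sum_mass_flow[OF M] flip: sum_distrib_right)
    qed
    then show ?thesis using supp by (subst occ_objective_finite[OF M]) auto
  qed
  have cl: "continuous_on A (\<lambda>x. mass_flow M x s q)" "continuous_on A (\<lambda>x. state_mass M x s)" for A s q
    by (intro linear_continuous_on linear_conv_bounded_linear[THEN iffD1] linear_mass_flow linear_state_mass)+
  have "continuous_on K ?g"
  proof (intro continuous_on_sum continuous_on_diff)
    fix s assume s: "s \<in> ?D"
    show "continuous_on K (\<lambda>x. mass_flow M x s q * ln (chain_prob M \<mu> s q))" for q
      by (intro continuous_on_mult cl continuous_on_const)
    show "continuous_on K (\<lambda>x. mass_flow M x s q * ln (mass_flow M x s q))" for q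
      by (rule continuous_on_compose2[OF continuous_on_x_ln_x cl(1)])
         (use mass_flow_nonneg[OF M dom s] in auto)
    show "continuous_on K (\<lambda>x. state_mass M x s * ln (state_mass M x s))"
      by (rule continuous_on_compose2[OF continuous_on_x_ln_x cl(2)])
         (use state_mass_nonneg[OF dom s] in auto)
  qed
  moreover have "compact K"
  proof (rule compact_eq_bounded_closed[THEN iffD2], rule conjI)
    have "0 \<le> x $ i" if "x \<in> K" for x i
    proof (cases i)
      case (Pair s a)
      then show ?thesis using that by (cases "s \<in> ?D \<and> a \<in> avail M s")
        (auto simp: K_def occ_feasible_iff occ_domain_def)
    qed
    moreover have "x $ i \<le> B" if "x \<in> K" for x i using that unfolding K_def by blast
    ultimately have "K \<subseteq> cbox 0 (\<chi> i. B)" by (auto simp del: split_paired_All simp: mem_box_cart)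
    then show "bounded K" by (rule bounded_subset[OF bounded_cbox])
    have "K = occ_feasible M R \<nu> \<mu> \<inter>
        (\<Inter>s\<in>?D. \<Inter>q\<in>{q. chain_prob M \<mu> s q = 0}. {x. mass_flow M x s q = 0}) \<inter> (\<Inter>i. {x. x $ i \<le> B})"
      unfolding K_def occ_objective_less_infinity_iff[OF M] by auto
    moreover have "closed {x :: real ^ ('s \<times> 'a). mass_flow M x s q = 0}" for s q
      by (rule closed_Collect_eq[OF cl(1) continuous_on_const])
    moreover have "closed {x :: real ^ ('s \<times> 'a). x $ i \<le> B}" for i
      by (intro closed_Collect_le continuous_intros)
    ultimately show "closed K"
      using polyhedron_imp_closed[OF polyhedron_occ_feasible, of M R \<nu> \<mu>] by (auto intro!: closed_Int closed_INT)
  qed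
  ultimately obtain x where "x \<in> K" "\<forall>y\<in>K. ?g x \<le> ?g y"
    using continuous_attains_inf[of K ?g] assms(3) by blast
  then show thesis using that fg by auto
qed

theorem proposition3:
  fixes M :: "('s::finite, 'a::finite) mdp"
    and R :: "'s set" and \<nu> :: real
    and \<mu> :: "'s \<Rightarrow> 'a pmf"
  assumes "is_mdp M"
    and "\<forall>s\<in>R. absorbing M s"
    and "0 \<le> \<nu>" "\<nu> \<le> 1"
    and "\<mu> \<in> stationary_policies M"
    and "\<bar>optimal_value (KL_to_reference M \<mu>) (reaching_policies M R \<nu>)\<bar> \<noteq> \<infinity>"
  shows "convex_problem (occ_domain M R \<mu>) (occ_objective M R \<mu>) (occ_feasible M R \<nu> \<mu>)
    \<and> optimal_value (occ_objective M R \<mu>) (occ_feasible M R \<nu> \<mu>) =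
        optimal_value (KL_to_reference M \<mu>) (reaching_policies M R \<nu>)
    \<and> (\<exists>\<sigma>\<in>stationary_policies M.
        (\<forall>s\<in>decision_states M R \<mu>. \<forall>a\<in>avail M s. occupation M (stationary \<sigma>) s a < \<infinity>) \<and>
        occ_vector M R \<mu> (stationary \<sigma>) \<in> occ_feasible M R \<nu> \<mu> \<and>
        occ_objective M R \<mu> (occ_vector M R \<mu> (stationary \<sigma>)) =
          optimal_value (occ_objective M R \<mu>) (occ_feasible M R \<nu> \<mu>))"
proof -
  note M = assms(1) and R = assms(2) and \<mu> = assms(5)
  let ?D = "decision_states M R \<mu>" and ?f = "occ_objective M R \<mu>" and ?F = "occ_feasible M R \<nu> \<mu>"
  let ?KL = "KL_to_reference M \<mu>" and ?P = "reaching_policies M R \<nu>"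
  have dec: "?D = - closed_states M \<mu>" by (rule decision_states_eq[OF M R])
  have lower: "occ_vector M R \<mu> \<pi> \<in> ?F" "?f (occ_vector M R \<mu> \<pi>) \<le> ?KL \<pi>"
    if "\<pi> \<in> ?P" "?KL \<pi> < \<infinity>" for \<pi>
    using occ_objective_le_KL[OF M R \<mu> _ that(2)] that(1) by (auto simp: reaching_policies_def)
  have "(INF \<pi>\<in>?P. ?KL \<pi>) < \<infinity>" using assms(6) by (auto simp: optimal_value_def)
  then obtain \<pi>0 where \<pi>0: "\<pi>0 \<in> ?P" "?KL \<pi>0 < \<infinity>" unfolding INF_less_iff by blast
  let ?x0 = "occ_vector M R \<mu> \<pi>0"
  have x0: "?x0 \<in> ?F" "?f ?x0 < \<infinity>" using lower[OF \<pi>0] \<pi>0(2) by (auto intro: le_less_trans)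
  obtain c B where c: "0 < c" and bound: "\<And>\<pi> s n. \<pi> \<in> policies M \<Longrightarrow> ?KL \<pi> < \<infinity> \<Longrightarrow>
      s \<notin> closed_states M \<mu> \<Longrightarrow> ereal (c * (\<Sum>t<n. state_prob M \<pi> t s)) \<le> ?KL \<pi> + ereal B"
    by (rule state_prob_sum_bound[OF M \<mu>]) (rule that)
  \<comment> \<open>The level of one known feasible point; only points at or below it compete for
    the minimum.\<close>
  obtain V where V: "?f ?x0 = ereal V"
    using x0(2) unfolding occ_objective_less_infinity_iff[OF M]
    by (intro that[OF occ_objective_finite[OF M]]) blast
  \<comment> \<open>By \<open>bound\<close>, a policy of divergence at most \<open>V\<close> spends
    expected time at most \<open>(V + B) / c\<close> in each transient state. The maximum with 0
    takes care of the components that are fixed to zero.\<close>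
  define b where "b = max 0 ((V + B) / c)"
  define K where "K = {x \<in> ?F. ?f x < \<infinity> \<and> (\<forall>i. x $ i \<le> b)}"
  \<comment> \<open>The replacement is an occupation vector whose objective equals a divergence. A
    level for the objective thereby becomes a level for the divergence, to which the time bound
    applies.\<close>
  have improve: "\<exists>y\<in>K. ?f y \<le> ?f x" if x: "x \<in> ?F" "?f x \<le> ereal V" for x
  proof -
    have fx: "?f x < \<infinity>" using x(2) by (rule le_less_trans) simp
    obtain \<sigma> where \<sigma>: "\<sigma> \<in> stationary_policies M"
      and feas: "occ_vector M R \<mu> (stationary \<sigma>) \<in> ?F"
      and KL: "?KL (stationary \<sigma>) = ?f (occ_vector M R \<mu> (stationary \<sigma>))"
      and le: "?f (occ_vector M R \<mu> (stationary \<sigma>)) \<le> ?f x"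
      by (rule stationary_policy_improves[OF M R \<mu> x(1) fx]) (rule that; assumption)
    let ?y = "occ_vector M R \<mu> (stationary \<sigma>)"
    note \<sigma>p = stationary_in_policies[OF \<sigma>]
    have yV: "?KL (stationary \<sigma>) \<le> ereal V" using KL le x(2) by simp
    then have fin: "?KL (stationary \<sigma>) < \<infinity>" by (rule le_less_trans) simp
    have ac: "chain_prob M \<mu> s q = 0 \<Longrightarrow> flow M (stationary \<sigma>) t s q = 0" for t s q
      by (rule flow_eq_0_if_chain_prob_eq_0[OF M \<mu> \<sigma>p KL_to_reference_finiteD(1)[OF fin]])
    have summ: "s \<notin> closed_states M \<mu> \<Longrightarrow> summable (\<lambda>t. state_prob M (stationary \<sigma>) t s)" for s
      by (rule summable_state_prob[OF M \<mu> \<sigma>p fin])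
    have "?y $ (s, a) \<le> b" for s a
    proof (cases "s \<in> ?D \<and> a \<in> avail M s")
      case True
      then have s: "s \<notin> closed_states M \<mu>" by (simp add: dec)
      have "?y $ (s, a) \<le> state_mass M ?y s"
        unfolding state_mass_def using True feas
        by (intro member_le_sum) (auto simp: occ_feasible_iff occ_domain_def)
      also have "\<dots> = (\<Sum>t. state_prob M (stationary \<sigma>) t s)"
        by (rule state_mass_occ_vector[OF M R \<sigma>p ac summ s])
      also have "\<dots> \<le> (V + B) / c"
      proof (rule suminf_le_const[OF summ[OF s]])
        fix n
        have "ereal (c * (\<Sum>t<n. state_prob M (stationary \<sigma>) t s)) \<le> ereal V + ereal B"
          using bound[OF \<sigma>p fin s, of n] yV by (meson add_right_mono order_trans)
        then show "(\<Sum>t<n. state_prob M (stationary \<sigma>) t s) \<le> (V + B) / c"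
          using c by (simp add: pos_le_divide_eq mult.commute)
      qed
      finally show ?thesis by (simp add: b_def)
    next
      case False
      then have "?y $ (s, a) = 0" using feas by (simp add: occ_feasible_iff)
      then show ?thesis by (simp add: b_def)
    qed
    then have "?y \<in> K" using feas fin KL by (auto simp: K_def)
    then show ?thesis using le by blast
  qed
  have "K \<noteq> {}" using improve[OF x0(1)] V by auto
  then obtain x where xK: "x \<in> K" and xmin: "\<And>y. y \<in> K \<Longrightarrow> ?f x \<le> ?f y"
    by (rule occ_objective_attains_min[OF M, where R=R and \<nu>=\<nu> and \<mu>=\<mu> and B=b, folded K_def])
      (rule that)
  have xF: "x \<in> ?F" "?f x < \<infinity>" using xK by (auto simp: K_def)
  \<comment> \<open>A feasible point above the level \<open>V\<close> is beaten by the replacement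
    of \<open>?x0\<close>.\<close>
  have opt: "?f x \<le> ?f z" if z: "z \<in> ?F" for z
  proof -
    have "\<exists>y\<in>K. ?f y \<le> ?f z"
    proof (cases "?f z \<le> ereal V")
      case True
      then show ?thesis by (rule improve[OF z])
    next
      case False
      then have Vz: "ereal V \<le> ?f z" by simp
      obtain y where "y \<in> K" "?f y \<le> ?f ?x0" using improve[OF x0(1)] V by auto
      then show ?thesis using Vz unfolding V by (meson order_trans)
    qed
    then show ?thesis using xmin order_trans by blast
  qed
  \<comment> \<open>The minimizer over \<open>K\<close> need not be an occupation vector, so it is
    improved once more; the resulting policy attains both optimal values.\<close>
  obtain \<sigma> where \<sigma>: "\<sigma> \<in> stationary_policies M" "stationary \<sigma> \<in> ?P"
    and occ: "\<And>s a. s \<in> ?D \<Longrightarrow> occupation M (stationary \<sigma>) s a < \<infinity>"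
    and feas: "occ_vector M R \<mu> (stationary \<sigma>) \<in> ?F"
    and KL: "?KL (stationary \<sigma>) = ?f (occ_vector M R \<mu> (stationary \<sigma>))"
    and le: "?f (occ_vector M R \<mu> (stationary \<sigma>)) \<le> ?f x"
    by (rule stationary_policy_improves[OF M R \<mu> xF]) (rule that)
  let ?y = "occ_vector M R \<mu> (stationary \<sigma>)"
  have val: "optimal_value ?f ?F = ?f ?y"
    unfolding optimal_value_def
    by (rule antisym) (auto intro!: INF_lower INF_greatest feas order_trans[OF le] opt)
  have val': "optimal_value ?KL ?P = ?f ?y"
    unfolding optimal_value_def
  proof (rule antisym)
    show "(INF \<pi>\<in>?P. ?KL \<pi>) \<le> ?f ?y" using INF_lower[OF \<sigma>(2), of ?KL] KL by simp
    show "?f ?y \<le> (INF \<pi>\<in>?P. ?KL \<pi>)"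
    proof (rule INF_greatest)
      fix \<pi> assume \<pi>: "\<pi> \<in> ?P"
      show "?f ?y \<le> ?KL \<pi>"
      proof (cases "?KL \<pi> < \<infinity>")
        case True
        then show ?thesis using lower[OF \<pi> True] le opt by (meson order_trans)
      qed simp
    qed
  qed
  have "convex_problem (occ_domain M R \<mu>) ?f ?F"
    unfolding convex_problem_def using polyhedron_occ_feasible occ_objective_convex[OF M]
    by (auto simp: occ_feasible_iff)
  then show ?thesis using val val' \<sigma>(1) occ feas by (intro conjI bexI[of _ \<sigma>]) auto
qed

end
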